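(* Let $n\ge1$ and let $K$ be either the Poisson kernel or the heat kernel on $\mathbb{R}^n$. For any non-negative measurable function $f$ on $(0,\infty)$ and any numbers $\delta,\tilde\delta,p$ with $1<\tilde\delta<\delta$ and $1<p\le\infty$, we have $$\mathbf{D}_{p,K}(x;\tilde\delta,f,n)\le \mathbf{D}_p(x;\delta,f)\qquad\text{for all }x\in\Omega_{p,\tilde\delta}.$$
   Context: For $y\in\mathbb{R}^n$, $t>0$: $P_t(y)=\frac{\Gamma(\frac{n+1}2)}{\pi^{(n+1)/2}}\frac{t}{(t^2+|y|^2)^{(n+1)/2}}$, $H_t(y)=(4\pi t)^{-n/2}e^{-|y|^2/(4t)}$; $K_t$ is either one. For $g$ on $\mathbb{R}^n$ and $z=(y,t)\in\mathbb{R}^n\times(0,\infty)$, $g(z):=(K_t*g)(y)$; e.g. $w^{-1/(p-1)}(z)$, $\log w(z)$, $(f\circ w)(z)$ are $K$-extensions of $w^{-1/(p-1)}$, $\log w$, $f\circ w$. A weight is an a.e. positive locally integrable function. For a finite interval $I$ and a weight $v$ on $I$: $\langle v\rangle_J=\frac1{|J|}\int_Jv$; for $1<p<\infty$, $[v]_{p,I}=\sup_{J\subset I}\langle v\rangle_J\langle v^{-1/(p-1)}\rangle_J^{p-1}$, and $[v]_{\infty,I}=\sup_{J\subset I}\langle v\rangle_Je^{-\langle\log v\rangle_J}$ (sup over subintervals $J$). For a weight $w$ on $\mathbb{R}^n$: $[w]^K_p=\sup_{z}w(z)[w^{-1/(p-1)}(z)]^{p-1}$ ($1<p<\infty$), $[w]^K_\infty=\sup_z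 w(z)e^{-\log w(z)}$, sup over $z\in\mathbb{R}^{n+1}_+$. Domains: for $1<p<\infty$, $\Omega_{p,\delta}=\{x\in\mathbb{R}^2: x_1>0,x_2>0,1\le x_1x_2^{p-1}\le\delta\}$; $\Omega_{\infty,\delta}=\{x\in\mathbb{R}^2: x_1>0, 1\le x_1e^{-x_2}\le\delta\}$. Bellman functions (independent of $I$, resp. $z$): for $1<p<\infty$, $\mathbf{D}_p(x;\delta,f)=\sup\{\langle f\circ v\rangle_I: [v]_{p,I}\le\delta,\ \langle v\rangle_I=x_1,\ \langle v^{-1/(p-1)}\rangle_I=x_2\}$ and $\mathbf{D}_{p,K}(x;\delta,f,n)=\sup\{(f\circ w)(z): [w]^K_p\le\delta,\ w(z)=x_1,\ w^{-1/(p-1)}(z)=x_2\}$; for $p=\infty$, $\mathbf{D}_\infty(x;\delta,f)=\sup\{\langle f\circ v\rangle_I:[v]_{\infty,I}\le\delta,\ \langle v\rangle_I=x_1,\ \langle\log v\rangle_I=x_2\}$ and $\mathbf{D}_{\infty,K}(x;\delta,f,n)=\sup\{(f\circ w)(z):[w]^K_\infty\le\delta,\ w(z)=x_1,\ \log w(z)=x_2\}$. *)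

theory Defs
  imports "HOL-Analysis.Analysis"
begin

datatype kernel = Poisson | Heat

definition kern :: "kernel \<Rightarrow> real \<Rightarrow> real^'n::finite \<Rightarrow> real" where
  "kern K t y = (case K of
     Poisson \<Rightarrow> Gamma ((real CARD('n) + 1) / 2) / (pi powr ((real CARD('n) + 1) / 2))
                 * t / ((t\<^sup>2 + (norm y)\<^sup>2) powr ((real CARD('n) + 1) / 2))
   | Heat \<Rightarrow> (4 * pi * t) powr (- real CARD('n) / 2) * exp (- (norm y)\<^sup>2 / (4 * t)))"

definition Kint :: "kernel \<Rightarrow> (real^'n::finite \<Rightarrow> real) \<Rightarrow> real^'n \<Rightarrow> real \<Rightarrow> bool" where
  "Kint K g y t = integrable lborel (\<lambda>u. kern K t (y - u) * g u)"

definition Kext :: "kernel \<Rightarrow> (real^'n::finite \<Rightarrow> real) \<Rightarrow> real^'n \<Rightarrow> real \<Rightarrow> real" where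
  "Kext K g y t = integral\<^sup>L lborel (\<lambda>u. kern K t (y - u) * g u)"

definition Kext_nn :: "kernel \<Rightarrow> (real^'n::finite \<Rightarrow> real) \<Rightarrow> real^'n \<Rightarrow> real \<Rightarrow> ennreal" where
  "Kext_nn K g y t = (\<integral>\<^sup>+ u. ennreal (kern K t (y - u) * g u) \<partial>lborel)"

definition weight_Rn :: "(real^'n::finite \<Rightarrow> real) \<Rightarrow> bool" where
  "weight_Rn w \<longleftrightarrow> w \<in> borel_measurable lborel \<and> (AE u in lborel. 0 < w u)
     \<and> (\<forall>C. compact C \<longrightarrow> set_integrable lborel C w)"

text \<open>[w]^K_p \<le> delta, p \<in> (1,\<infinity>]; the supremum being \<le> delta includes that all
  the K-extensions involved are finite (well defined).\<close>
definition ApK :: "kernel \<Rightarrow> ereal \<Rightarrow> real \<Rightarrow> (real^'n::finite \<Rightarrow> real) \<Rightarrow> bool" where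
  "ApK K p \<delta> w \<longleftrightarrow> weight_Rn w \<and>
    (if p = \<infinity> then
       (\<forall>y t. 0 < t \<longrightarrow> Kint K w y t \<and> Kint K (\<lambda>u. ln (w u)) y t \<and>
          Kext K w y t * exp (- Kext K (\<lambda>u. ln (w u)) y t) \<le> \<delta>)
     else
       (\<forall>y t. 0 < t \<longrightarrow> Kint K w y t \<and> Kint K (\<lambda>u. w u powr (-1 / (real_of_ereal p - 1))) y t \<and>
          Kext K w y t * Kext K (\<lambda>u. w u powr (-1 / (real_of_ereal p - 1))) y t
             powr (real_of_ereal p - 1) \<le> \<delta>))"

definition avg :: "(real \<Rightarrow> real) \<Rightarrow> real \<Rightarrow> real \<Rightarrow> real" where
  "avg v c d = (LINT s:{c..d}|lborel. v s) / (d - c)"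

definition Ap_int :: "ereal \<Rightarrow> real \<Rightarrow> (real \<Rightarrow> real) \<Rightarrow> real \<Rightarrow> real \<Rightarrow> bool" where
  "Ap_int p \<delta> v a b \<longleftrightarrow> a < b \<and> (AE s in lborel. s \<in> {a..b} \<longrightarrow> 0 < v s)
     \<and> set_integrable lborel {a..b} v \<and>
    (if p = \<infinity> then
       set_integrable lborel {a..b} (\<lambda>s. ln (v s)) \<and>
       (\<forall>c d. a \<le> c \<and> c < d \<and> d \<le> b \<longrightarrow>
          avg v c d * exp (- avg (\<lambda>s. ln (v s)) c d) \<le> \<delta>)
     else
       set_integrable lborel {a..b} (\<lambda>s. v s powr (-1 / (real_of_ereal p - 1))) \<and>
       (\<forall>c d. a \<le> c \<and> c < d \<and> d \<le> b \<longrightarrow>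
          avg v c d * avg (\<lambda>s. v s powr (-1 / (real_of_ereal p - 1))) c d
             powr (real_of_ereal p - 1) \<le> \<delta>))"

definition Omega :: "ereal \<Rightarrow> real \<Rightarrow> real \<times> real \<Rightarrow> bool" where
  "Omega p \<delta> x \<longleftrightarrow> (if p = \<infinity> then
       0 < fst x \<and> 1 \<le> fst x * exp (- snd x) \<and> fst x * exp (- snd x) \<le> \<delta>
     else 0 < fst x \<and> 0 < snd x \<and> 1 \<le> fst x * snd x powr (real_of_ereal p - 1)
        \<and> fst x * snd x powr (real_of_ereal p - 1) \<le> \<delta>)"

definition dual_fn :: "ereal \<Rightarrow> real \<Rightarrow> real" where
  "dual_fn p s = (if p = \<infinity> then ln s else s powr (-1 / (real_of_ereal p - 1)))"

definition Dp :: "ereal \<Rightarrow> real \<Rightarrow> (real \<Rightarrow> real) \<Rightarrow> real \<times> real \<Rightarrow> ennreal" where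
  "Dp p \<delta> f x = Sup {ennreal (1 / (b - a)) * (\<integral>\<^sup>+ s. ennreal (f (v s)) * indicator {a..b} s \<partial>lborel)
     | a b v. Ap_int p \<delta> v a b \<and> avg v a b = fst x \<and> avg (\<lambda>s. dual_fn p (v s)) a b = snd x}"

definition DpK :: "kernel \<Rightarrow> 'n::finite itself \<Rightarrow> ereal \<Rightarrow> real \<Rightarrow> (real \<Rightarrow> real) \<Rightarrow> real \<times> real \<Rightarrow> ennreal" where
  "DpK K _ p \<delta> f x = Sup {Kext_nn K (\<lambda>u. f (w u)) y t
     | (w :: real^'n \<Rightarrow> real) y t. 0 < t \<and> ApK K p \<delta> w \<and> Kext K w y t = fst x
        \<and> Kext K (\<lambda>u. dual_fn p (w u)) y t = snd x}"

end

theory Submission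
  imports Defs "HOL-Probability.Probability"
begin

text \<open>
  Under the probability measure with density \<open>kern K t (y - u)\<close>, let \<open>v\<close> be the quantile function of
  the weight \<open>w\<close> on \<open>(0,1)\<close>. All averages of functions of \<open>w\<close> are reproduced by \<open>v\<close>, so it suffices
  that \<open>v\<close> satisfies the interval condition with constant \<open>\<delta>'\<close>.

  A point \<open>x\<close> lies below the upper boundary of the domain iff it lies below one of its tangents, which are
  indexed by a scale \<open>s > 0\<close>; on the lower boundary curve \<open>\<tau> \<mapsto> (\<tau>, dual_fn p \<tau>)\<close> the tangent form is
  a function of \<open>\<tau> / s\<close> alone, decreasing and then increasing. Hence clipping \<open>w\<close> to an interval
  \<open>[\<alpha>, \<beta>]\<close> preserves the kernel condition. To treat the average of \<open>v\<close> over \<open>[c, d]\<close>, clip \<open>w\<close> to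
  \<open>[v c, v d]\<close> and take the tangents \<open>s1\<close> through the point of \<open>\<alpha> = v c\<close> and \<open>s2\<close> through the point
  of \<open>\<beta> = v d\<close>. If they cross, the whole arc over \<open>[\<alpha>, \<beta>]\<close> lies below one tangent. Otherwise a maximum
  principle shows that the extension of the clipped weight stays below some tangent with \<open>s1 \<le> s \<le> s2\<close>;
  both end points of the arc lie above that tangent, so discarding their contribution leaves the average
  over \<open>[c, d]\<close> below it.

  The maximum principle concerns two extensions \<open>h\<close>, \<open>m\<close> such that \<open>h \<le> 0\<close> wherever \<open>m = 0\<close>: the positive
  part of \<open>h\<close>, cut off where \<open>m \<le> 0\<close>, is subharmonic (subcaloric), so it vanishes if its
  boundary values do.
\<close>

section \<open>The kernels\<close>

text \<open>The obstacle is twofold: the domain is not convex, and an interval \<open>[c, d]\<close>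
  corresponds to a slice of the values of \<open>w\<close>, which is not a kernel average, so the
  hypothesis says nothing about it directly. The part of the domain above a tangent splits into two
  pieces, one on each side of the point of tangency. As \<open>(y, t)\<close> varies, the averages
  of the clipped weight move continuously inside the domain and cannot pass from one piece to the
  other; with h the excess over the tangent and m the signed side, this is what the maximum
  principle exploits. The tangent \<open>s1\<close> meets the arc at its lower end, so the arc
  exceeds it only at parameters beyond \<open>s1\<close>; hence an average exceeding it lies in the
  corresponding piece, which says that the optimal scale of that average is at least
  \<open>s1\<close>. Symmetrically for \<open>s2\<close>. The tangent of the optimal scale always
  lies above the average, so one of \<open>s1\<close>, \<open>s2\<close> and the optimal scale lies
  between \<open>s1\<close> and \<open>s2\<close> and is good.\<close>

lemma nn_integral_gauss_real:
  fixes s :: real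
  assumes "s > 0"
  shows "(\<integral>\<^sup>+ x. ennreal (exp (- s * x\<^sup>2)) \<partial>lborel) = ennreal (sqrt (pi / s))"
proof -
  define \<sigma> where "\<sigma> = sqrt (1 / (2 * s))"
  have \<sigma>: "\<sigma> > 0" "\<sigma>\<^sup>2 = 1 / (2 * s)"
    using assms by (auto simp: \<sigma>_def)
  have eq: "exp (- s * x\<^sup>2) = sqrt (pi / s) * normal_density 0 \<sigma> x" for x
    using assms unfolding normal_density_def \<sigma>(2) by (simp add: real_sqrt_divide)
  have "integrable lborel (\<lambda>x. exp (- s * x\<^sup>2))"
    unfolding eq using \<sigma> by (intro integrable_mult_right integrable_normal_density) auto
  moreover have "(LINT x|lborel. exp (- s * x\<^sup>2)) = sqrt (pi / s)"
    unfolding eq using \<sigma> by simp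
  ultimately show ?thesis
    by (subst nn_integral_eq_integral) auto
qed

lemma nn_integral_gauss_vec:
  fixes s :: real
  assumes "s > 0"
  shows "(\<integral>\<^sup>+ (y::real^'n). ennreal (exp (- s * (norm y)\<^sup>2)) \<partial>lborel)
           = ennreal ((pi / s) powr (real CARD('n) / 2))"
proof -
  have "ennreal (exp (- s * (norm y)\<^sup>2)) = (\<Prod>b\<in>Basis. ennreal (exp (- s * (y \<bullet> b)\<^sup>2)))"
    for y :: "real^'n"
  proof -
    have "(norm y)\<^sup>2 = (\<Sum>b\<in>Basis. (y \<bullet> b)\<^sup>2)"
      unfolding power2_norm_eq_inner by (subst euclidean_inner) (simp add: power2_eq_square)
    then show ?thesis
      by (simp add: sum_distrib_left exp_sum prod_ennreal sum_negf flip: exp_sum)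
  qed
  then have "(\<integral>\<^sup>+ (y::real^'n). ennreal (exp (- s * (norm y)\<^sup>2)) \<partial>lborel)
      = (\<Prod>b\<in>(Basis::(real^'n) set). ennreal (sqrt (pi / s)))"
    using nn_integral_lborel_prod[of "\<lambda>(b::real^'n) x. ennreal (exp (- s * x\<^sup>2))"]
    by (simp only: nn_integral_gauss_real[OF assms]) simp
  also have "\<dots> = ennreal (sqrt (pi / s) ^ CARD('n))"
    using assms by (simp add: ennreal_power)
  also have "sqrt (pi / s) ^ CARD('n) = (pi / s) powr (real CARD('n) / 2)"
    using assms by (simp add: powr_half_sqrt[symmetric] powr_powr flip: powr_realpow)
  finally show ?thesis .
qed

lemma nn_integral_lborel_affine_vec:
  fixes f :: "'a::euclidean_space \<Rightarrow> ennreal" and c :: real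
  assumes [measurable]: "f \<in> borel_measurable borel" and "c \<noteq> 0"
  shows "(\<integral>\<^sup>+ x. f x \<partial>lborel) = ennreal (\<bar>c\<bar> ^ DIM('a)) * (\<integral>\<^sup>+ x. f (y + c *\<^sub>R x) \<partial>lborel)"
  by (subst lborel_affine[OF assms(2), of y])
     (simp add: nn_integral_density nn_integral_distr nn_integral_cmult ennreal_power)

lemma kern_pos: "t > 0 \<Longrightarrow> kern K t y > 0"
  by (cases K) (auto simp: kern_def intro!: mult_pos_pos divide_pos_pos Gamma_real_pos
      powr_gt_zero[THEN iffD2] add_pos_nonneg)

lemma measurable_kern [measurable]: "kern K t \<in> borel_measurable borel"
  by (cases K) (simp_all add: kern_def[abs_def])

lemma kern_minus [simp]: "kern K t (- y) = kern K t y"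
  by (cases K) (simp_all add: kern_def)

lemma tendsto_kern:
  assumes "(Y \<longlongrightarrow> y) F" "(T \<longlongrightarrow> t) F" "t > 0"
  shows "((\<lambda>i. kern K (T i) (Y i)) \<longlongrightarrow> kern K t y) F"
proof -
  have "t\<^sup>2 + (norm y)\<^sup>2 \<noteq> 0"
    using assms(3) by (smt (verit) zero_le_power2 zero_less_power)
  then show ?thesis
    unfolding kern_def using assms
    by (cases K) (auto intro!: tendsto_intros)
qed

lemma nn_integral_kern_Heat:
  assumes "t > 0"
  shows "(\<integral>\<^sup>+ y. ennreal (kern Heat t (y::real^'n::finite)) \<partial>lborel) = 1"
proof -
  have "(\<integral>\<^sup>+ y. ennreal (kern Heat t (y::real^'n)) \<partial>lborel)
      = ennreal ((4 * pi * t) powr (- real CARD('n) / 2))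
         * (\<integral>\<^sup>+ (y::real^'n). ennreal (exp (- (1/(4*t)) * (norm y)\<^sup>2)) \<partial>lborel)"
    by (simp add: kern_def ennreal_mult' nn_integral_cmult)
  also have "\<dots> = ennreal ((4 * pi * t) powr (- real CARD('n) / 2) * (4 * pi * t) powr (real CARD('n) / 2))"
    using assms by (subst nn_integral_gauss_vec) (auto simp: ennreal_mult' mult_ac)
  also have "\<dots> = 1"
    using assms by (simp flip: powr_add)
  finally show ?thesis .
qed

text \<open>A negative power of \<open>A\<close> as a mixture of exponentials in \<open>A\<close>.
  With A = t^2 + |y|^2 it turns the Poisson kernel into a superposition of Gaussians.\<close>

lemma Gamma_scaled:
  fixes m A :: real
  assumes "m > 0" "A > 0"
  shows "(\<integral>\<^sup>+ s. ennreal (indicator {0<..} s * s powr (m - 1) * exp (- s * A)) \<partial>lborel)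
       = ennreal (Gamma m / A powr m)"
proof -
  have "ennreal (Gamma m) = (\<integral>\<^sup>+ t. ennreal (indicator {0..} t * t powr (m - 1) / exp t) \<partial>lborel)"
    by (rule Gamma_conv_nn_integral_real) fact
  also have "\<dots> = (\<integral>\<^sup>+ t. ennreal (indicator {0<..} t * t powr (m - 1) * exp (- t)) \<partial>lborel)"
    by (intro nn_integral_cong_AE AE_I'[of "{0}"]) (auto simp: indicator_def exp_minus field_simps)
  also have "\<dots> = ennreal A * (\<integral>\<^sup>+ s. ennreal (indicator {0<..} (0 + A * s) * (0 + A * s) powr (m - 1) * exp (- (0 + A * s))) \<partial>lborel)"
    using assms by (subst nn_integral_real_affine[where c = A and t = 0]) auto
  also have "(\<integral>\<^sup>+ s. ennreal (indicator {0<..} (0 + A * s) * (0 + A * s) powr (m - 1) * exp (- (0 + A * s))) \<partial>lborel)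
     = (\<integral>\<^sup>+ s. ennreal (A powr (m - 1)) * ennreal (indicator {0<..} s * s powr (m - 1) * exp (- s * A)) \<partial>lborel)"
    using assms by (intro nn_integral_cong)
      (auto simp: indicator_def powr_mult zero_less_mult_iff mult_ac simp flip: ennreal_mult')
  also have "\<dots> = ennreal (A powr (m - 1)) * (\<integral>\<^sup>+ s. ennreal (indicator {0<..} s * s powr (m - 1) * exp (- s * A)) \<partial>lborel)"
    by (intro nn_integral_cmult) simp
  finally have eq: "ennreal (Gamma m) = ennreal (A powr m) * (\<integral>\<^sup>+ s. ennreal (indicator {0<..} s * s powr (m - 1) * exp (- s * A)) \<partial>lborel)"
    using assms by (simp add: mult.assoc[symmetric] powr_diff flip: ennreal_mult')
  have "ennreal (Gamma m / A powr m) = ennreal (1 / A powr m) * ennreal (Gamma m)"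
    by (subst ennreal_mult'[symmetric]) auto
  also have "\<dots> = ennreal (1 / A powr m * A powr m) * (\<integral>\<^sup>+ s. ennreal (indicator {0<..} s * s powr (m - 1) * exp (- s * A)) \<partial>lborel)"
    unfolding eq by (simp add: mult.assoc[symmetric] flip: ennreal_mult')
  finally show ?thesis
    using assms by simp
qed

text \<open>Subordination: after \<open>Gamma_scaled\<close> and an exchange of integrals, the
  integral over \<open>y\<close> is Gaussian and contributes \<open>(pi / s) powr (m - 1/2)\<close>.
  What remains in \<open>s\<close> is again a Gamma integral, now of exponent 1/2, and Gamma (1/2)
  is the square root of pi.\<close>

lemma nn_integral_kern_Poisson:
  assumes "t > 0"
  shows "(\<integral>\<^sup>+ y. ennreal (kern Poisson t (y::real^'n::finite)) \<partial>lborel) = 1"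
proof -
  define m where "m = (real CARD('n) + 1) / 2"
  have m: "m > 0" by (simp add: m_def)
  have pos: "t\<^sup>2 + (norm y)\<^sup>2 > 0" for y :: "real^'n"
    using assms by (simp add: add_pos_nonneg)
  have "(\<integral>\<^sup>+ y. ennreal (kern Poisson t (y::real^'n)) \<partial>lborel)
     = (\<integral>\<^sup>+ (y::real^'n). ennreal (t / pi powr m) * ennreal (Gamma m / (t\<^sup>2 + (norm y)\<^sup>2) powr m) \<partial>lborel)"
    using assms by (intro nn_integral_cong) (simp add: kern_def m_def flip: ennreal_mult')
  also have "\<dots> = ennreal (t / pi powr m) * (\<integral>\<^sup>+ (y::real^'n). ennreal (Gamma m / (t\<^sup>2 + (norm y)\<^sup>2) powr m) \<partial>lborel)"
    by (intro nn_integral_cmult) simp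
  also have "(\<integral>\<^sup>+ (y::real^'n). ennreal (Gamma m / (t\<^sup>2 + (norm y)\<^sup>2) powr m) \<partial>lborel)
     = (\<integral>\<^sup>+ (y::real^'n). (\<integral>\<^sup>+ s. ennreal (indicator {0<..} s * s powr (m - 1) * exp (- s * (t\<^sup>2 + (norm y)\<^sup>2))) \<partial>lborel) \<partial>lborel)"
    by (intro nn_integral_cong Gamma_scaled[symmetric] m pos)
  also have "\<dots> = (\<integral>\<^sup>+ s. (\<integral>\<^sup>+ (y::real^'n). ennreal (indicator {0<..} s * s powr (m - 1) * exp (- s * (t\<^sup>2 + (norm y)\<^sup>2))) \<partial>lborel) \<partial>lborel)"
    by (rule lborel_pair.Fubini') simp
  also have "\<dots> = (\<integral>\<^sup>+ s. ennreal (pi powr (m - 1/2)) * ennreal (indicator {0<..} s * s powr (1/2 - 1) * exp (- s * t\<^sup>2)) \<partial>lborel)"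
  proof (intro nn_integral_cong)
    fix s :: real
    show "(\<integral>\<^sup>+ (y::real^'n). ennreal (indicator {0<..} s * s powr (m - 1) * exp (- s * (t\<^sup>2 + (norm y)\<^sup>2))) \<partial>lborel)
       = ennreal (pi powr (m - 1/2)) * ennreal (indicator {0<..} s * s powr (1/2 - 1) * exp (- s * t\<^sup>2))"
    proof (cases "s > 0")
      case True
      have "(\<integral>\<^sup>+ (y::real^'n). ennreal (indicator {0<..} s * s powr (m - 1) * exp (- s * (t\<^sup>2 + (norm y)\<^sup>2))) \<partial>lborel)
        = (\<integral>\<^sup>+ (y::real^'n). ennreal (s powr (m - 1) * exp (- s * t\<^sup>2)) * ennreal (exp (- s * (norm y)\<^sup>2)) \<partial>lborel)"
        using True by (intro nn_integral_cong)
          (simp add: ring_distribs exp_add exp_diff exp_minus field_simps flip: ennreal_mult')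
      also have "\<dots> = ennreal (s powr (m - 1) * exp (- s * t\<^sup>2)) * ennreal ((pi / s) powr (real CARD('n) / 2))"
        by (subst nn_integral_cmult) (simp_all add: nn_integral_gauss_vec[OF True, unfolded mult_minus_left] )
      also have "\<dots> = ennreal (s powr (m - 1) * exp (- s * t\<^sup>2) * (pi / s) powr (m - 1/2))"
        by (subst ennreal_mult'[symmetric]) (simp_all add: m_def add_divide_distrib)
      also have "s powr (m - 1) * exp (- s * t\<^sup>2) * (pi / s) powr (m - 1/2)
         = pi powr (m - 1/2) * (s powr (1/2 - 1) * exp (- s * t\<^sup>2))"
      proof -
        have "s powr (m - 1) / s powr (m - 1/2) = s powr (1/2 - 1)"
          by (simp flip: powr_diff)
        then show ?thesis
          using True by (simp add: powr_divide field_simps)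
      qed
      finally show ?thesis
        using True by (simp add: ennreal_mult')
    qed simp
  qed
  also have "\<dots> = ennreal (pi powr (m - 1/2)) * (\<integral>\<^sup>+ s. ennreal (indicator {0<..} s * s powr (1/2 - 1) * exp (- s * t\<^sup>2)) \<partial>lborel)"
    by (intro nn_integral_cmult) simp
  also have "(\<integral>\<^sup>+ s. ennreal (indicator {0<..} s * s powr (1/2 - 1) * exp (- s * t\<^sup>2)) \<partial>lborel)
      = ennreal (Gamma (1/2) / (t\<^sup>2) powr (1/2))"
    using assms by (intro Gamma_scaled) auto
  also have "\<dots> = ennreal (pi powr (1/2) / t)"
    using assms by (simp add: Gamma_one_half_real powr_half_sqrt)
  also have "ennreal (t / pi powr m) * (ennreal (pi powr (m - 1/2)) * ennreal (pi powr (1/2) / t))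
     = ennreal (t / pi powr m * (pi powr (m - 1/2) * (pi powr (1/2) / t)))"
    using assms by (simp flip: ennreal_mult')
  also have "t / pi powr m * (pi powr (m - 1/2) * (pi powr (1/2) / t)) = 1"
    using assms by (simp add: powr_diff)
  finally show ?thesis by simp
qed

lemma nn_integral_kern_affine:
  fixes y :: "real^'n::finite"
  assumes "t > 0"
  shows "(\<integral>\<^sup>+ u. ennreal (kern K t (y - u)) \<partial>lborel) = 1"
proof -
  have "(\<integral>\<^sup>+ (u::real^'n). ennreal (kern K t u) \<partial>lborel) = (\<integral>\<^sup>+ u. ennreal (kern K t (y - u)) \<partial>lborel)"
    using nn_integral_lborel_affine_vec[of "\<lambda>u. ennreal (kern K t u)" "-1" y] by simp
  moreover have "(\<integral>\<^sup>+ u. ennreal (kern K t (u::real^'n)) \<partial>lborel) = 1"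
    using assms by (cases K) (auto simp: nn_integral_kern_Heat nn_integral_kern_Poisson)
  ultimately show ?thesis by simp
qed

lemma integrable_kern: 
  fixes y :: "real^'n::finite"
  assumes "t > 0"
  shows "integrable lborel (\<lambda>u. kern K t (y - u))"
  using assms nn_integral_kern_affine[OF assms, of K y] kern_pos[OF assms, of K]
  by (intro integrableI_nonneg) (auto intro!: AE_I2 less_imp_le)

lemma integral_kern:
  fixes y :: "real^'n::finite"
  assumes "t > 0"
  shows "(LINT u|lborel. kern K t (y - u)) = 1"
  using nn_integral_kern_affine[OF assms, of K y] kern_pos[OF assms, of K]
  by (subst integral_eq_nn_integral) (auto intro!: AE_I2 less_imp_le)

text \<open>The spatial width at time \<open>t\<close>: by \<open>kern_scale\<close>,
  \<open>kern K t\<close> is the mass-preserving dilate of \<open>kern K 1\<close> by this factor.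
  It vanishes at time 0, which is how initial values enter later.\<close>

definition kern_radius :: "kernel \<Rightarrow> real \<Rightarrow> real" where
  "kern_radius K t = (case K of Poisson \<Rightarrow> t | Heat \<Rightarrow> sqrt t)"

lemma kern_scale:
  fixes v :: "real^'n::finite"
  assumes "t > 0"
  shows "kern K t (kern_radius K t *\<^sub>R v) * kern_radius K t ^ CARD('n) = kern K 1 v"
proof (cases K)
  case Poisson
  have "t powr ((1 + real CARD('n))) = t * t ^ CARD('n)"
    using assms by (simp add: powr_add powr_realpow)
  moreover have "(t\<^sup>2 + (t * norm v)\<^sup>2) powr ((real CARD('n) + 1) / 2)
     = t powr ((1 + real CARD('n))) * (1 + (norm v)\<^sup>2) powr ((real CARD('n) + 1) / 2)"
  proof -
    have "t\<^sup>2 + (t * norm v)\<^sup>2 = t powr 2 * (1 + (norm v)\<^sup>2)"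
      using assms by (simp add: power_mult_distrib ring_distribs)
    then show ?thesis
      using assms by (simp only: powr_mult powr_powr) (simp add: algebra_simps add_divide_distrib)
  qed
  ultimately show ?thesis
    using Poisson assms by (simp add: kern_def kern_radius_def)
next
  case Heat
  have "sqrt t ^ CARD('n) = t powr (real CARD('n) / 2)"
    using assms by (simp add: powr_half_sqrt[symmetric] powr_powr flip: powr_realpow)
  moreover have "(4 * pi * t) powr (- real CARD('n) / 2) = (4 * pi) powr (- real CARD('n) / 2) / t powr (real CARD('n) / 2)"
    using assms by (simp add: powr_mult powr_minus divide_simps)
  ultimately show ?thesis
    using Heat assms by (simp add: kern_def kern_radius_def power_mult_distrib)
qed

section \<open>A discrete generator\<close>

text \<open>
  After division by \<open>r\<^sup>2\<close> this approximates the Laplacian in \<open>(y, t)\<close> for the Poisson kernel and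
  \<open>\<Delta> - \<partial>\<^sub>t\<close> for the heat kernel. It is a sum of differences to the centre value, hence nonpositive at a
  local maximum, and it avoids differentiation under the integral.
\<close>

definition discrete_gen :: "kernel \<Rightarrow> real \<Rightarrow> (real^'n::finite \<Rightarrow> real \<Rightarrow> real) \<Rightarrow> real^'n \<Rightarrow> real \<Rightarrow> real" where
  "discrete_gen K r F y t = (\<Sum>b\<in>Basis. F (y + r *\<^sub>R b) t + F (y - r *\<^sub>R b) t - 2 * F y t) +
     (case K of Poisson \<Rightarrow> F y (t + r) + F y (t - r) - 2 * F y t
      | Heat \<Rightarrow> F y (t - r\<^sup>2) - F y t)"

text \<open>The first-order terms of the Taylor expansions to the right and to the left cancel.
  Keeping the intermediate points serves both the bound uniform in \<open>r\<close> and the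
  limit.\<close>

lemma second_difference_mean_value:
  fixes f f1 f2 :: "real \<Rightarrow> real"
  assumes "r > 0"
    and f1: "\<And>\<tau>. \<bar>\<tau>\<bar> \<le> r \<Longrightarrow> (f has_real_derivative f1 \<tau>) (at \<tau>)"
    and f2: "\<And>\<tau>. \<bar>\<tau>\<bar> \<le> r \<Longrightarrow> (f1 has_real_derivative f2 \<tau>) (at \<tau>)"
  obtains \<xi> \<eta> where "\<bar>\<xi>\<bar> \<le> r" "\<bar>\<eta>\<bar> \<le> r" "f r + f (- r) - 2 * f 0 = r\<^sup>2 / 2 * (f2 \<xi> + f2 \<eta>)"
proof -
  define diff where "diff m = (if m = 0 then f else if m = 1 then f1 else f2)" for m :: nat
  have D: "\<forall>m t. m < 2 \<and> -r \<le> t \<and> t \<le> r \<longrightarrow> (diff m has_real_derivative diff (Suc m) t) (at t)"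
    using f1 f2 by (auto simp: diff_def abs_le_iff less_2_cases_iff)
  have "\<exists>\<xi>. (if r < 0 then r < \<xi> \<and> \<xi> < 0 else 0 < \<xi> \<and> \<xi> < r) \<and>
      f r = (\<Sum>m<2. (diff m 0 / fact m) * (r - 0)^m) + (diff 2 \<xi> / fact 2) * (r - 0)^2"
    by (rule Taylor[OF _ _ D]) (use assms(1) in \<open>auto simp: diff_def\<close>)
  then obtain \<xi> where \<xi>: "0 < \<xi>" "\<xi> < r" "f r = f 0 + f1 0 * r + f2 \<xi> / 2 * r\<^sup>2"
    using assms(1) by (auto simp: diff_def numeral_2_eq_2)
  have "\<exists>\<eta>. (if -r < 0 then -r < \<eta> \<and> \<eta> < 0 else 0 < \<eta> \<and> \<eta> < -r) \<and>
      f (-r) = (\<Sum>m<2. (diff m 0 / fact m) * (-r - 0)^m) + (diff 2 \<eta> / fact 2) * (-r - 0)^2"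
    by (rule Taylor[OF _ _ D]) (use assms(1) in \<open>auto simp: diff_def\<close>)
  then obtain \<eta> where \<eta>: "-r < \<eta>" "\<eta> < 0" "f (-r) = f 0 - f1 0 * r + f2 \<eta> / 2 * r\<^sup>2"
    using assms(1) by (auto simp: diff_def numeral_2_eq_2)
  show thesis
    by (rule that[of \<xi> \<eta>]) (use \<xi> \<eta> in \<open>auto simp: field_simps\<close>)
qed

lemma second_difference_bound:
  fixes f f1 f2 :: "real \<Rightarrow> real"
  assumes "0 < r" "r \<le> R"
    and f1: "\<And>\<tau>. \<bar>\<tau>\<bar> \<le> R \<Longrightarrow> (f has_real_derivative f1 \<tau>) (at \<tau>)"
    and f2: "\<And>\<tau>. \<bar>\<tau>\<bar> \<le> R \<Longrightarrow> (f1 has_real_derivative f2 \<tau>) (at \<tau>)"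
    and B: "\<And>\<tau>. \<bar>\<tau>\<bar> \<le> R \<Longrightarrow> \<bar>f2 \<tau>\<bar> \<le> B"
  shows "\<bar>(f r + f (- r) - 2 * f 0) / r\<^sup>2\<bar> \<le> B"
proof -
  obtain \<xi> \<eta> where *: "\<bar>\<xi>\<bar> \<le> r" "\<bar>\<eta>\<bar> \<le> r" "f r + f (- r) - 2 * f 0 = r\<^sup>2 / 2 * (f2 \<xi> + f2 \<eta>)"
    using second_difference_mean_value[of r f f1 f2] assms by (metis order_trans)
  have "(f r + f (- r) - 2 * f 0) / r\<^sup>2 = (f2 \<xi> + f2 \<eta>) / 2"
    using assms(1) * by simp
  moreover have "\<bar>f2 \<xi>\<bar> \<le> B" "\<bar>f2 \<eta>\<bar> \<le> B"
    using * assms(2) by (auto intro: B)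
  ultimately show ?thesis by (simp only:) (simp add: abs_le_iff)
qed

lemma second_difference_tendsto:
  fixes f f1 f2 :: "real \<Rightarrow> real" and r :: "nat \<Rightarrow> real"
  assumes r: "\<And>k. 0 < r k" "\<And>k. r k \<le> R" "r \<longlonglongrightarrow> 0"
    and f1: "\<And>\<tau>. \<bar>\<tau>\<bar> \<le> R \<Longrightarrow> (f has_real_derivative f1 \<tau>) (at \<tau>)"
    and f2: "\<And>\<tau>. \<bar>\<tau>\<bar> \<le> R \<Longrightarrow> (f1 has_real_derivative f2 \<tau>) (at \<tau>)"
    and cont: "isCont f2 0"
  shows "(\<lambda>k. (f (r k) + f (- r k) - 2 * f 0) / (r k)\<^sup>2) \<longlonglongrightarrow> f2 0"
proof -
  have "\<exists>\<xi> \<eta>. \<bar>\<xi>\<bar> \<le> r k \<and> \<bar>\<eta>\<bar> \<le> r k \<and> f (r k) + f (- r k) - 2 * f 0 = (r k)\<^sup>2 / 2 * (f2 \<xi> + f2 \<eta>)" for k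
    using second_difference_mean_value[of "r k" f f1 f2] r f1 f2 by (metis order_trans)
  then obtain \<xi> \<eta> where *: "\<And>k. \<bar>\<xi> k\<bar> \<le> r k" "\<And>k. \<bar>\<eta> k\<bar> \<le> r k"
    "\<And>k. f (r k) + f (- r k) - 2 * f 0 = (r k)\<^sup>2 / 2 * (f2 (\<xi> k) + f2 (\<eta> k))"
    by metis
  have "\<xi> \<longlonglongrightarrow> 0" "\<eta> \<longlonglongrightarrow> 0"
    using * by (auto intro!: Lim_null_comparison[OF _ r(3)])
  then have lim: "(\<lambda>k. (f2 (\<xi> k) + f2 (\<eta> k)) / 2) \<longlonglongrightarrow> (f2 0 + f2 0) / 2"
    by (intro tendsto_intros isCont_tendsto_compose[OF cont]) auto
  have eq: "(f (r k) + f (- r k) - 2 * f 0) / (r k)\<^sup>2 = (f2 (\<xi> k) + f2 (\<eta> k)) / 2" for k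
    using r(1)[of k] *(3)[of k] by simp
  show ?thesis unfolding eq using lim by simp
qed

text \<open>Both the spatial and the time profile of the Poisson kernel are powers of \<open>quad\<close> (up to a linear factor).\<close>

definition quad :: "real \<Rightarrow> real \<Rightarrow> real \<Rightarrow> real" where
  "quad A a \<tau> = A + 2 * a * \<tau> + \<tau>\<^sup>2"

definition quad_powr :: "real \<Rightarrow> real \<Rightarrow> real \<Rightarrow> real \<Rightarrow> real" where
  "quad_powr A a m \<tau> = quad A a \<tau> powr (- m)"

definition quad_powr_d1 :: "real \<Rightarrow> real \<Rightarrow> real \<Rightarrow> real \<Rightarrow> real" where
  "quad_powr_d1 A a m \<tau> = - m * quad A a \<tau> powr (- m - 1) * (2 * (a + \<tau>))"

definition quad_powr_d2 :: "real \<Rightarrow> real \<Rightarrow> real \<Rightarrow> real \<Rightarrow> real" where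
  "quad_powr_d2 A a m \<tau> = - 2 * m * quad A a \<tau> powr (- m - 1) + 4 * m * (m + 1) * (a + \<tau>)\<^sup>2 * quad A a \<tau> powr (- m - 2)"

context
  fixes A a m :: real
  assumes A: "A > 0" and aA: "a\<^sup>2 \<le> A" and m: "m > 0"
begin

text \<open>Since \<open>a\<^sup>2 \<le> A\<close>, the worst case is the perfect square (sqrt A -
  |\<tau>|)^2. In the applications \<open>A\<close> is t^2 + |w|^2 and \<open>a\<close> is one
  coordinate of the point (w, t).\<close>

lemma quad_lower: "\<bar>\<tau>\<bar> \<le> sqrt A / 2 \<Longrightarrow> A / 4 \<le> quad A a \<tau>"
proof -
  assume \<tau>: "\<bar>\<tau>\<bar> \<le> sqrt A / 2"
  have "\<bar>a\<bar> \<le> sqrt A" using aA by (simp add: real_le_rsqrt)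
  then have "\<bar>a * \<tau>\<bar> \<le> sqrt A * \<bar>\<tau>\<bar>" by (simp add: abs_mult mult_right_mono)
  then have "quad A a \<tau> \<ge> (sqrt A)\<^sup>2 - 2 * sqrt A * \<bar>\<tau>\<bar> + \<bar>\<tau>\<bar>\<^sup>2"
    unfolding quad_def using A by (simp add: abs_le_iff algebra_simps)
  also have "(sqrt A)\<^sup>2 - 2 * sqrt A * \<bar>\<tau>\<bar> + \<bar>\<tau>\<bar>\<^sup>2 = (sqrt A - \<bar>\<tau>\<bar>)\<^sup>2"
    by (simp add: power2_eq_square algebra_simps)
  also have "(sqrt A - \<bar>\<tau>\<bar>)\<^sup>2 \<ge> (sqrt A / 2)\<^sup>2"
    using \<tau> A by (intro power_mono) auto
  finally show ?thesis using A by (simp add: power_divide)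
qed

lemma quad_deriv: "((quad A a) has_real_derivative 2 * (a + \<tau>)) (at \<tau>)"
  unfolding quad_def[abs_def] by (auto intro!: derivative_eq_intros)

lemma quad_powr_deriv: "\<bar>\<tau>\<bar> \<le> sqrt A / 2 \<Longrightarrow> ((quad_powr A a m) has_real_derivative quad_powr_d1 A a m \<tau>) (at \<tau>)"
  using quad_lower[of \<tau>] A DERIV_fun_powr[OF quad_deriv[of \<tau>], of "- m"]
  unfolding quad_powr_def[abs_def] quad_powr_d1_def by simp

lemma quad_powr_d1_deriv: "\<bar>\<tau>\<bar> \<le> sqrt A / 2 \<Longrightarrow> ((quad_powr_d1 A a m) has_real_derivative quad_powr_d2 A a m \<tau>) (at \<tau>)"
proof -
  assume "\<bar>\<tau>\<bar> \<le> sqrt A / 2"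
  then have q: "quad A a \<tau> > 0" using quad_lower[of \<tau>] A by linarith
  have "((\<lambda>\<tau>. quad A a \<tau> powr (- m - 1)) has_real_derivative (- m - 1) * quad A a \<tau> powr (- m - 2) * (2 * (a + \<tau>))) (at \<tau>)"
    using DERIV_fun_powr[OF quad_deriv q, of "-m-1"] by (simp add: diff_diff_eq)
  moreover have "((\<lambda>\<tau>. 2 * (a + \<tau>)) has_real_derivative 2) (at \<tau>)"
    by (auto intro!: derivative_eq_intros)
  ultimately have "((\<lambda>\<tau>. - m * (quad A a \<tau> powr (- m - 1) * (2 * (a + \<tau>)))) has_real_derivative
      - m * ((- m - 1) * quad A a \<tau> powr (- m - 2) * (2 * (a + \<tau>)) * (2 * (a + \<tau>)) + 2 * quad A a \<tau> powr (- m - 1))) (at \<tau>)"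
    by (intro DERIV_cmult DERIV_mult)
  moreover have "- m * ((- m - 1) * quad A a \<tau> powr (- m - 2) * (2 * (a + \<tau>)) * (2 * (a + \<tau>)) + 2 * quad A a \<tau> powr (- m - 1))
     = quad_powr_d2 A a m \<tau>"
    by (simp add: quad_powr_d2_def power2_eq_square algebra_simps)
  ultimately show ?thesis
    unfolding quad_powr_d1_def[abs_def] mult.assoc by (simp only:)
qed

lemma isCont_quad_powr_d2: "isCont (quad_powr_d2 A a m) 0" and isCont_quad_powr_d1: "isCont (quad_powr_d1 A a m) 0"
proof -
  have "quad A a 0 > 0" "isCont (quad A a) 0" using A by (auto simp: quad_def intro!: DERIV_isCont[OF quad_deriv])
  then show "isCont (quad_powr_d2 A a m) 0" "isCont (quad_powr_d1 A a m) 0"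
    unfolding quad_powr_d2_def[abs_def] quad_powr_d1_def[abs_def] by (auto intro!: continuous_intros)
qed

text \<open>The bounds are uniform in the increment and proportional to \<open>A powr (- m)\<close>,
  the profile at the centre, so that the kernel itself can serve as dominating function. The factor
  \<open>4 powr (m + 1)\<close> is the price of \<open>quad_lower\<close>.\<close>

lemma quad_powr_bounds:
  assumes \<tau>: "\<bar>\<tau>\<bar> \<le> t / 2" and t: "0 < t" "t\<^sup>2 \<le> A"
  shows "\<bar>quad_powr_d1 A a m \<tau>\<bar> \<le> 3 * m * 4 powr (m + 1) * A powr (- m) / t"
    "\<bar>quad_powr_d2 A a m \<tau>\<bar> \<le> (2 * m + 4 * m * (m + 1)) * 4 powr (m + 1) * A powr (- m) / t\<^sup>2"
proof -
  have tA: "t \<le> sqrt A" using t by (simp add: real_le_rsqrt)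
  then have \<tau>': "\<bar>\<tau>\<bar> \<le> sqrt A / 2" using \<tau> by simp
  have q: "A / 4 \<le> quad A a \<tau>" "quad A a \<tau> > 0" using quad_lower[OF \<tau>'] A by auto
  have "quad A a \<tau> powr (- m - 1) \<le> (A / 4) powr (- m - 1)"
    using q A m by (intro powr_mono2') auto
  also have "\<dots> = 4 powr (m + 1) * A powr (- m) / A"
  proof -
    have "A powr (- m - 1) = A powr (- m) / A" using A by (simp add: powr_diff)
    moreover have "4 powr (- m - 1) = inverse (4 powr (m + 1) :: real)"
      by (subst powr_minus[symmetric]) (simp add: minus_diff_commute)
    ultimately show ?thesis
      using A by (simp only: powr_divide) (simp add: divide_inverse)
  qed
  finally have b: "quad A a \<tau> powr (- m - 1) \<le> 4 powr (m + 1) * A powr (- m) / A" .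
  have "\<bar>a\<bar> \<le> sqrt A" using aA by (simp add: real_le_rsqrt)
  then have at: "\<bar>2 * (a + \<tau>)\<bar> \<le> 3 * sqrt A" using \<tau>' by (smt (verit) field_sum_of_halves)
  have "\<bar>quad_powr_d1 A a m \<tau>\<bar> = m * quad A a \<tau> powr (- m - 1) * \<bar>2 * (a + \<tau>)\<bar>"
    using m by (simp add: quad_powr_d1_def abs_mult)
  also have "\<dots> \<le> m * (4 powr (m + 1) * A powr (- m) / A) * (3 * sqrt A)"
    using m b at A by (intro mult_mono) auto
  also have "\<dots> = 3 * m * 4 powr (m + 1) * A powr (- m) * (sqrt A / A)" by simp
  also have "sqrt A / A \<le> 1 / t"
  proof -
    have "sqrt A / A = 1 / sqrt A" using A by (simp add: field_simps)
    then show ?thesis using tA A t by (simp add: frac_le)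
  qed
  finally show "\<bar>quad_powr_d1 A a m \<tau>\<bar> \<le> 3 * m * 4 powr (m + 1) * A powr (- m) / t"
    using m A by (simp add: mult_left_mono)
  \<comment> \<open>This absorbs the factor \<open>(a + \<tau>)\<^sup>2\<close> of the second
    derivative into one power of \<open>quad\<close>, leaving the same power as in the other
    term.\<close>
  have sq: "(a + \<tau>)\<^sup>2 \<le> quad A a \<tau>" unfolding quad_def using aA by (simp add: power2_eq_square algebra_simps)
  have "\<bar>quad_powr_d2 A a m \<tau>\<bar> \<le> 2 * m * quad A a \<tau> powr (- m - 1) + 4 * m * (m + 1) * ((a + \<tau>)\<^sup>2 * quad A a \<tau> powr (- m - 2))"
    unfolding quad_powr_d2_def using m by (intro order_trans[OF abs_triangle_ineq]) (simp add: abs_mult)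
  also have "(a + \<tau>)\<^sup>2 * quad A a \<tau> powr (- m - 2) \<le> quad A a \<tau> * quad A a \<tau> powr (- m - 2)"
    using sq by (intro mult_right_mono) auto
  also have "quad A a \<tau> * quad A a \<tau> powr (- m - 2) = quad A a \<tau> powr (- m - 1)"
    using q by (simp add: powr_mult_base minus_diff_commute)
  finally have "\<bar>quad_powr_d2 A a m \<tau>\<bar> \<le> 2 * m * quad A a \<tau> powr (- m - 1) + 4 * m * (m + 1) * quad A a \<tau> powr (- m - 1)"
    using m by (simp add: mult_left_mono)
  also have "\<dots> = (2 * m + 4 * m * (m + 1)) * quad A a \<tau> powr (- m - 1)"
    by (simp only: distrib_right)
  also have "\<dots> \<le> (2 * m + 4 * m * (m + 1)) * (4 powr (m + 1) * A powr (- m) / A)"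
    using m b by (intro mult_left_mono) auto
  also have "\<dots> \<le> (2 * m + 4 * m * (m + 1)) * (4 powr (m + 1) * A powr (- m) / t\<^sup>2)"
    using m t A by (intro mult_left_mono divide_left_mono) auto
  finally show "\<bar>quad_powr_d2 A a m \<tau>\<bar> \<le> (2 * m + 4 * m * (m + 1)) * 4 powr (m + 1) * A powr (- m) / t\<^sup>2"
    by simp
qed

end

lemma norm_shift_Basis:
  fixes w b :: "'a::euclidean_space"
  assumes "b \<in> Basis"
  shows "(norm (w + r *\<^sub>R b))\<^sup>2 = (norm w)\<^sup>2 + 2 * (w \<bullet> b) * r + r\<^sup>2"
  using assms unfolding power2_norm_eq_inner
  by (simp add: inner_add inner_commute algebra_simps power2_eq_square)

lemma sum_inner_Basis_sq: "(\<Sum>b\<in>Basis. (w \<bullet> b)\<^sup>2) = (norm (w::'a::euclidean_space))\<^sup>2"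
  unfolding power2_norm_eq_inner by (subst (2) euclidean_inner) (simp add: power2_eq_square)

lemma inner_Basis_sq_le: "b \<in> Basis \<Longrightarrow> (w \<bullet> b)\<^sup>2 \<le> (norm (w::'a::euclidean_space))\<^sup>2"
  using Basis_le_norm[of b w] by (simp add: abs_le_square_iff[symmetric])

section \<open>The Poisson kernel: discrete Laplacian in space and time\<close>

context
  fixes t :: real and w :: "real^'n::finite" and c m A :: real
  assumes t: "t > 0"
  defines "m \<equiv> (real CARD('n) + 1) / 2" and "c \<equiv> Gamma ((real CARD('n) + 1) / 2) / pi powr ((real CARD('n) + 1) / 2)"
    and "A \<equiv> t\<^sup>2 + (norm w)\<^sup>2"
begin

lemma Poisson_consts: "A > 0" "t\<^sup>2 \<le> A" "m > 0" "b \<in> Basis \<Longrightarrow> (w \<bullet> b)\<^sup>2 \<le> A" "t / 2 \<le> sqrt A / 2" "c > 0"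
proof -
  show "A > 0" using t by (simp add: A_def add_pos_nonneg)
  show "t\<^sup>2 \<le> A" by (simp add: A_def)
  then show "t / 2 \<le> sqrt A / 2" using t by (simp add: real_le_rsqrt)
  show "m > 0" by (simp add: m_def)
  show "b \<in> Basis \<Longrightarrow> (w \<bullet> b)\<^sup>2 \<le> A"
    using inner_Basis_sq_le[of b w] by (simp add: A_def add_increasing)
  show "c > 0" by (simp add: c_def Gamma_real_pos)
qed

lemma Poisson_space:
  assumes "b \<in> Basis"
  shows "kern Poisson t (w + r *\<^sub>R b) = c * t * quad_powr A (w \<bullet> b) m r"
proof -
  have "quad A (w \<bullet> b) r = t\<^sup>2 + (norm (w + r *\<^sub>R b))\<^sup>2"
    using assms by (simp add: quad_def A_def norm_shift_Basis)
  then show ?thesis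
    by (simp only: kern_def quad_powr_def powr_minus m_def c_def divide_inverse kernel.case mult_ac)
qed

lemma Poisson_time:
  shows "kern Poisson (t + r) w = c * ((t + r) * quad_powr A t m r)"
proof -
  have "quad A t r = (t + r)\<^sup>2 + (norm w)\<^sup>2"
    by (simp add: quad_def A_def power2_sum)
  then show ?thesis
    by (simp only: kern_def quad_powr_def powr_minus m_def c_def divide_inverse kernel.case mult_ac)
qed

lemma Poisson_time_deriv:
  assumes "\<bar>\<tau>\<bar> \<le> t / 2"
  shows "((\<lambda>r. (t + r) * quad_powr A t m r) has_real_derivative quad_powr A t m \<tau> + (t + \<tau>) * quad_powr_d1 A t m \<tau>) (at \<tau>)"
    "((\<lambda>\<tau>. quad_powr A t m \<tau> + (t + \<tau>) * quad_powr_d1 A t m \<tau>) has_real_derivative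
       2 * quad_powr_d1 A t m \<tau> + (t + \<tau>) * quad_powr_d2 A t m \<tau>) (at \<tau>)"
proof -
  have \<tau>: "\<bar>\<tau>\<bar> \<le> sqrt A / 2" using assms Poisson_consts(5) by linarith
  show "((\<lambda>r. (t + r) * quad_powr A t m r) has_real_derivative quad_powr A t m \<tau> + (t + \<tau>) * quad_powr_d1 A t m \<tau>) (at \<tau>)"
    by (rule derivative_eq_intros quad_powr_deriv[OF Poisson_consts(1,2,3) \<tau>] refl | simp)+
  show "((\<lambda>\<tau>. quad_powr A t m \<tau> + (t + \<tau>) * quad_powr_d1 A t m \<tau>) has_real_derivative
       2 * quad_powr_d1 A t m \<tau> + (t + \<tau>) * quad_powr_d2 A t m \<tau>) (at \<tau>)"
    by (rule derivative_eq_intros quad_powr_deriv[OF Poisson_consts(1,2,3) \<tau>] quad_powr_d1_deriv[OF Poisson_consts(1,2,3) \<tau>] refl | simp)+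
qed

lemma discrete_gen_Poisson_eq:
  "discrete_gen Poisson r (\<lambda>y t. kern Poisson t y) w t / r\<^sup>2 =
     c * (t * (\<Sum>b\<in>Basis. (quad_powr A (w \<bullet> b) m r + quad_powr A (w \<bullet> b) m (- r) - 2 * quad_powr A (w \<bullet> b) m 0) / r\<^sup>2)
       + ((t + r) * quad_powr A t m r + (t + - r) * quad_powr A t m (- r) - 2 * ((t + 0) * quad_powr A t m 0)) / r\<^sup>2)"
proof -
  have "(\<Sum>b\<in>Basis. kern Poisson t (w + r *\<^sub>R b) + kern Poisson t (w - r *\<^sub>R b) - 2 * kern Poisson t w)
     = (\<Sum>b\<in>Basis. c * t * (quad_powr A (w \<bullet> b) m r + quad_powr A (w \<bullet> b) m (- r) - 2 * quad_powr A (w \<bullet> b) m 0))"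
  proof (rule sum.cong[OF refl])
    fix b :: "real^'n" assume "b \<in> Basis"
    from Poisson_space[OF this, of r] Poisson_space[OF this, of "-r"] Poisson_space[OF this, of 0]
    show "kern Poisson t (w + r *\<^sub>R b) + kern Poisson t (w - r *\<^sub>R b) - 2 * kern Poisson t w
        = c * t * (quad_powr A (w \<bullet> b) m r + quad_powr A (w \<bullet> b) m (- r) - 2 * quad_powr A (w \<bullet> b) m 0)"
      by (simp add: algebra_simps)
  qed
  also have "\<dots> = c * t * (\<Sum>b\<in>Basis. quad_powr A (w \<bullet> b) m r + quad_powr A (w \<bullet> b) m (- r) - 2 * quad_powr A (w \<bullet> b) m 0)"
    by (rule sum_distrib_left[symmetric])
  finally have sum_eq: "(\<Sum>b\<in>Basis. kern Poisson t (w + r *\<^sub>R b) + kern Poisson t (w - r *\<^sub>R b) - 2 * kern Poisson t w) = c * t * (\<Sum>b\<in>Basis. quad_powr A (w \<bullet> b) m r + quad_powr A (w \<bullet> b) m (- r) - 2 * quad_powr A (w \<bullet> b) m 0)" .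
  have time_eq: "kern Poisson (t + r) w + kern Poisson (t - r) w - 2 * kern Poisson t w
     = c * ((t + r) * quad_powr A t m r + (t + - r) * quad_powr A t m (- r) - 2 * ((t + 0) * quad_powr A t m 0))"
    using Poisson_time[of r] Poisson_time[of "-r"] Poisson_time[of 0] by (simp add: algebra_simps)
  show ?thesis
    unfolding discrete_gen_def kernel.case sum_eq time_eq sum_divide_distrib[symmetric]
    by (simp only: add_divide_distrib distrib_left times_divide_eq_right mult.assoc)
qed

text \<open>The limit is the Laplacian in all n + 1 variables, and the Poisson kernel is
  harmonic.\<close>

lemma discrete_gen_Poisson_tendsto:
  assumes r: "\<And>k. 0 < r k" "\<And>k. r k \<le> t / 2" "r \<longlonglongrightarrow> 0"
  shows "(\<lambda>k. discrete_gen Poisson (r k) (\<lambda>y t. kern Poisson t y) w t / (r k)\<^sup>2) \<longlonglongrightarrow> 0"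
proof -
  have "(\<lambda>k. (quad_powr A (w \<bullet> b) m (r k) + quad_powr A (w \<bullet> b) m (- r k) - 2 * quad_powr A (w \<bullet> b) m 0) / (r k)\<^sup>2)
     \<longlonglongrightarrow> quad_powr_d2 A (w \<bullet> b) m 0" if b: "b \<in> Basis" for b
    using r Poisson_consts b
    by (intro second_difference_tendsto[where R = "t/2" and ?f1.0 = "quad_powr_d1 A (w \<bullet> b) m"] 
        quad_powr_deriv quad_powr_d1_deriv isCont_quad_powr_d2) auto
  moreover have "(\<lambda>k. ((t + r k) * quad_powr A t m (r k) + (t + - r k) * quad_powr A t m (- r k) - 2 * ((t + 0) * quad_powr A t m 0)) / (r k)\<^sup>2)
     \<longlonglongrightarrow> 2 * quad_powr_d1 A t m 0 + (t + 0) * quad_powr_d2 A t m 0"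
    by (intro second_difference_tendsto[where R = "t/2", OF _ _ _ Poisson_time_deriv] r
         continuous_intros isCont_quad_powr_d1 isCont_quad_powr_d2 Poisson_consts)
  ultimately have "(\<lambda>k. discrete_gen Poisson (r k) (\<lambda>y t. kern Poisson t y) w t / (r k)\<^sup>2) \<longlonglongrightarrow>
     c * (t * (\<Sum>b\<in>Basis. quad_powr_d2 A (w \<bullet> b) m 0) + (2 * quad_powr_d1 A t m 0 + (t + 0) * quad_powr_d2 A t m 0))"
    unfolding discrete_gen_Poisson_eq by (intro tendsto_intros)
  also have "c * (t * (\<Sum>b\<in>Basis. quad_powr_d2 A (w \<bullet> b) m 0) + (2 * quad_powr_d1 A t m 0 + (t + 0) * quad_powr_d2 A t m 0)) = 0"
  proof -
    define B where "B = A powr (- m - 2)"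
    have B: "A powr (- m - 1) = A * B"
      using Poisson_consts(1) by (simp add: B_def powr_mult_base minus_diff_commute)
    have "quad_powr_d2 A (w \<bullet> b) m 0 = - 2 * m * A * B + 4 * m * (m + 1) * B * (w \<bullet> b)\<^sup>2" if "b \<in> Basis" for b
      using that by (simp add: quad_powr_d2_def quad_def B B_def)
    then have "(\<Sum>b\<in>Basis. quad_powr_d2 A (w \<bullet> b) m 0) = (\<Sum>b\<in>(Basis::(real^'n) set). - 2 * m * A * B + 4 * m * (m + 1) * B * (w \<bullet> b)\<^sup>2)"
      by simp
    also have "\<dots> = - 2 * real CARD('n) * m * A * B + 4 * m * (m + 1) * B * (norm w)\<^sup>2"
      by (simp only: sum.distrib sum_distrib_left[symmetric] sum_inner_Basis_sq) simp
    finally have *: "(\<Sum>b\<in>Basis. quad_powr_d2 A (w \<bullet> b) m 0) = - 2 * real CARD('n) * m * A * B + 4 * m * (m + 1) * B * (norm w)\<^sup>2" .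
    \<comment> \<open>Replacing n by 2m - 1 and |w|^2 by A - t^2 leaves only \<open>A\<close>,
      \<open>B\<close>, \<open>m\<close> and \<open>t\<close>, and the contributions of space and
      time then cancel as polynomials.\<close>
    have 1: "(\<Sum>b\<in>Basis. quad_powr_d2 A (w \<bullet> b) m 0) = - 2 * (2 * m - 1) * m * A * B + 4 * m * (m + 1) * B * (A - t\<^sup>2)"
    proof -
      have "real CARD('n) = 2 * m - 1" "(norm w)\<^sup>2 = A - t\<^sup>2" by (simp_all add: m_def A_def add_divide_distrib)
      with * show ?thesis by (simp only:)
    qed
    have 2: "2 * quad_powr_d1 A t m 0 + (t + 0) * quad_powr_d2 A t m 0 = - 6 * m * A * B * t + 4 * m * (m + 1) * t^3 * B"
      by (simp add: quad_powr_d2_def quad_powr_d1_def quad_def B)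
         (simp add: B_def algebra_simps power2_eq_square power3_eq_cube)
    show ?thesis unfolding 1 2 by (simp add: algebra_simps power2_eq_square power3_eq_cube)
  qed
  finally show ?thesis .
qed

text \<open>The constant has one term for the n spatial differences and two for the time difference,
  whose second derivative is \<open>2 * quad_powr_d1 + (t + \<tau>) * quad_powr_d2\<close> with t +
  \<tau> at most 3t/2.\<close>

lemma discrete_gen_Poisson_bound:
  assumes "0 < r" "r \<le> t / 2"
  shows "\<bar>discrete_gen Poisson r (\<lambda>y t. kern Poisson t y) w t / r\<^sup>2\<bar> \<le>
     (real CARD('n) * ((2 * m + 4 * m * (m + 1)) * 4 powr (m + 1)) + 2 * (3 * m * 4 powr (m + 1))
        + 3/2 * ((2 * m + 4 * m * (m + 1)) * 4 powr (m + 1))) / t\<^sup>2 * kern Poisson t w"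
proof -
  define C2 where "C2 = (2 * m + 4 * m * (m + 1)) * 4 powr (m + 1)"
  define C1 where "C1 = 3 * m * 4 powr (m + 1)"
  define P where "P = A powr (- m)"
  note b1 = quad_powr_bounds(1)[OF Poisson_consts(1) _ Poisson_consts(3) _ t Poisson_consts(2), folded C1_def C2_def P_def]
    and b2 = quad_powr_bounds(2)[OF Poisson_consts(1) _ Poisson_consts(3) _ t Poisson_consts(2), folded C1_def C2_def P_def]
  have C: "C1 \<ge> 0" "C2 \<ge> 0" "P \<ge> 0" using Poisson_consts(3) by (auto simp: C1_def C2_def P_def)
  have 1: "\<bar>(quad_powr A (w \<bullet> b) m r + quad_powr A (w \<bullet> b) m (- r) - 2 * quad_powr A (w \<bullet> b) m 0) / r\<^sup>2\<bar> \<le> C2 * P / t\<^sup>2"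
    if b: "b \<in> Basis" for b
    using Poisson_consts b
    by (intro second_difference_bound[OF assms, where ?f1.0 = "quad_powr_d1 A (w \<bullet> b) m" and ?f2.0 = "quad_powr_d2 A (w \<bullet> b) m"]
         quad_powr_deriv quad_powr_d1_deriv b2[of "w \<bullet> b"]) auto
  have 2: "\<bar>((t + r) * quad_powr A t m r + (t + - r) * quad_powr A t m (- r) - 2 * ((t + 0) * quad_powr A t m 0)) / r\<^sup>2\<bar>
      \<le> 2 * (C1 * P / t) + 3/2 * t * (C2 * P / t\<^sup>2)"
  proof (rule second_difference_bound[OF assms Poisson_time_deriv])
    fix \<tau> assume \<tau>: "\<bar>\<tau>\<bar> \<le> t / 2"
    have "\<bar>2 * quad_powr_d1 A t m \<tau> + (t + \<tau>) * quad_powr_d2 A t m \<tau>\<bar> \<le> 2 * \<bar>quad_powr_d1 A t m \<tau>\<bar> + \<bar>t + \<tau>\<bar> * \<bar>quad_powr_d2 A t m \<tau>\<bar>"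
      by (rule order_trans[OF abs_triangle_ineq]) (simp add: abs_mult)
    also have "\<dots> \<le> 2 * (C1 * P / t) + 3/2 * t * (C2 * P / t\<^sup>2)"
      using \<tau> t C by (intro add_mono mult_mono mult_left_mono b1 b2 Poisson_consts) auto
    finally show "\<bar>2 * quad_powr_d1 A t m \<tau> + (t + \<tau>) * quad_powr_d2 A t m \<tau>\<bar> \<le> 2 * (C1 * P / t) + 3/2 * t * (C2 * P / t\<^sup>2)" .
  qed
  have "\<bar>\<Sum>b\<in>Basis. (quad_powr A (w \<bullet> b) m r + quad_powr A (w \<bullet> b) m (- r) - 2 * quad_powr A (w \<bullet> b) m 0) / r\<^sup>2\<bar>
     \<le> (\<Sum>b\<in>(Basis::(real^'n) set). C2 * P / t\<^sup>2)"
    by (rule order_trans[OF sum_abs sum_mono[OF 1]])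
  then have 3: "\<bar>\<Sum>b\<in>Basis. (quad_powr A (w \<bullet> b) m r + quad_powr A (w \<bullet> b) m (- r) - 2 * quad_powr A (w \<bullet> b) m 0) / r\<^sup>2\<bar>
     \<le> real CARD('n) * (C2 * P / t\<^sup>2)" by simp
  let ?S = "\<Sum>b\<in>Basis. (quad_powr A (w \<bullet> b) m r + quad_powr A (w \<bullet> b) m (- r) - 2 * quad_powr A (w \<bullet> b) m 0) / r\<^sup>2"
  let ?T = "((t + r) * quad_powr A t m r + (t + - r) * quad_powr A t m (- r) - 2 * ((t + 0) * quad_powr A t m 0)) / r\<^sup>2"
  have "\<bar>t * ?S + ?T\<bar> \<le> t * \<bar>?S\<bar> + \<bar>?T\<bar>"
    using t by (intro order_trans[OF abs_triangle_ineq]) (simp add: abs_mult)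
  also have "\<dots> \<le> t * (real CARD('n) * (C2 * P / t\<^sup>2)) + (2 * (C1 * P / t) + 3/2 * t * (C2 * P / t\<^sup>2))"
    using t by (intro add_mono mult_left_mono 2 3) auto
  finally have bound: "\<bar>t * ?S + ?T\<bar> \<le> t * (real CARD('n) * (C2 * P / t\<^sup>2)) + (2 * (C1 * P / t) + 3/2 * t * (C2 * P / t\<^sup>2))" .
  have "\<bar>discrete_gen Poisson r (\<lambda>y t. kern Poisson t y) w t / r\<^sup>2\<bar> = c * \<bar>t * ?S + ?T\<bar>"
    unfolding discrete_gen_Poisson_eq abs_mult using Poisson_consts(6) by (simp only: abs_of_pos)
  also have "\<dots> \<le> c * (t * (real CARD('n) * (C2 * P / t\<^sup>2)) + (2 * (C1 * P / t) + 3/2 * t * (C2 * P / t\<^sup>2)))"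
    using Poisson_consts(6) by (intro mult_left_mono bound) auto
  also have "\<dots> = (real CARD('n) * C2 + 2 * C1 + 3/2 * C2) / t\<^sup>2 * (c * t * P)"
    using t by (simp add: field_simps power2_eq_square)
  also have "c * t * P = kern Poisson t w"
    using Poisson_time[of 0] by (simp add: quad_powr_def quad_def P_def)
  finally show ?thesis unfolding C1_def C2_def .
qed

end

section \<open>The heat kernel: discrete heat operator with a backward time step\<close>

lemma one_plus_le_exp_half: "0 \<le> k \<Longrightarrow> 0 \<le> x \<Longrightarrow> (x + k / 2) * exp (- x) \<le> (2 + k) * exp (- x / 2)" for x k :: real
proof -
  assume k: "0 \<le> k" "0 \<le> x"
  have "x + k / 2 \<le> (2 + k) * (1 + x / 2)" using k mult_nonneg_nonneg[OF k] by (simp add: algebra_simps add_divide_distrib)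
  also have "\<dots> \<le> (2 + k) * exp (x / 2)" using k by (intro mult_left_mono exp_ge_add_one_self) auto
  finally have "(x + k / 2) * exp (- x) \<le> (2 + k) * exp (x / 2) * exp (- x)"
    by (intro mult_right_mono) auto
  also have "\<dots> = (2 + k) * exp (- x / 2)" by (simp add: mult.assoc flip: exp_add)
  finally show ?thesis .
qed

context
  fixes t :: real and w :: "real^'n::finite" and c A :: real
  assumes t: "t > 0"
  defines "c \<equiv> (4 * pi * t) powr (- real CARD('n) / 2)" and "A \<equiv> (norm w)\<^sup>2"
begin

lemma Heat_space:
  assumes "b \<in> Basis"
  shows "kern Heat t (w + r *\<^sub>R b) = c * exp (- quad A (w \<bullet> b) r / (4 * t))"
  using assms by (simp add: kern_def c_def quad_def A_def norm_shift_Basis)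

lemma Heat_space_deriv:
  "((\<lambda>\<tau>. exp (- quad A a \<tau> / (4 * t))) has_real_derivative - (a + \<tau>) / (2 * t) * exp (- quad A a \<tau> / (4 * t))) (at \<tau>)"
  "((\<lambda>\<tau>. - (a + \<tau>) / (2 * t) * exp (- quad A a \<tau> / (4 * t))) has_real_derivative
      ((a + \<tau>)\<^sup>2 / (4 * t\<^sup>2) - 1 / (2 * t)) * exp (- quad A a \<tau> / (4 * t))) (at \<tau>)"
  using t unfolding quad_def
  by (auto intro!: derivative_eq_intros simp: field_simps power2_eq_square)

text \<open>The polynomial prefactor is at most \<open>(x + 1) / t\<close> and is absorbed by half
  of the exponential decay. The other half survives the shift by \<tau> as a Gaussian in
  \<open>A\<close>, at the cost of the factor \<open>exp 1\<close>. A wider Gaussian than the kernel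
  is needed, because a shifted heat kernel is not bounded by a multiple of the unshifted
  one.\<close>

lemma Heat_space_bound:
  assumes "a\<^sup>2 \<le> A" "\<tau>\<^sup>2 \<le> t"
  shows "\<bar>((a + \<tau>)\<^sup>2 / (4 * t\<^sup>2) - 1 / (2 * t)) * exp (- quad A a \<tau> / (4 * t))\<bar> \<le> 4 / t * exp 1 * exp (- A / (16 * t))"
proof -
  define x where "x = quad A a \<tau> / (4 * t)"
  have sq: "(a + \<tau>)\<^sup>2 \<le> quad A a \<tau>" unfolding quad_def using assms(1) by (simp add: power2_eq_square algebra_simps)
  then have x0: "0 \<le> x" using t zero_le_power2[of "a + \<tau>"] unfolding x_def by (intro divide_nonneg_pos) linarith+
  \<comment> \<open>Completing this square bounds \<open>2 * a * \<tau>\<close> below by -A/2 -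
    2\<tau>^2, so that half of \<open>A\<close> survives in \<open>quad\<close>.\<close>
  have "0 \<le> (a + 2 * \<tau>)\<^sup>2" by simp
  then have "A / 2 - \<tau>\<^sup>2 \<le> quad A a \<tau>" using assms(1) unfolding quad_def by (simp add: power2_eq_square algebra_simps)
  then have "A / 2 - t \<le> quad A a \<tau>" using assms(2) by linarith
  then have xl: "A / (16 * t) - 1 \<le> x / 2" 
    using t divide_right_mono[of "A / 2 - t" "quad A a \<tau>" "8 * t"] unfolding x_def by (simp add: diff_divide_distrib)
  have "\<bar>(a + \<tau>)\<^sup>2 / (4 * t\<^sup>2) - 1 / (2 * t)\<bar> \<le> (a + \<tau>)\<^sup>2 / (4 * t\<^sup>2) + 1 / (2 * t)"
    using t by (intro order_trans[OF abs_triangle_ineq4]) simp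
  also have "\<dots> \<le> quad A a \<tau> / (4 * t\<^sup>2) + 1 / (2 * t)"
    using sq t by (intro add_mono divide_right_mono) auto
  also have "\<dots> \<le> (x + 2 / 2) / t" using t by (simp add: x_def field_simps power2_eq_square)
  finally have "\<bar>((a + \<tau>)\<^sup>2 / (4 * t\<^sup>2) - 1 / (2 * t)) * exp (- x)\<bar> \<le> (x + 2 / 2) / t * exp (- x)"
    unfolding abs_mult abs_exp_cancel by (rule mult_right_mono) auto
  also have "\<dots> = (x + 2 / 2) * exp (- x) / t" by simp
  also have "\<dots> \<le> (2 + 2) * exp (- x / 2) / t"
    using t x0 by (intro divide_right_mono one_plus_le_exp_half) auto
  also have "\<dots> \<le> (2 + 2) * exp (1 + - A / (16 * t)) / t"
    using xl t by (intro divide_right_mono mult_left_mono) auto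
  also have "\<dots> = 4 / t * exp 1 * exp (- A / (16 * t))" unfolding exp_add by simp
  finally show ?thesis by (simp add: x_def)
qed

lemma Heat_time_deriv:
  assumes "s > 0"
  shows "((\<lambda>s. kern Heat s w) has_real_derivative (A / (4 * s\<^sup>2) - real CARD('n) / (2 * s)) * kern Heat s w) (at s)"
proof -
  have *: "((\<lambda>s. (4 * pi * s) powr (- real CARD('n) / 2)) has_real_derivative
       - real CARD('n) / 2 * (4 * pi * s) powr (- real CARD('n) / 2 - of_nat 1) * (4 * pi)) (at s)"
    by (rule DERIV_fun_powr) (use assms in \<open>auto intro!: derivative_eq_intros\<close>)
  have "(4 * pi * s) powr (- real CARD('n) / 2 - of_nat 1) = (4 * pi * s) powr (- real CARD('n) / 2) / (4 * pi * s)"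
    using assms by (simp add: powr_diff)
  then have 1: "((\<lambda>s. (4 * pi * s) powr (- real CARD('n) / 2)) has_real_derivative
       - real CARD('n) / (2 * s) * (4 * pi * s) powr (- real CARD('n) / 2)) (at s)"
    using assms by (intro DERIV_cong[OF *]) (simp only:, simp)
  have 2: "((\<lambda>s. exp (- A / (4 * s))) has_real_derivative A / (4 * s\<^sup>2) * exp (- A / (4 * s))) (at s)"
    using assms by (auto intro!: derivative_eq_intros simp: field_simps power2_eq_square)
  have "- real CARD('n) / (2 * s) * (4 * pi * s) powr (- real CARD('n) / 2) * exp (- A / (4 * s))
     + A / (4 * s\<^sup>2) * exp (- A / (4 * s)) * (4 * pi * s) powr (- real CARD('n) / 2)
     = (A / (4 * s\<^sup>2) - real CARD('n) / (2 * s)) * kern Heat s w"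
    by (simp add: kern_def A_def algebra_simps)
  with DERIV_mult[OF 1 2] show ?thesis
    by (simp add: kern_def A_def)
qed

text \<open>The same trade of half the decay as in \<open>Heat_space_bound\<close>. A backward step
  of at most t/2 keeps \<open>s\<close> in \<open>[t / 2, t]\<close>, where the normalising power is
  largest at t/2.\<close>

lemma Heat_time_bound:
  assumes "t / 2 \<le> s" "s \<le> t"
  shows "\<bar>(A / (4 * s\<^sup>2) - real CARD('n) / (2 * s)) * kern Heat s w\<bar>
     \<le> (2 + real CARD('n)) * (2 / t) * (2 * pi * t) powr (- real CARD('n) / 2) * exp (- A / (16 * t))"
proof -
  have s: "s > 0" using assms t by linarith
  define x where "x = A / (4 * s)"
  have x: "0 \<le> x" using s by (simp add: x_def A_def)
  have "\<bar>A / (4 * s\<^sup>2) - real CARD('n) / (2 * s)\<bar> \<le> A / (4 * s\<^sup>2) + real CARD('n) / (2 * s)"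
    using s by (intro order_trans[OF abs_triangle_ineq4]) (simp add: A_def)
  also have "\<dots> = (x + real CARD('n) / 2) / s" using s by (simp add: x_def field_simps power2_eq_square)
  finally have "\<bar>A / (4 * s\<^sup>2) - real CARD('n) / (2 * s)\<bar> * exp (- x) \<le> (x + real CARD('n) / 2) / s * exp (- x)"
    by (intro mult_right_mono) auto
  also have "\<dots> = (x + real CARD('n) / 2) * exp (- x) / s" by simp
  also have "\<dots> \<le> (2 + real CARD('n)) * exp (- x / 2) / s"
    using s x by (intro divide_right_mono one_plus_le_exp_half) auto
  also have "\<dots> = (2 + real CARD('n)) * exp (- x / 2) * (1 / s)" by simp
  also have "\<dots> \<le> (2 + real CARD('n)) * exp (- A / (16 * t)) * (2 / t)"
  proof (intro mult_mono mult_left_mono)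
    have "A / (16 * t) \<le> A / (8 * s)"
      using assms s t by (intro divide_left_mono) (auto simp: A_def)
    then show "exp (- x / 2) \<le> exp (- A / (16 * t))" by (simp add: x_def)
    show "1 / s \<le> 2 / t" using assms s t by (simp add: field_simps)
  qed (use t s in auto)
  finally have 1: "\<bar>A / (4 * s\<^sup>2) - real CARD('n) / (2 * s)\<bar> * exp (- x) \<le> (2 + real CARD('n)) * exp (- A / (16 * t)) * (2 / t)" .
  have 2: "(4 * pi * s) powr (- real CARD('n) / 2) \<le> (2 * pi * t) powr (- real CARD('n) / 2)"
    using assms t by (intro powr_mono2') auto
  have "\<bar>(A / (4 * s\<^sup>2) - real CARD('n) / (2 * s)) * kern Heat s w\<bar>
    = (\<bar>A / (4 * s\<^sup>2) - real CARD('n) / (2 * s)\<bar> * exp (- x)) * (4 * pi * s) powr (- real CARD('n) / 2)"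
    by (simp add: kern_def abs_mult x_def A_def)
  also have "\<dots> \<le> ((2 + real CARD('n)) * exp (- A / (16 * t)) * (2 / t)) * (2 * pi * t) powr (- real CARD('n) / 2)"
    using t by (intro mult_mono 1 2) auto
  finally show ?thesis by (simp only: mult_ac)
qed

lemma discrete_gen_Heat_eq:
  "discrete_gen Heat r (\<lambda>y t. kern Heat t y) w t / r\<^sup>2 =
     c * (\<Sum>b\<in>Basis. (exp (- quad A (w \<bullet> b) r / (4 * t)) + exp (- quad A (w \<bullet> b) (- r) / (4 * t)) - 2 * exp (- quad A (w \<bullet> b) 0 / (4 * t))) / r\<^sup>2)
       + (kern Heat (t - r\<^sup>2) w - kern Heat t w) / r\<^sup>2"
proof -
  have "(\<Sum>b\<in>Basis. kern Heat t (w + r *\<^sub>R b) + kern Heat t (w - r *\<^sub>R b) - 2 * kern Heat t w)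
     = (\<Sum>b\<in>Basis. c * (exp (- quad A (w \<bullet> b) r / (4 * t)) + exp (- quad A (w \<bullet> b) (- r) / (4 * t)) - 2 * exp (- quad A (w \<bullet> b) 0 / (4 * t))))"
  proof (rule sum.cong[OF refl])
    fix b :: "real^'n" assume "b \<in> Basis"
    from Heat_space[OF this, of r] Heat_space[OF this, of "-r"] Heat_space[OF this, of 0]
    show "kern Heat t (w + r *\<^sub>R b) + kern Heat t (w - r *\<^sub>R b) - 2 * kern Heat t w
        = c * (exp (- quad A (w \<bullet> b) r / (4 * t)) + exp (- quad A (w \<bullet> b) (- r) / (4 * t)) - 2 * exp (- quad A (w \<bullet> b) 0 / (4 * t)))"
      by (simp add: algebra_simps)
  qed
  then have sum_eq: "(\<Sum>b\<in>Basis. kern Heat t (w + r *\<^sub>R b) + kern Heat t (w - r *\<^sub>R b) - 2 * kern Heat t w)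
     = c * (\<Sum>b\<in>Basis. exp (- quad A (w \<bullet> b) r / (4 * t)) + exp (- quad A (w \<bullet> b) (- r) / (4 * t)) - 2 * exp (- quad A (w \<bullet> b) 0 / (4 * t)))"
    by (simp only: sum_distrib_left[symmetric])
  show ?thesis
    unfolding discrete_gen_def kernel.case sum_eq sum_divide_distrib[symmetric]
    by (simp only: add_divide_distrib times_divide_eq_right)
qed

text \<open>The spatial part tends to the Laplacian and the backward step to minus the time
  derivative. Both derivatives are the kernel times A/(4t^2) - n/(2t).\<close>

lemma discrete_gen_Heat_tendsto:
  assumes r: "\<And>k. 0 < r k" "r \<longlonglongrightarrow> 0"
  shows "(\<lambda>k. discrete_gen Heat (r k) (\<lambda>y t. kern Heat t y) w t / (r k)\<^sup>2) \<longlonglongrightarrow> 0"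
proof -
  have cv: "convergent r" using r(2) by (auto simp: convergent_def)
  then obtain R where R: "\<And>k. r k \<le> R"
    by (metis Bseq_def convergent_imp_Bseq real_norm_def abs_le_D1)
  have 1: "(\<lambda>k. (exp (- quad A a (r k) / (4 * t)) + exp (- quad A a (- r k) / (4 * t)) - 2 * exp (- quad A a 0 / (4 * t))) / (r k)\<^sup>2)
     \<longlonglongrightarrow> ((a + 0)\<^sup>2 / (4 * t\<^sup>2) - 1 / (2 * t)) * exp (- quad A a 0 / (4 * t))" for a
    using t by (intro second_difference_tendsto[OF r(1) R r(2) Heat_space_deriv]) (auto simp: quad_def intro!: continuous_intros)
  \<comment> \<open>The increment in the definition of the derivative is the negative number
    \<open>- (r k)\<^sup>2\<close>; this produces the minus sign in front of the time
    derivative.\<close>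
  have "filterlim (\<lambda>k. - (r k)\<^sup>2) (at 0) sequentially"
    unfolding filterlim_at using r(1) by (auto intro!: tendsto_eq_intros r(2) simp: less_imp_neq[symmetric])
  from filterlim_compose[OF Heat_time_deriv[OF t, unfolded DERIV_def] this]
  have "(\<lambda>k. - ((kern Heat (t + - (r k)\<^sup>2) w - kern Heat t w) / - (r k)\<^sup>2)) \<longlonglongrightarrow> - ((A / (4 * t\<^sup>2) - real CARD('n) / (2 * t)) * kern Heat t w)"
    by (rule tendsto_minus)
  then have "(\<lambda>k. (kern Heat (t - (r k)\<^sup>2) w - kern Heat t w) / (r k)\<^sup>2) \<longlonglongrightarrow> - ((A / (4 * t\<^sup>2) - real CARD('n) / (2 * t)) * kern Heat t w)"
    by simp
  then have "(\<lambda>k. discrete_gen Heat (r k) (\<lambda>y t. kern Heat t y) w t / (r k)\<^sup>2) \<longlonglongrightarrow>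
     c * (\<Sum>b\<in>Basis. (((w \<bullet> b) + 0)\<^sup>2 / (4 * t\<^sup>2) - 1 / (2 * t)) * exp (- quad A (w \<bullet> b) 0 / (4 * t)))
       + - ((A / (4 * t\<^sup>2) - real CARD('n) / (2 * t)) * kern Heat t w)"
    unfolding discrete_gen_Heat_eq by (intro tendsto_intros 1)
  also have "(\<Sum>b\<in>Basis. (((w \<bullet> b) + 0)\<^sup>2 / (4 * t\<^sup>2) - 1 / (2 * t)) * exp (- quad A (w \<bullet> b) 0 / (4 * t)))
     = (A / (4 * t\<^sup>2) - real CARD('n) / (2 * t)) * exp (- A / (4 * t))"
    by (simp add: quad_def sum_distrib_right[symmetric] sum_subtractf sum_divide_distrib[symmetric] sum_inner_Basis_sq A_def)
  also have "c * ((A / (4 * t\<^sup>2) - real CARD('n) / (2 * t)) * exp (- A / (4 * t))) + - ((A / (4 * t\<^sup>2) - real CARD('n) / (2 * t)) * kern Heat t w) = 0"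
    by (simp add: kern_def c_def A_def)
  finally show ?thesis .
qed

lemma discrete_gen_Heat_bound:
  assumes "0 < r" "r\<^sup>2 \<le> t / 2"
  shows "\<bar>discrete_gen Heat r (\<lambda>y t. kern Heat t y) w t / r\<^sup>2\<bar> \<le>
     (c * (real CARD('n) * (4 / t * exp 1)) + (2 + real CARD('n)) * (2 / t) * (2 * pi * t) powr (- real CARD('n) / 2)) * exp (- (norm w)\<^sup>2 / (16 * t))"
proof -
  let ?D = "\<lambda>b. (exp (- quad A (w \<bullet> b) r / (4 * t)) + exp (- quad A (w \<bullet> b) (- r) / (4 * t)) - 2 * exp (- quad A (w \<bullet> b) 0 / (4 * t))) / r\<^sup>2"
  have 1: "\<bar>?D b\<bar> \<le> 4 / t * exp 1 * exp (- A / (16 * t))" if "b \<in> Basis" for b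
  proof (rule second_difference_bound[OF assms(1) order_refl Heat_space_deriv Heat_space_bound])
    show "(w \<bullet> b)\<^sup>2 \<le> A" using inner_Basis_sq_le[OF that] by (simp add: A_def)
    fix \<tau> :: real assume "\<bar>\<tau>\<bar> \<le> r"
    then have "\<tau>\<^sup>2 \<le> r\<^sup>2" using assms(1) by (simp add: abs_le_square_iff[symmetric])
    then show "\<tau>\<^sup>2 \<le> t" using assms(2) t by linarith
  qed
  have "\<bar>\<Sum>b\<in>Basis. ?D b\<bar> \<le> (\<Sum>b\<in>(Basis::(real^'n) set). 4 / t * exp 1 * exp (- A / (16 * t)))"
    by (rule order_trans[OF sum_abs sum_mono[OF 1]])
  then have 2: "\<bar>\<Sum>b\<in>Basis. ?D b\<bar> \<le> real CARD('n) * (4 / t * exp 1) * exp (- A / (16 * t))"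
    by simp
  have "t - r\<^sup>2 < t" using assms(1) by simp
  moreover have "((\<lambda>s. kern Heat s w) has_real_derivative (A / (4 * s\<^sup>2) - real CARD('n) / (2 * s)) * kern Heat s w) (at s)"
    if "t - r\<^sup>2 \<le> s" "s \<le> t" for s
    using that assms(2) t by (intro Heat_time_deriv) linarith
  ultimately have "\<exists>s>t - r\<^sup>2. s < t \<and> kern Heat t w - kern Heat (t - r\<^sup>2) w = (t - (t - r\<^sup>2)) * ((A / (4 * s\<^sup>2) - real CARD('n) / (2 * s)) * kern Heat s w)"
    by (rule MVT2)
  then obtain s where s: "t - r\<^sup>2 < s" "s < t" "kern Heat t w - kern Heat (t - r\<^sup>2) w = r\<^sup>2 * ((A / (4 * s\<^sup>2) - real CARD('n) / (2 * s)) * kern Heat s w)"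
    by auto
  have "(kern Heat (t - r\<^sup>2) w - kern Heat t w) / r\<^sup>2 = - ((kern Heat t w - kern Heat (t - r\<^sup>2) w) / r\<^sup>2)"
    by (simp add: diff_divide_distrib)
  also have "\<dots> = - ((A / (4 * s\<^sup>2) - real CARD('n) / (2 * s)) * kern Heat s w)"
    unfolding s(3) using assms(1) by simp
  finally have 3: "\<bar>(kern Heat (t - r\<^sup>2) w - kern Heat t w) / r\<^sup>2\<bar>
     \<le> (2 + real CARD('n)) * (2 / t) * (2 * pi * t) powr (- real CARD('n) / 2) * exp (- A / (16 * t))"
    using Heat_time_bound[of s] s assms(2) by (simp only: abs_minus_cancel)
  have c: "c \<ge> 0" by (simp add: c_def)
  have "\<bar>discrete_gen Heat r (\<lambda>y t. kern Heat t y) w t / r\<^sup>2\<bar> \<le> c * \<bar>\<Sum>b\<in>Basis. ?D b\<bar> + \<bar>(kern Heat (t - r\<^sup>2) w - kern Heat t w) / r\<^sup>2\<bar>"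
    unfolding discrete_gen_Heat_eq using c by (intro order_trans[OF abs_triangle_ineq]) (simp only: abs_mult abs_of_nonneg order_refl)
  also have "\<dots> \<le> c * (real CARD('n) * (4 / t * exp 1) * exp (- A / (16 * t))) + (2 + real CARD('n)) * (2 / t) * (2 * pi * t) powr (- real CARD('n) / 2) * exp (- A / (16 * t))"
    by (intro add_mono mult_left_mono 2 3 c)
  finally show ?thesis by (simp only: A_def distrib_right mult.assoc)
qed

end

section \<open>Extensions of bounded functions: bounds, continuity, scaling, generator\<close>

lemma integrable_gauss:
  fixes y :: "real^'n::finite"
  assumes "t > 0"
  shows "integrable lborel (\<lambda>u. exp (- (norm (y - u))\<^sup>2 / (16 * t)))"
proof -
  have "exp (- (norm (y - u))\<^sup>2 / (16 * t)) = kern Heat (4 * t) (y - u) / (16 * pi * t) powr (- real CARD('n) / 2)" for u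
    using assms by (simp add: kern_def mult.assoc)
  then show ?thesis
    using integrable_kern[of "4 * t" Heat y] assms by simp
qed

text \<open>The dominating function does not depend on \<open>r\<close>, which is what dominated
  convergence needs: a multiple of the kernel itself for Poisson, of the heat kernel at time 4t for
  heat. The two smallness conditions on \<open>r\<close> keep the time arguments away from
  0.\<close>

lemma discrete_gen_kern_dominated:
  fixes y :: "real^'n::finite"
  assumes t: "t > 0"
  obtains Q where "integrable lborel Q" 
    "\<And>r u. 0 < r \<Longrightarrow> r \<le> t / 2 \<Longrightarrow> r\<^sup>2 \<le> t / 2 \<Longrightarrow> \<bar>discrete_gen K r (\<lambda>y t. kern K t y) (y - u) t / r\<^sup>2\<bar> \<le> Q u"
proof (cases K)
  case Poisson
  show ?thesis
    by (rule that) (unfold Poisson, rule integrable_mult_right[OF integrable_kern[OF t]], rule discrete_gen_Poisson_bound[OF t])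
next
  case Heat
  show ?thesis
    by (rule that) (unfold Heat, rule integrable_mult_right[OF integrable_gauss[OF t]], rule discrete_gen_Heat_bound[OF t])
qed

lemma discrete_gen_kern_tendsto:
  fixes w :: "real^'n::finite"
  assumes t: "t > 0" and r: "\<And>k. 0 < r k" "\<And>k. r k \<le> t / 2" "r \<longlonglongrightarrow> 0"
  shows "(\<lambda>k. discrete_gen K (r k) (\<lambda>y t. kern K t y) w t / (r k)\<^sup>2) \<longlonglongrightarrow> 0"
  using discrete_gen_Poisson_tendsto[OF t r] discrete_gen_Heat_tendsto[OF t r(1,3)] by (cases K) auto

lemma integrable_kern_mult:
  fixes a :: "real^'n::finite \<Rightarrow> real"
  assumes "t > 0" and [measurable]: "a \<in> borel_measurable borel" and M: "\<And>u. \<bar>a u\<bar> \<le> M"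
  shows "integrable lborel (\<lambda>u. kern K t (y - u) * a u)"
proof (rule Bochner_Integration.integrable_bound)
  show "integrable lborel (\<lambda>u. kern K t (y - u) * M)"
    by (intro integrable_mult_left integrable_kern assms)
  show "AE u in lborel. norm (kern K t (y - u) * a u) \<le> norm (kern K t (y - u) * M)"
  proof (intro AE_I2)
    fix u
    have "\<bar>a u\<bar> \<le> \<bar>M\<bar>" using M[of u] by linarith
    then show "norm (kern K t (y - u) * a u) \<le> norm (kern K t (y - u) * M)"
      by (simp add: abs_mult mult_left_mono)
  qed
qed simp

lemma abs_Kext_le_of_integrable:
  fixes a :: "real^'n::finite \<Rightarrow> real"
  assumes "t > 0" "integrable lborel (\<lambda>u. kern K t (y - u) * a u)" "\<And>u. \<bar>a u\<bar> \<le> M"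
  shows "\<bar>Kext K a y t\<bar> \<le> M"
proof -
  have "\<bar>Kext K a y t\<bar> \<le> (LINT u|lborel. \<bar>kern K t (y - u) * a u\<bar>)"
    unfolding Kext_def by (rule integral_abs_bound)
  also have "\<dots> \<le> (LINT u|lborel. kern K t (y - u) * M)"
  proof (rule integral_mono)
    show "integrable lborel (\<lambda>u. kern K t (y - u) * M)"
      by (intro integrable_mult_left integrable_kern assms)
    show "\<bar>kern K t (y - u) * a u\<bar> \<le> kern K t (y - u) * M" for u
      using kern_pos[OF assms(1), of K "y - u"] assms(3)[of u] by (simp add: abs_mult)
  qed (use assms in simp)
  also have "\<dots> = M" using integral_kern[OF assms(1), of K y] by simp
  finally show ?thesis .
qed

lemma abs_Kext_le:
  fixes a :: "real^'n::finite \<Rightarrow> real"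
  assumes "t > 0" and [measurable]: "a \<in> borel_measurable borel" and M: "\<And>u. \<bar>a u\<bar> \<le> M"
  shows "\<bar>Kext K a y t\<bar> \<le> M"
  using abs_Kext_le_of_integrable[OF assms(1) integrable_kern_mult[OF assms] M] by simp

text \<open>Scheffe: the kernels converge pointwise and all have mass 1. The L1 convergence gives
  continuity of extensions of data that are merely bounded and measurable.\<close>

lemma kern_L1_continuous:
  fixes y :: "real^'n::finite"
  assumes "Y \<longlonglongrightarrow> y" "T \<longlonglongrightarrow> t" "t > 0" "\<And>k. T k > 0"
  shows "(\<lambda>k. LINT u|lborel. \<bar>kern K (T k) (Y k - u) - kern K t (y - u)\<bar>) \<longlonglongrightarrow> 0"
proof -
  have eq: "(\<integral>\<^sup>+ u. ennreal (norm (kern K t (y - u))) \<partial>lborel) = 1" if "t > 0" for t and y :: "real^'n"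
    using nn_integral_kern_affine[OF that, of K y] by (simp add: abs_of_pos kern_pos[OF that])
  have lim: "(\<lambda>k. \<integral>\<^sup>+ u. ennreal (norm (kern K (T k) (Y k - u) - kern K t (y - u))) \<partial>lborel) \<longlonglongrightarrow> 0"
  proof (rule Scheffe_lemma2)
    show "AE u in lborel. (\<lambda>k. kern K (T k) (Y k - u)) \<longlonglongrightarrow> kern K t (y - u)"
      by (intro AE_I2 tendsto_kern tendsto_intros assms)
    show "(\<integral>\<^sup>+ u. ennreal (norm (kern K (T k) (Y k - u))) \<partial>lborel) \<le> (\<integral>\<^sup>+ u. ennreal (norm (kern K t (y - u))) \<partial>lborel)" for k
      by (simp only: eq assms)
  qed (use assms in \<open>simp_all add: integrable_kern\<close>)
  have "(\<integral>\<^sup>+ u. ennreal (norm (kern K (T k) (Y k - u) - kern K t (y - u))) \<partial>lborel)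
     = ennreal (LINT u|lborel. \<bar>kern K (T k) (Y k - u) - kern K t (y - u)\<bar>)" for k
    unfolding real_norm_def
    by (intro nn_integral_eq_integral integrable_abs Bochner_Integration.integrable_diff integrable_kern assms) auto
  with lim have "(\<lambda>k. ennreal (LINT u|lborel. \<bar>kern K (T k) (Y k - u) - kern K t (y - u)\<bar>)) \<longlonglongrightarrow> ennreal 0"
    by simp
  then show ?thesis
    by (rule tendsto_ennrealD) auto
qed

lemma Kext_tendsto:
  fixes a :: "real^'n::finite \<Rightarrow> real"
  assumes lim: "Y \<longlonglongrightarrow> y" "T \<longlonglongrightarrow> t" "t > 0" "\<And>k. T k > 0"
    and [measurable]: "a \<in> borel_measurable borel" and M: "\<And>u. \<bar>a u\<bar> \<le> M"
  shows "(\<lambda>k. Kext K a (Y k) (T k)) \<longlonglongrightarrow> Kext K a y t"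
proof -
  note int = integrable_kern_mult[OF _ assms(5) M]
  have le: "\<bar>Kext K a (Y k) (T k) - Kext K a y t\<bar> \<le> (LINT u|lborel. \<bar>kern K (T k) (Y k - u) - kern K t (y - u)\<bar>) * M" for k
  proof -
    have "Kext K a (Y k) (T k) - Kext K a y t = (LINT u|lborel. (kern K (T k) (Y k - u) - kern K t (y - u)) * a u)"
      unfolding Kext_def using int lim by (simp add: left_diff_distrib)
    also have "\<bar>\<dots>\<bar> \<le> (LINT u|lborel. \<bar>(kern K (T k) (Y k - u) - kern K t (y - u)) * a u\<bar>)"
      by (rule integral_abs_bound)
    also have "\<dots> \<le> (LINT u|lborel. \<bar>kern K (T k) (Y k - u) - kern K t (y - u)\<bar> * M)"
    proof (rule integral_mono)
      show "integrable lborel (\<lambda>u. \<bar>(kern K (T k) (Y k - u) - kern K t (y - u)) * a u\<bar>)"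
        unfolding left_diff_distrib using int lim by (intro integrable_abs Bochner_Integration.integrable_diff) auto
      show "integrable lborel (\<lambda>u. \<bar>kern K (T k) (Y k - u) - kern K t (y - u)\<bar> * M)"
        using lim by (intro integrable_mult_left integrable_abs Bochner_Integration.integrable_diff integrable_kern) auto
      show "\<bar>(kern K (T k) (Y k - u) - kern K t (y - u)) * a u\<bar> \<le> \<bar>kern K (T k) (Y k - u) - kern K t (y - u)\<bar> * M" for u
        unfolding abs_mult by (intro mult_left_mono M) auto
    qed
    finally show ?thesis by simp
  qed
  have lim0: "(\<lambda>k. (LINT u|lborel. \<bar>kern K (T k) (Y k - u) - kern K t (y - u)\<bar>) * M) \<longlonglongrightarrow> 0 * M"
    by (intro tendsto_intros kern_L1_continuous lim)
  have "(\<lambda>k. Kext K a (Y k) (T k) - Kext K a y t) \<longlonglongrightarrow> 0"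
    by (rule Lim_null_comparison[OF _ lim0[unfolded mult_zero_left]]) (simp add: le)
  then show ?thesis by (simp only: LIM_zero_iff)
qed

lemma continuous_on_Kext:
  fixes a :: "real^'n::finite \<Rightarrow> real"
  assumes "a \<in> borel_measurable borel" "\<And>u. \<bar>a u\<bar> \<le> M"
  shows "continuous_on {z. 0 < snd z} (\<lambda>z. Kext K a (fst z) (snd z))"
  unfolding continuous_on_sequentially
proof (intro allI ballI impI, unfold o_def)
  fix x and z :: "(real^'n) \<times> real" assume z: "z \<in> {z. 0 < snd z}" and x: "(\<forall>k. x k \<in> {z. 0 < snd z}) \<and> x \<longlonglongrightarrow> z"
  show "(\<lambda>k. Kext K a (fst (x k)) (snd (x k))) \<longlonglongrightarrow> Kext K a (fst z) (snd z)"
    by (rule Kext_tendsto[OF _ _ _ _ assms]) (use x z in \<open>auto intro!: tendsto_intros\<close>)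
qed

lemma kern_radius_pos: "t > 0 \<Longrightarrow> kern_radius K t > 0"
  by (cases K) (auto simp: kern_radius_def)

lemma kern_radius_0 [simp]: "kern_radius K 0 = 0"
  by (cases K) (auto simp: kern_radius_def)

lemma tendsto_kern_radius: "(T \<longlongrightarrow> t) F \<Longrightarrow> ((\<lambda>k. kern_radius K (T k)) \<longlongrightarrow> kern_radius K t) F"
  by (cases K) (auto simp: kern_radius_def intro!: tendsto_intros)

text \<open>The substitution fixes the kernel and moves \<open>(y, t)\<close> into the argument of
  \<open>a\<close>. The right-hand side still makes sense at \<open>t = 0\<close>, where it equals
  \<open>a y\<close>, so for continuous \<open>a\<close> it extends the extension continuously to
  the boundary.\<close>

lemma Kext_scaled:
  fixes a :: "real^'n::finite \<Rightarrow> real"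
  assumes t: "t > 0" and [measurable]: "a \<in> borel_measurable borel"
  shows "Kext K a y t = (LINT v|lborel. kern K 1 v * a (y - kern_radius K t *\<^sub>R v))"
proof -
  define c where "c = - kern_radius K t"
  have c: "c \<noteq> 0" "\<bar>c\<bar> = kern_radius K t" using kern_radius_pos[OF t, of K] by (auto simp: c_def)
  have "Kext K a y t = (LINT v|lborel. \<bar>c\<bar> ^ CARD('n) * (kern K t (y - (y + c *\<^sub>R v)) * a (y + c *\<^sub>R v)))"
    unfolding Kext_def
    by (subst lborel_affine[OF c(1), of y]) (simp add: integral_density integral_distr)
  also have "\<dots> = (LINT v|lborel. kern K 1 v * a (y - kern_radius K t *\<^sub>R v))"
  proof (rule Bochner_Integration.integral_cong[OF refl])
    fix v :: "real^'n"
    have "\<bar>c\<bar> ^ CARD('n) * (kern K t (y - (y + c *\<^sub>R v)) * a (y + c *\<^sub>R v))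
      = (kern K t (kern_radius K t *\<^sub>R v) * kern_radius K t ^ CARD('n)) * a (y - kern_radius K t *\<^sub>R v)"
      unfolding c(2) by (simp add: c_def)
    then show "\<bar>c\<bar> ^ CARD('n) * (kern K t (y - (y + c *\<^sub>R v)) * a (y + c *\<^sub>R v)) = kern K 1 v * a (y - kern_radius K t *\<^sub>R v)"
      unfolding kern_scale[OF t] .
  qed
  finally show ?thesis .
qed

lemma Kext_scaled_tendsto:
  fixes g :: "real^'n::finite \<Rightarrow> real"
  assumes "Y \<longlonglongrightarrow> y" "R \<longlonglongrightarrow> r" and g: "continuous_on UNIV g" and M: "\<And>u. \<bar>g u\<bar> \<le> M"
  shows "(\<lambda>k. LINT v|lborel. kern K 1 v * g (Y k - R k *\<^sub>R v)) \<longlonglongrightarrow> (LINT v|lborel. kern K 1 v * g (y - r *\<^sub>R v))"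
proof (rule integral_dominated_convergence)
  have [measurable]: "g \<in> borel_measurable borel" using g by (rule borel_measurable_continuous_onI)
  show "(\<lambda>v. kern K 1 v * g (y - r *\<^sub>R v)) \<in> borel_measurable lborel" 
     "\<And>k. (\<lambda>v. kern K 1 v * g (Y k - R k *\<^sub>R v)) \<in> borel_measurable lborel" by simp_all
  show "integrable lborel (\<lambda>v::real^'n. kern K 1 v * M)"
    using integrable_kern[of 1 K "0::real^'n"] by (intro integrable_mult_left) simp
  have "(\<lambda>k. g (Y k - R k *\<^sub>R v)) \<longlonglongrightarrow> g (y - r *\<^sub>R v)" for v
    by (rule continuous_on_tendsto_compose[OF g]) (auto intro!: tendsto_intros assms)
  then show "AE v in lborel. (\<lambda>k. kern K 1 v * g (Y k - R k *\<^sub>R v)) \<longlonglongrightarrow> kern K 1 v * g (y - r *\<^sub>R v)"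
    by (intro AE_I2 tendsto_intros)
  show "AE v in lborel. norm (kern K 1 v * g (Y k - R k *\<^sub>R v)) \<le> kern K 1 v * M" for k
    using M by (intro AE_I2) (simp add: abs_mult kern_pos abs_of_pos)
qed

lemma discrete_gen_Kext_eq:
  fixes a :: "real^'n::finite \<Rightarrow> real"
  assumes r: "0 < r" "r \<le> t / 2" "r\<^sup>2 \<le> t / 2"
    and [measurable]: "a \<in> borel_measurable borel" and M: "\<And>u. \<bar>a u\<bar> \<le> M"
  shows "discrete_gen K r (Kext K a) y t / r\<^sup>2 = (LINT u|lborel. discrete_gen K r (\<lambda>y t. kern K t y) (y - u) t / r\<^sup>2 * a u)"
proof -
  have t: "t > 0" "t - r > 0" "t + r > 0" "t - r\<^sup>2 > 0" using r by auto
  have hb: "has_bochner_integral lborel (\<lambda>u. kern K s (y - u) * a u) (Kext K a y s)" if "s > 0" for s y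
    unfolding Kext_def by (intro has_bochner_integral_integrable integrable_kern_mult[OF that assms(4) M])
  have hb2: "has_bochner_integral lborel (\<lambda>u. kern K s (y - u + v) * a u) (Kext K a (y + v) s)"
    "has_bochner_integral lborel (\<lambda>u. kern K s (y - u - v) * a u) (Kext K a (y - v) s)" if "s > 0" for s y v
    using hb[OF that, of "y + v"] hb[OF that, of "y - v"] by (simp_all add: algebra_simps)
  \<comment> \<open>The integrand of the generator with \<open>a u\<close> distributed over its
    terms, so that linearity of the integral applies term by term.\<close>
  define F where "F u = (\<Sum>b\<in>Basis. kern K t (y - u + r *\<^sub>R b) * a u + kern K t (y - u - r *\<^sub>R b) * a u - 2 * (kern K t (y - u) * a u)) +
     (case K of Poisson \<Rightarrow> kern K (t + r) (y - u) * a u + kern K (t - r) (y - u) * a u - 2 * (kern K t (y - u) * a u)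
      | Heat \<Rightarrow> kern K (t - r\<^sup>2) (y - u) * a u - kern K t (y - u) * a u)" for u
  have "has_bochner_integral lborel F (discrete_gen K r (Kext K a) y t)"
    unfolding F_def[abs_def] discrete_gen_def
  proof (intro has_bochner_integral_add has_bochner_integral_sum has_bochner_integral_diff has_bochner_integral_mult_right hb hb2 t)
    show "has_bochner_integral lborel (\<lambda>u. case K of
         Poisson \<Rightarrow> kern K (t + r) (y - u) * a u + kern K (t - r) (y - u) * a u - 2 * (kern K t (y - u) * a u)
       | Heat \<Rightarrow> kern K (t - r\<^sup>2) (y - u) * a u - kern K t (y - u) * a u)
      (case K of Poisson \<Rightarrow> Kext K a y (t + r) + Kext K a y (t - r) - 2 * Kext K a y t
       | Heat \<Rightarrow> Kext K a y (t - r\<^sup>2) - Kext K a y t)"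
    proof (cases K)
      case Poisson
      show ?thesis unfolding Poisson kernel.case
        by (intro has_bochner_integral_add has_bochner_integral_diff has_bochner_integral_mult_right hb[unfolded Poisson] t)
    next
      case Heat
      show ?thesis unfolding Heat kernel.case
        by (intro has_bochner_integral_diff hb[unfolded Heat] t)
    qed
  qed
  moreover have "F = (\<lambda>u. discrete_gen K r (\<lambda>y t. kern K t y) (y - u) t * a u)"
    unfolding F_def discrete_gen_def
    by (intro ext, cases K) (simp_all only: kernel.case distrib_right left_diff_distrib sum_distrib_right mult.assoc)
  ultimately have "(LINT u|lborel. discrete_gen K r (\<lambda>y t. kern K t y) (y - u) t * a u) = discrete_gen K r (Kext K a) y t"
    by (simp add: has_bochner_integral_iff)
  then show ?thesis by simp
qed

text \<open>Harmonicity (caloricity) of extensions in the weak form that the maximum principle uses: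
  the generator falls on the kernel, and the limit is taken under the integral.\<close>

lemma discrete_gen_Kext_tendsto:
  fixes a :: "real^'n::finite \<Rightarrow> real"
  assumes t: "t > 0" and r: "\<And>k. 0 < r k" "\<And>k. r k \<le> t / 2" "\<And>k. (r k)\<^sup>2 \<le> t / 2" "r \<longlonglongrightarrow> 0"
    and [measurable]: "a \<in> borel_measurable borel" and M: "\<And>u. \<bar>a u\<bar> \<le> M"
  shows "(\<lambda>k. discrete_gen K (r k) (Kext K a) y t / (r k)\<^sup>2) \<longlonglongrightarrow> 0"
proof -
  obtain Q where Q: "integrable lborel Q" 
    "\<And>r u. 0 < r \<Longrightarrow> r \<le> t / 2 \<Longrightarrow> r\<^sup>2 \<le> t / 2 \<Longrightarrow> \<bar>discrete_gen K r (\<lambda>y t. kern K t y) (y - u) t / r\<^sup>2\<bar> \<le> Q u"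
    using discrete_gen_kern_dominated[OF t] by blast
  have [measurable]: "Q \<in> borel_measurable borel" using Q(1) by auto
  have [measurable]: "(\<lambda>u. discrete_gen K r (\<lambda>y t. kern K t y) (y - u) t) \<in> borel_measurable borel" for r
    unfolding discrete_gen_def by (cases K) simp_all
  have "(\<lambda>k. LINT u|lborel. discrete_gen K (r k) (\<lambda>y t. kern K t y) (y - u) t / (r k)\<^sup>2 * a u) \<longlonglongrightarrow> (LINT u|(lborel::(real^'n) measure). 0)"
  proof (rule integral_dominated_convergence)
    show "integrable lborel (\<lambda>u. Q u * M)" by (intro integrable_mult_left Q(1))
    have "(\<lambda>k. discrete_gen K (r k) (\<lambda>y t. kern K t y) (y - u) t / (r k)\<^sup>2 * a u) \<longlonglongrightarrow> 0 * a u" for u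
      by (intro tendsto_intros discrete_gen_kern_tendsto t r)
    then show "AE u in lborel. (\<lambda>k. discrete_gen K (r k) (\<lambda>y t. kern K t y) (y - u) t / (r k)\<^sup>2 * a u) \<longlonglongrightarrow> 0"
      by simp
    show "AE u in lborel. norm (discrete_gen K (r k) (\<lambda>y t. kern K t y) (y - u) t / (r k)\<^sup>2 * a u) \<le> Q u * M" for k
      unfolding real_norm_def abs_mult
      by (intro AE_I2 mult_mono Q(2) M r) (auto intro: order_trans[OF abs_ge_zero Q(2)] r)
  qed simp_all
  then show ?thesis
    unfolding discrete_gen_Kext_eq[OF r(1-3) assms(6) M] by (simp only: Bochner_Integration.integral_zero)
qed

section \<open>Boundary values\<close>

lemma Kext_shift:
  fixes D :: "real^'n::finite \<Rightarrow> real"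
  assumes [measurable]: "D \<in> borel_measurable borel"
  shows "(LINT u|lborel. kern K t (y - u) * D (u - h)) = Kext K D (y - h) t"
proof -
  have "(LINT u|lborel. kern K t (y - u) * D (u - h)) = (LINT u|distr lborel borel ((+) h). kern K t (y - u) * D (u - h))"
    by (simp only: lborel_distr_plus)
  also have "\<dots> = (LINT u|lborel. kern K t (y - (h + u)) * D ((h + u) - h))"
    by (subst integral_distr) simp_all
  finally have "(LINT u|lborel. kern K t (y - u) * D (u - h)) = (LINT u|lborel. kern K t (y - (h + u)) * D ((h + u) - h))" .
  then show ?thesis by (simp add: Kext_def algebra_simps)
qed

lemma continuous_on_Kext_fst:
  fixes a :: "real^'n::finite \<Rightarrow> real"
  assumes t: "t > 0" and "a \<in> borel_measurable borel" "\<And>u. \<bar>a u\<bar> \<le> M"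
  shows "continuous_on UNIV (\<lambda>u. Kext K a u t)"
proof -
  have "continuous_on UNIV (\<lambda>u::real^'n. (u, t))" by (intro continuous_intros)
  moreover have "range (\<lambda>u::real^'n. (u, t)) \<subseteq> {z. 0 < snd z}" using t by auto
  ultimately show ?thesis
    using continuous_on_compose2[OF continuous_on_Kext[OF assms(2,3)], of UNIV "\<lambda>u. (u, t)" K] by simp
qed

lemma bounded_measurable_approx_continuous:
  fixes a :: "real^'n::finite \<Rightarrow> real"
  assumes "a \<in> borel_measurable borel" and M: "\<And>u. \<bar>a u\<bar> \<le> M"
  obtains g where "\<And>n::nat. continuous_on UNIV (g n)" "\<And>n u. \<bar>g n u\<bar> \<le> M" "AE u in lborel. (\<lambda>n. g n u) \<longlonglongrightarrow> a u"
proof -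
  have "a \<in> borel_measurable lebesgue" using assms(1) by (simp add: measurable_completion)
  then have "a measurable_on UNIV" by (intro lebesgue_measurable_imp_measurable_on) auto
  then obtain N g where N: "negligible N" and g: "\<And>n. continuous_on UNIV (g n)" "\<And>x. x \<notin> N \<Longrightarrow> (\<lambda>n::nat. g n x) \<longlonglongrightarrow> a x"
    unfolding measurable_on_def by auto
  have M0: "0 \<le> M" using M[of undefined] by linarith
  have N': "AE u in lborel. u \<notin> N"
  proof -
    have "AE u in lebesgue. u \<notin> N" using N by (intro AE_not_in) (simp add: negligible_iff_null_sets)
    then show ?thesis by (simp add: AE_completion_iff)
  qed
  show thesis
  proof (rule that[of "\<lambda>n u. max (- M) (min M (g n u))"])
    show "continuous_on UNIV (\<lambda>u. max (- M) (min M (g n u)))" for n by (intro continuous_intros g)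
    show "\<bar>max (- M) (min M (g n u))\<bar> \<le> M" for n u using M0 by (auto simp: abs_le_iff)
    show "AE u in lborel. (\<lambda>n. max (- M) (min M (g n u))) \<longlonglongrightarrow> a u"
      using N'
    proof (eventually_elim)
      case (elim u)
      have "(\<lambda>n. max (- M) (min M (g n u))) \<longlonglongrightarrow> max (- M) (min M (a u))"
        by (intro tendsto_intros g elim)
      moreover have "max (- M) (min M (a u)) = a u" using M[of u] by (auto simp: abs_le_iff)
      ultimately show ?case by simp
    qed
  qed
qed

text \<open>Approximate \<open>a\<close> by bounded continuous functions and use the triangle
  inequality. The weighted measure is not translation invariant, so the shifted error is not equal
  to the unshifted one. By \<open>Kext_shift\<close> it is an extension evaluated at the shifted
  point \<open>y - h k\<close>, hence converges to the unshifted error.\<close>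

lemma translation_L1_tendsto:
  fixes a :: "real^'n::finite \<Rightarrow> real"
  assumes t: "t > 0" and [measurable]: "a \<in> borel_measurable borel" and M: "\<And>u. \<bar>a u\<bar> \<le> M" and h: "h \<longlonglongrightarrow> 0"
  shows "(\<lambda>k. LINT u|lborel. kern K t (y - u) * \<bar>a (u - h k) - a u\<bar>) \<longlonglongrightarrow> 0"
proof -
  have M0: "0 \<le> M" using M[of undefined] by linarith
  obtain g where g: "\<And>n::nat. continuous_on UNIV (g n)" "\<And>n u. \<bar>g n u\<bar> \<le> M" "AE u in lborel. (\<lambda>n. g n u) \<longlonglongrightarrow> a u"
    using bounded_measurable_approx_continuous[OF assms(2) M] by blast
  have [measurable]: "g n \<in> borel_measurable borel" for n by (rule borel_measurable_continuous_onI[OF g(1)])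
  have int: "integrable lborel (\<lambda>u. kern K t (y - u) * c u)" if "c \<in> borel_measurable borel" "\<And>u. \<bar>c u\<bar> \<le> 2 * M" for c y
    by (rule integrable_kern_mult[OF t that])
  define D where "D n u = \<bar>a u - g n u\<bar>" for n u
  have D[measurable]: "D n \<in> borel_measurable borel" for n unfolding D_def[abs_def] by simp
  have DM: "\<bar>D n u\<bar> \<le> 2 * M" for n u using M[of u] g(2)[of n u] by (simp add: D_def abs_le_iff)
  have kb: "AE u in lborel. norm (kern K t (y - u) * c u) \<le> kern K t (y - u) * (2 * M)" if "\<And>u. \<bar>c u\<bar> \<le> 2 * M" for c :: "real^'n \<Rightarrow> real"
    using that by (intro AE_I2) (simp add: abs_mult kern_pos[OF t] abs_of_pos)
  have ki: "integrable lborel (\<lambda>u. kern K t (y - u) * (2 * M))"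
    by (intro integrable_mult_left integrable_kern t)
  have "(\<lambda>n. LINT u|lborel. kern K t (y - u) * D n u) \<longlonglongrightarrow> (LINT u|lborel. kern K t (y - u) * 0)"
  proof (rule integral_dominated_convergence[OF _ _ ki])
    show "AE u in lborel. (\<lambda>n. kern K t (y - u) * D n u) \<longlonglongrightarrow> kern K t (y - u) * 0"
      using g(3)
    proof eventually_elim
      case (elim u)
      have "(\<lambda>n. \<bar>a u - g n u\<bar>) \<longlonglongrightarrow> \<bar>a u - a u\<bar>" by (intro tendsto_intros elim)
      then show ?case unfolding D_def by (intro tendsto_intros) simp
    qed
  qed (use kb[OF DM] in simp_all)
  then have D0: "(\<lambda>n. Kext K (D n) y t) \<longlonglongrightarrow> 0" by (simp add: Kext_def)
  show ?thesis
  proof (rule LIMSEQ_I)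
    fix e :: real assume e: "0 < e"
    \<comment> \<open>The error of approximation counts twice in the limit, once shifted and once
      unshifted; e/4 leaves room for both.\<close>
    from LIMSEQ_D[OF D0, of "e / 4"] e obtain n where n: "\<bar>Kext K (D n) y t\<bar> < e / 4" by auto
    define E where "E k = (LINT u|lborel. kern K t (y - u) * \<bar>g n (u - h k) - g n u\<bar>)" for k
    have gM: "\<bar>\<bar>g n (u - h k) - g n u\<bar>\<bar> \<le> 2 * M" for u k using g(2)[of n u] g(2)[of n "u - h k"] by (simp add: abs_le_iff)
    have aM: "\<bar>\<bar>a (u - h k) - a u\<bar>\<bar> \<le> 2 * M" for u k using M[of u] M[of "u - h k"] by (simp add: abs_le_iff)
    have "E \<longlonglongrightarrow> (LINT u|lborel. kern K t (y - u) * 0)"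
      unfolding E_def
    proof (rule integral_dominated_convergence[OF _ _ ki])
      have "(\<lambda>k. \<bar>g n (u - h k) - g n u\<bar>) \<longlonglongrightarrow> 0" for u
      proof -
        have "(\<lambda>k. g n (u - h k)) \<longlonglongrightarrow> g n (u - 0)"
          by (rule continuous_on_tendsto_compose[OF g(1)]) (auto intro!: tendsto_eq_intros h)
        then have "(\<lambda>k. \<bar>g n (u - h k) - g n u\<bar>) \<longlonglongrightarrow> \<bar>g n (u - 0) - g n u\<bar>" by (intro tendsto_intros)
        then show ?thesis by simp
      qed
      then show "AE u in lborel. (\<lambda>k. kern K t (y - u) * \<bar>g n (u - h k) - g n u\<bar>) \<longlonglongrightarrow> kern K t (y - u) * 0"
        by (intro AE_I2 tendsto_intros)
    qed (use kb[OF gM] in simp_all)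
    then have E0: "E \<longlonglongrightarrow> 0" by simp
    have "(\<lambda>k. Kext K (D n) (y - h k) t) \<longlonglongrightarrow> Kext K (D n) (y - 0) t"
      by (rule Kext_tendsto[OF _ _ t _ D DM]) (auto intro!: tendsto_eq_intros h t)
    then have "(\<lambda>k. Kext K (D n) (y - h k) t + E k + Kext K (D n) y t) \<longlonglongrightarrow> Kext K (D n) (y - 0) t + 0 + Kext K (D n) y t"
      by (intro tendsto_intros E0)
    moreover have "Kext K (D n) (y - 0) t + 0 + Kext K (D n) y t < e" using n by simp
    ultimately have ev: "\<forall>\<^sub>F k in sequentially. Kext K (D n) (y - h k) t + E k + Kext K (D n) y t < e"
      by (rule order_tendstoD)
    have le: "(LINT u|lborel. kern K t (y - u) * \<bar>a (u - h k) - a u\<bar>) \<le> Kext K (D n) (y - h k) t + E k + Kext K (D n) y t" for k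
    proof -
      have Dk: "\<bar>D n (u - h k)\<bar> \<le> 2 * M" for u by (rule DM)
      have i: "integrable lborel (\<lambda>u. kern K t (y - u) * D n (u - h k))" "integrable lborel (\<lambda>u. kern K t (y - u) * \<bar>g n (u - h k) - g n u\<bar>)"
        "integrable lborel (\<lambda>u. kern K t (y - u) * D n u)" "integrable lborel (\<lambda>u. kern K t (y - u) * \<bar>a (u - h k) - a u\<bar>)"
        by (rule int, simp, rule Dk gM DM aM)+
      have "(LINT u|lborel. kern K t (y - u) * \<bar>a (u - h k) - a u\<bar>)
        \<le> (LINT u|lborel. kern K t (y - u) * D n (u - h k) + kern K t (y - u) * \<bar>g n (u - h k) - g n u\<bar> + kern K t (y - u) * D n u)"
      proof (rule integral_mono)
        show "kern K t (y - u) * \<bar>a (u - h k) - a u\<bar> \<le> kern K t (y - u) * D n (u - h k) + kern K t (y - u) * \<bar>g n (u - h k) - g n u\<bar> + kern K t (y - u) * D n u" for u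
          unfolding distrib_left[symmetric] D_def using kern_pos[OF t, of K "y - u"] by (intro mult_left_mono) auto
      qed (intro Bochner_Integration.integrable_add i)+
      also have "\<dots> = (LINT u|lborel. kern K t (y - u) * D n (u - h k)) + E k + Kext K (D n) y t"
        using i by (simp add: E_def Kext_def)
      finally show ?thesis by (simp only: Kext_shift[OF D])
    qed
    have nn: "0 \<le> (LINT u|lborel. kern K t (y - u) * \<bar>a (u - h k) - a u\<bar>)" for k
      by (intro integral_nonneg_AE AE_I2 mult_nonneg_nonneg less_imp_le[OF kern_pos[OF t]]) auto
    from ev obtain k0 where "\<And>k. k \<ge> k0 \<Longrightarrow> Kext K (D n) (y - h k) t + E k + Kext K (D n) y t < e"
      unfolding eventually_sequentially by blast
    then have "\<forall>k\<ge>k0. norm ((LINT u|lborel. kern K t (y - u) * \<bar>a (u - h k) - a u\<bar>) - 0) < e"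
      using le nn by (auto intro: le_less_trans)
    then show "\<exists>k0. \<forall>k\<ge>k0. norm ((LINT u|lborel. kern K t (y - u) * \<bar>a (u - h k) - a u\<bar>) - 0) < e" by blast
  qed
qed

text \<open>By \<open>Kext_scaled\<close> the error at \<open>u\<close> is at most a
  \<open>kern K 1\<close>-average of translation differences. After Fubini it becomes an average of
  \<open>J\<close> over translations that shrink to 0, where \<open>J\<close> tends to 0 and is
  bounded by 2M.\<close>

lemma Kext_L1_tendsto:
  fixes a :: "real^'n::finite \<Rightarrow> real"
  assumes t: "t > 0" and [measurable]: "a \<in> borel_measurable borel" and M: "\<And>u. \<bar>a u\<bar> \<le> M"
    and \<epsilon>: "\<And>k. \<epsilon> k > 0" "\<epsilon> \<longlonglongrightarrow> 0"
  shows "(\<lambda>k. LINT u|lborel. kern K t (y - u) * \<bar>Kext K a u (\<epsilon> k) - a u\<bar>) \<longlonglongrightarrow> 0"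
proof -
  have M0: "0 \<le> M" using M[of undefined] by linarith
  define J where "J h = (LINT u|lborel. kern K t (y - u) * \<bar>a (u - h) - a u\<bar>)" for h
  have aM: "\<bar>\<bar>a (u - h) - a u\<bar>\<bar> \<le> 2 * M" for u h using M[of u] M[of "u - h"] by (simp add: abs_le_iff)
  have iJ: "integrable lborel (\<lambda>u. kern K t (y - u) * \<bar>a (u - h) - a u\<bar>)" for h
    by (rule integrable_kern_mult[OF t _ aM]) simp
  have J0: "0 \<le> J h" for h
    unfolding J_def by (intro integral_nonneg_AE AE_I2 mult_nonneg_nonneg less_imp_le[OF kern_pos[OF t]]) auto
  have JM: "J h \<le> 2 * M" for h
    using abs_Kext_le_of_integrable[OF t iJ aM] by (simp add: J_def Kext_def abs_le_iff)
  have [measurable]: "J \<in> borel_measurable borel"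
    unfolding J_def[abs_def] by (rule lborel.borel_measurable_lebesgue_integral) simp
  have k1: "integrable lborel (\<lambda>v::real^'n. kern K 1 v)" using integrable_kern[of 1 K "0::real^'n"] by simp
  have k1i: "(LINT v|lborel. kern K 1 (v::real^'n)) = 1" using integral_kern[of 1 K "0::real^'n"] by simp
  have bnd: "integrable lborel (\<lambda>v. kern K 1 v * c v)" if [measurable]: "c \<in> borel_measurable borel" and c: "\<And>v. \<bar>c v\<bar> \<le> B" for c :: "real^'n \<Rightarrow> real" and B
    using integrable_kern_mult[of 1 c B K 0] that by simp
  have le: "(LINT u|lborel. kern K t (y - u) * \<bar>Kext K a u e - a u\<bar>) \<le> (LINT v|lborel. kern K 1 v * J (kern_radius K e *\<^sub>R v))" if e: "e > 0" for e
  proof -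
    let ?r = "kern_radius K e"
    have "continuous_on UNIV (\<lambda>u. Kext K a u e)"
      by (rule continuous_on_Kext_fst[OF e assms(2) M])
    then have [measurable]: "(\<lambda>u. Kext K a u e) \<in> borel_measurable borel" by (rule borel_measurable_continuous_onI)
    have KM: "\<bar>\<bar>Kext K a u e - a u\<bar>\<bar> \<le> 2 * M" for u
      using abs_Kext_le[OF e assms(2) M, of K u] M[of u] by (simp add: abs_le_iff)
    have aM': "\<bar>\<bar>a (u - ?r *\<^sub>R v) - a u\<bar>\<bar> \<le> 2 * M" for u v by (rule aM)
    have pt: "\<bar>Kext K a u e - a u\<bar> \<le> (LINT v|lborel. kern K 1 v * \<bar>a (u - ?r *\<^sub>R v) - a u\<bar>)" for u
    proof -
      have i1: "integrable lborel (\<lambda>v. kern K 1 v * a (u - ?r *\<^sub>R v))" by (rule bnd[where B = M]) (auto intro: M)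
      have "Kext K a u e - a u = (LINT v|lborel. kern K 1 v * a (u - ?r *\<^sub>R v) - kern K 1 v * a u)"
        using i1 k1 by (simp add: Kext_scaled[OF e] k1i)
      also have "\<bar>\<dots>\<bar> \<le> (LINT v|lborel. \<bar>kern K 1 v * a (u - ?r *\<^sub>R v) - kern K 1 v * a u\<bar>)"
        by (rule integral_abs_bound)
      also have "\<dots> = (LINT v|lborel. kern K 1 v * \<bar>a (u - ?r *\<^sub>R v) - a u\<bar>)"
        by (simp add: right_diff_distrib[symmetric] abs_mult kern_pos abs_of_pos)
      finally show ?thesis .
    qed
    have "ennreal (LINT u|lborel. kern K t (y - u) * \<bar>Kext K a u e - a u\<bar>) = (\<integral>\<^sup>+ u. ennreal (kern K t (y - u) * \<bar>Kext K a u e - a u\<bar>) \<partial>lborel)"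
      by (subst nn_integral_eq_integral) (auto intro!: integrable_kern_mult[OF t _ KM] AE_I2 mult_nonneg_nonneg less_imp_le[OF kern_pos[OF t]])
    also have "\<dots> \<le> (\<integral>\<^sup>+ u. (\<integral>\<^sup>+ v. ennreal (kern K t (y - u) * (kern K 1 v * \<bar>a (u - ?r *\<^sub>R v) - a u\<bar>)) \<partial>lborel) \<partial>lborel)"
    proof (intro nn_integral_mono)
      fix u
      have i: "integrable lborel (\<lambda>v. kern K 1 v * \<bar>a (u - ?r *\<^sub>R v) - a u\<bar>)" by (rule bnd[OF _ aM']) simp
      have "(\<integral>\<^sup>+ v. ennreal (kern K t (y - u) * (kern K 1 v * \<bar>a (u - ?r *\<^sub>R v) - a u\<bar>)) \<partial>lborel)
         = ennreal (LINT v|lborel. kern K t (y - u) * (kern K 1 v * \<bar>a (u - ?r *\<^sub>R v) - a u\<bar>))"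
        using i by (intro nn_integral_eq_integral integrable_mult_right)
          (auto intro!: AE_I2 mult_nonneg_nonneg less_imp_le[OF kern_pos] t)
      also have "\<dots> = ennreal (kern K t (y - u) * (LINT v|lborel. kern K 1 v * \<bar>a (u - ?r *\<^sub>R v) - a u\<bar>))" by simp
      finally show "ennreal (kern K t (y - u) * \<bar>Kext K a u e - a u\<bar>) \<le> (\<integral>\<^sup>+ v. ennreal (kern K t (y - u) * (kern K 1 v * \<bar>a (u - ?r *\<^sub>R v) - a u\<bar>)) \<partial>lborel)"
        using pt[of u] kern_pos[OF t, of K "y - u"] by (simp add: ennreal_leI mult_left_mono)
    qed
    also have "\<dots> = (\<integral>\<^sup>+ v. (\<integral>\<^sup>+ u. ennreal (kern K t (y - u) * (kern K 1 v * \<bar>a (u - ?r *\<^sub>R v) - a u\<bar>)) \<partial>lborel) \<partial>lborel)"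
      by (rule lborel_pair.Fubini') simp
    also have "\<dots> = (\<integral>\<^sup>+ v. ennreal (kern K 1 v * J (?r *\<^sub>R v)) \<partial>lborel)"
    proof (intro nn_integral_cong)
      fix v
      have "(\<integral>\<^sup>+ u. ennreal (kern K t (y - u) * (kern K 1 v * \<bar>a (u - ?r *\<^sub>R v) - a u\<bar>)) \<partial>lborel)
        = (\<integral>\<^sup>+ u. ennreal (kern K 1 v * (kern K t (y - u) * \<bar>a (u - ?r *\<^sub>R v) - a u\<bar>)) \<partial>lborel)"
        by (simp add: mult.left_commute)
      also have "\<dots> = ennreal (LINT u|lborel. kern K 1 v * (kern K t (y - u) * \<bar>a (u - ?r *\<^sub>R v) - a u\<bar>))"
        by (intro nn_integral_eq_integral integrable_mult_right iJ)
          (auto intro!: AE_I2 mult_nonneg_nonneg less_imp_le[OF kern_pos] t)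
      finally show "(\<integral>\<^sup>+ u. ennreal (kern K t (y - u) * (kern K 1 v * \<bar>a (u - ?r *\<^sub>R v) - a u\<bar>)) \<partial>lborel) = ennreal (kern K 1 v * J (?r *\<^sub>R v))"
        by (simp add: J_def)
    qed
    also have "\<dots> = ennreal (LINT v|lborel. kern K 1 v * J (?r *\<^sub>R v))"
      by (intro nn_integral_eq_integral bnd[where B = "2 * M"])
         (auto intro!: AE_I2 mult_nonneg_nonneg less_imp_le[OF kern_pos] J0 simp: abs_of_nonneg[OF J0] JM)
    finally show ?thesis
      by (subst (asm) ennreal_le_iff) (auto intro!: integral_nonneg_AE AE_I2 mult_nonneg_nonneg less_imp_le[OF kern_pos] J0)
  qed
  have "(\<lambda>k. LINT v|lborel. kern K 1 v * J (kern_radius K (\<epsilon> k) *\<^sub>R v)) \<longlonglongrightarrow> (LINT v|(lborel::(real^'n) measure). kern K 1 v * 0)"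
  proof (rule integral_dominated_convergence)
    show "integrable lborel (\<lambda>v::real^'n. kern K 1 v * (2 * M))" by (intro integrable_mult_left k1)
    have "(\<lambda>k. J (kern_radius K (\<epsilon> k) *\<^sub>R v)) \<longlonglongrightarrow> 0" for v
      unfolding J_def by (rule translation_L1_tendsto[OF t assms(2) M])
        (use tendsto_scaleR[OF tendsto_kern_radius[OF \<epsilon>(2), of K] tendsto_const[of v]] in simp)
    then show "AE v in lborel. (\<lambda>k. kern K 1 v * J (kern_radius K (\<epsilon> k) *\<^sub>R v)) \<longlonglongrightarrow> kern K 1 v * 0"
      by (intro AE_I2 tendsto_intros)
    show "AE v in lborel. norm (kern K 1 v * J (kern_radius K (\<epsilon> k) *\<^sub>R v)) \<le> kern K 1 v * (2 * M)" for k
      using J0 JM by (intro AE_I2) (simp add: abs_mult kern_pos abs_of_pos abs_of_nonneg)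
  qed simp_all
  then have lim: "(\<lambda>k. LINT v|lborel. kern K 1 v * J (kern_radius K (\<epsilon> k) *\<^sub>R v)) \<longlonglongrightarrow> 0"
    by (simp only: mult_zero_right Bochner_Integration.integral_zero)
  have nn: "0 \<le> (LINT u|lborel. kern K t (y - u) * \<bar>Kext K a u e - a u\<bar>)" for e
    by (intro integral_nonneg_AE AE_I2 mult_nonneg_nonneg less_imp_le[OF kern_pos[OF t]]) auto
  show ?thesis
    by (rule tendsto_sandwich[OF _ _ tendsto_const lim]) (simp_all add: nn le \<epsilon>(1))
qed

text \<open>L1 convergence gives almost everywhere convergence along a subsequence of times, which
  is enough for the boundary behaviour. Adding the errors of \<open>a\<close> and \<open>b\<close>
  makes one subsequence serve both; the weight \<open>kern K 1 (0 - u)\<close> is positive and is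
  divided out.\<close>

lemma Kext_AE_tendsto_subseq:
  fixes a b :: "real^'n::finite \<Rightarrow> real"
  assumes [measurable]: "a \<in> borel_measurable borel" "b \<in> borel_measurable borel"
    and M: "\<And>u. \<bar>a u\<bar> \<le> M" "\<And>u. \<bar>b u\<bar> \<le> M"
  obtains \<epsilon> :: "nat \<Rightarrow> real" where "\<And>k. \<epsilon> k > 0" "\<epsilon> \<longlonglongrightarrow> 0"
    "AE u in lborel. (\<lambda>k. Kext K a u (\<epsilon> k)) \<longlonglongrightarrow> a u" "AE u in lborel. (\<lambda>k. Kext K b u (\<epsilon> k)) \<longlonglongrightarrow> b u"
proof -
  define e where "e k = inverse (real (Suc k))" for k
  have e: "\<And>k. e k > 0" "e \<longlonglongrightarrow> 0" unfolding e_def[abs_def] by (simp, rule LIMSEQ_inverse_real_of_nat)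
  have i: "integrable lborel (\<lambda>u. kern K 1 (0 - u) * \<bar>Kext K c u (e k) - c u\<bar>)" if [measurable]: "c \<in> borel_measurable borel" and c: "\<And>u. \<bar>c u\<bar> \<le> M" for c :: "real^'n \<Rightarrow> real" and k
  proof (rule integrable_kern_mult[where M = "2 * M"])
    have "continuous_on UNIV (\<lambda>u. Kext K c u (e k))"
      by (rule continuous_on_Kext_fst[OF e(1) that])
    then have [measurable]: "(\<lambda>u. Kext K c u (e k)) \<in> borel_measurable borel" by (rule borel_measurable_continuous_onI)
    show "(\<lambda>u. \<bar>Kext K c u (e k) - c u\<bar>) \<in> borel_measurable borel" by simp
    show "\<bar>\<bar>Kext K c u (e k) - c u\<bar>\<bar> \<le> 2 * M" for u
      using abs_Kext_le[OF e(1)[of k] that, of K u] c[of u] by (simp add: abs_le_iff)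
  qed simp
  note ia = i[OF assms(1) M(1)] and ib = i[OF assms(2) M(2)]
  define F where "F k u = kern K 1 (0 - u) * \<bar>Kext K a u (e k) - a u\<bar> + kern K 1 (0 - u) * \<bar>Kext K b u (e k) - b u\<bar>" for k u
  have iF: "integrable lborel (F k)" for k unfolding F_def[abs_def] by (intro Bochner_Integration.integrable_add ia ib)
  have Fn: "0 \<le> F k u" for k u unfolding F_def using kern_pos[of 1 K "0 - u"] by simp
  have "(\<lambda>k. (LINT u|lborel. kern K 1 (0 - u) * \<bar>Kext K a u (e k) - a u\<bar>) + (LINT u|lborel. kern K 1 (0 - u) * \<bar>Kext K b u (e k) - b u\<bar>)) \<longlonglongrightarrow> 0 + 0"
    by (intro tendsto_add Kext_L1_tendsto[where M = M] e M) simp_all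
  then have "(\<lambda>k. LINT u|lborel. norm (F k u)) \<longlonglongrightarrow> 0"
    using ia ib Fn by (simp add: F_def)
  from tendsto_L1_AE_subseq[OF iF this] obtain r where r: "strict_mono r" "AE u in lborel. (\<lambda>k. F (r k) u) \<longlonglongrightarrow> 0" by blast
  have conv: "(\<lambda>k. c k) \<longlonglongrightarrow> l" if F0: "(\<lambda>k. F (r k) u) \<longlonglongrightarrow> 0" and c: "\<And>k. kern K 1 (0 - u) * \<bar>c k - l\<bar> \<le> F (r k) u" for c l u
  proof -
    have "(\<lambda>k. F (r k) u / kern K 1 (0 - u)) \<longlonglongrightarrow> 0 / kern K 1 (0 - u)"
      using kern_pos[of 1 K "0 - u"] by (intro tendsto_intros F0) auto
    then have lim: "(\<lambda>k. F (r k) u / kern K 1 (0 - u)) \<longlonglongrightarrow> 0" by (simp only: div_0)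
    have "\<bar>c k - l\<bar> \<le> F (r k) u / kern K 1 (0 - u)" for k
      using c[of k] kern_pos[of 1 K "0 - u"] by (simp only: pos_le_divide_eq zero_less_one mult.commute)
    then have "(\<lambda>k. c k - l) \<longlonglongrightarrow> 0"
      by (intro Lim_null_comparison[OF _ lim] always_eventually allI) (simp only: real_norm_def)
    then show ?thesis by (simp only: LIM_zero_iff)
  qed
  have pos: "0 \<le> kern K 1 (0 - u)" for u :: "real^'n" using kern_pos[of 1 K "0 - u"] by simp
  show thesis
  proof (rule that[of "e \<circ> r"])
    show "(e \<circ> r) k > 0" for k using e by simp
    show "(e \<circ> r) \<longlonglongrightarrow> 0" by (rule LIMSEQ_subseq_LIMSEQ[OF e(2) r(1)])
    show "AE u in lborel. (\<lambda>k. Kext K a u ((e \<circ> r) k)) \<longlonglongrightarrow> a u"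
      using r(2) by eventually_elim (rule conv, assumption, use pos in \<open>simp add: F_def\<close>)
    show "AE u in lborel. (\<lambda>k. Kext K b u ((e \<circ> r) k)) \<longlonglongrightarrow> b u"
      using r(2) by eventually_elim (rule conv, assumption, use pos in \<open>simp add: F_def\<close>)
  qed
qed

section \<open>The maximum principle\<close>

lemma discrete_gen_diff: "discrete_gen K r (\<lambda>y t. F y t - G y t) y t = discrete_gen K r F y t - discrete_gen K r G y t"
  by (cases K) (simp_all add: discrete_gen_def sum_subtractf[symmetric] algebra_simps flip: sum.distrib)

lemma discrete_gen_cmult: "discrete_gen K r (\<lambda>y t. c * F y t) y t = c * discrete_gen K r F y t"
  by (cases K) (simp_all add: discrete_gen_def sum_distrib_left algebra_simps)

lemma discrete_gen_time: "discrete_gen K r (\<lambda>y t. t) (y::real^'n::finite) t = (case K of Poisson \<Rightarrow> 0 | Heat \<Rightarrow> - r\<^sup>2)"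
  by (cases K) (simp_all add: discrete_gen_def)

lemma discrete_gen_shift_time: "discrete_gen K r (\<lambda>y t. F y (t + e)) y t = discrete_gen K r F y (t + e)"
  by (cases K) (simp_all add: discrete_gen_def algebra_simps)

text \<open>A strict supersolution that grows like |y|^2. The sum over the basis contributes 2n r^2
  to the generator, and the coefficients n + 1 and 2n + 1 are chosen so that the time term outweighs
  it. The summand \<open>T\<^sup>2\<close> keeps the Poisson barrier nonnegative up to time
  \<open>T\<close>.\<close>

definition barrier :: "kernel \<Rightarrow> real \<Rightarrow> real^'n::finite \<Rightarrow> real \<Rightarrow> real" where
  "barrier K T y t = (norm y)\<^sup>2 + (case K of Poisson \<Rightarrow> (real CARD('n) + 1) * (T\<^sup>2 - t\<^sup>2)
      | Heat \<Rightarrow> (2 * real CARD('n) + 1) * t)"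

lemma discrete_gen_barrier: "discrete_gen K r (barrier K T) (y::real^'n::finite) t = (case K of Poisson \<Rightarrow> - 2 * r\<^sup>2 | Heat \<Rightarrow> - r\<^sup>2)"
proof -
  have "(norm (y + r *\<^sub>R b))\<^sup>2 + (norm (y - r *\<^sub>R b))\<^sup>2 - 2 * (norm y)\<^sup>2 = 2 * r\<^sup>2" if "b \<in> Basis" for b
    using norm_shift_Basis[OF that, of y r] norm_shift_Basis[OF that, of y "- r"] by simp
  then have 1: "(\<Sum>b\<in>Basis. (norm (y + r *\<^sub>R b))\<^sup>2 + (norm (y - r *\<^sub>R b))\<^sup>2 - 2 * (norm y)\<^sup>2) = real CARD('n) * (2 * r\<^sup>2)"
    by simp
  have "(\<Sum>b\<in>Basis. barrier K T (y + r *\<^sub>R b) t + barrier K T (y - r *\<^sub>R b) t - 2 * barrier K T y t)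
    = (\<Sum>b\<in>Basis. (norm (y + r *\<^sub>R b))\<^sup>2 + (norm (y - r *\<^sub>R b))\<^sup>2 - 2 * (norm y)\<^sup>2)"
    by (simp add: barrier_def algebra_simps)
  then show ?thesis
    unfolding discrete_gen_def 1 by (cases K) (simp_all add: barrier_def algebra_simps power2_eq_square)
qed

lemma barrier_ge: "0 \<le> t \<Longrightarrow> t \<le> T \<Longrightarrow> (norm y)\<^sup>2 \<le> barrier K T y t"
  by (cases K) (simp_all add: barrier_def power_mono)

lemma discrete_gen_nonpos_at_max:
  fixes F :: "real^'n::finite \<Rightarrow> real \<Rightarrow> real"
  assumes "\<And>b. b \<in> Basis \<Longrightarrow> F (y + r *\<^sub>R b) t \<le> F y t" "\<And>b. b \<in> Basis \<Longrightarrow> F (y - r *\<^sub>R b) t \<le> F y t"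
    and "F y (t + r) \<le> F y t" "F y (t - r) \<le> F y t" "F y (t - r\<^sup>2) \<le> F y t"
  shows "discrete_gen K r F y t \<le> 0"
proof -
  have "(\<Sum>b\<in>Basis. F (y + r *\<^sub>R b) t + F (y - r *\<^sub>R b) t - 2 * F y t) \<le> 0"
  proof (rule sum_nonpos)
    fix b :: "real^'n" assume "b \<in> Basis"
    from assms(1,2)[OF this] show "F (y + r *\<^sub>R b) t + F (y - r *\<^sub>R b) t - 2 * F y t \<le> 0" by linarith
  qed
  then show ?thesis
    unfolding discrete_gen_def using assms(3-) by (cases K) simp_all
qed

definition phase :: "kernel \<Rightarrow> (real^'n::finite \<Rightarrow> real) \<Rightarrow> (real^'n \<Rightarrow> real) \<Rightarrow> real^'n \<Rightarrow> real \<Rightarrow> real" where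
  "phase K a b y t = (if Kext K b y t \<le> 0 then 0 else max (Kext K a y t) 0)"

context
  fixes K :: kernel and a b :: "real^'n::finite \<Rightarrow> real" and M :: real
  assumes am: "a \<in> borel_measurable borel" and bm: "b \<in> borel_measurable borel"
    and aM: "\<And>u. \<bar>a u\<bar> \<le> M" and bM: "\<And>u. \<bar>b u\<bar> \<le> M"
    and sep: "\<And>y t. 0 < t \<Longrightarrow> Kext K b y t = 0 \<Longrightarrow> Kext K a y t \<le> 0"
begin

lemma M_nonneg: "0 \<le> M"
  using aM[of undefined] by linarith

lemma phase_bounds: "0 < t \<Longrightarrow> 0 \<le> phase K a b y t \<and> phase K a b y t \<le> M"
  using abs_Kext_le[OF _ am aM, of t K y] M_nonneg by (auto simp: phase_def abs_le_iff)

text \<open>The two branches agree on the zero set of the extension of \<open>b\<close>: there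
  \<open>sep\<close> makes the positive part vanish.\<close>

lemma continuous_on_phase: "continuous_on {z. 0 < snd z} (\<lambda>z. phase K a b (fst z) (snd z))"
  unfolding phase_def
proof (rule continuous_on_cases_le)
  show "continuous_on {z. 0 < snd z} (\<lambda>z. Kext K b (fst z) (snd z))"
    by (rule continuous_on_Kext[OF bm bM])
  show "continuous_on {z \<in> {z. 0 < snd z}. 0 \<le> Kext K b (fst z) (snd z)} (\<lambda>z. max (Kext K a (fst z) (snd z)) 0)"
    by (intro continuous_intros continuous_on_subset[OF continuous_on_Kext[OF am aM]]) auto
qed (use sep in auto)

lemma tendsto_phase:
  assumes "Y \<longlonglongrightarrow> y" "T \<longlonglongrightarrow> t" "t > 0" "\<And>k. T k > 0"
  shows "(\<lambda>k. phase K a b (Y k) (T k)) \<longlonglongrightarrow> phase K a b y t"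
  using continuous_on_tendsto_compose[OF continuous_on_phase, of "\<lambda>k. (Y k, T k)" "(y, t)" sequentially] assms
  by (auto intro!: tendsto_Pair)

text \<open>Comparison of the phase above height \<open>e\<close> with the extension of its trace at
  height \<open>e\<close>. If it failed at one point, then after small penalties the difference
  would have a positive maximum inside a cylinder. There the phase is positive and equals the
  extension of \<open>a\<close>, so the scaled generator of the penalised difference tends to the
  strictly positive contribution of the penalties, although it is nonpositive at a maximum.\<close>

lemma phase_subsolution:
  assumes e: "0 < e" and t0: "0 < t0"
  shows "phase K a b y0 (t0 + e) \<le> Kext K (\<lambda>u. phase K a b u e) y0 t0"
proof (rule ccontr)
  assume contra: "\<not> ?thesis"
  define g where "g u = phase K a b u e" for u
  have g_cont: "continuous_on UNIV g"
    unfolding g_def continuous_on_sequentially o_def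
    by (auto intro!: tendsto_phase e)
  then have gm: "g \<in> borel_measurable borel" by (rule borel_measurable_continuous_onI)
  have g0: "0 \<le> g u" and gM': "g u \<le> M" for u using phase_bounds[OF e] by (auto simp: g_def)
  then have gM: "\<bar>g u\<bar> \<le> M" for u by simp
  \<comment> \<open>\<open>\<phi>\<close> is the extension of \<open>g\<close> for positive times
    and \<open>g\<close> itself at time 0, with continuity across; this lets the comparison run on a
    compact cylinder including its bottom.\<close>
  define \<phi> where "\<phi> y t = (LINT v|lborel. kern K 1 v * g (y - kern_radius K t *\<^sub>R v))" for y t
  have \<phi>_Kext: "\<phi> y t = Kext K g y t" if "t > 0" for y t
    unfolding \<phi>_def by (rule Kext_scaled[OF that gm, symmetric])
  have \<phi>_0: "\<phi> y 0 = g y" for y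
    using integral_kern[of 1 K "0::real^'n"] by (simp add: \<phi>_def)
  have \<phi>_nonneg: "0 \<le> \<phi> y t" for y t
    unfolding \<phi>_def by (intro integral_nonneg_AE AE_I2 mult_nonneg_nonneg g0 less_imp_le[OF kern_pos]) simp
  have \<phi>_cont: "continuous_on UNIV (\<lambda>z. \<phi> (fst z) (snd z))"
    unfolding continuous_on_sequentially o_def
  proof (intro allI ballI impI)
    fix x and z :: "(real^'n) \<times> real" assume x: "(\<forall>k. x k \<in> UNIV) \<and> x \<longlonglongrightarrow> z"
    show "(\<lambda>k. \<phi> (fst (x k)) (snd (x k))) \<longlonglongrightarrow> \<phi> (fst z) (snd z)"
      unfolding \<phi>_def by (rule Kext_scaled_tendsto[OF _ _ g_cont gM]) (use x in \<open>auto intro!: tendsto_intros tendsto_kern_radius\<close>)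
  qed
  define d where "d = phase K a b y0 (t0 + e) - Kext K g y0 t0"
  have d: "d > 0" using contra by (simp add: d_def g_def[abs_def])
  \<comment> \<open>\<open>T\<close> is chosen so that the linear penalty costs less than d/2 at
    \<open>(y0, t0)\<close>, and then \<eta>, since the barrier depends on \<open>T\<close>, so that
    the barrier costs less than the other d/2.\<close>
  define T where "T = t0 + 1 + 2 * M * t0 / d"
  have T: "T > t0" "M * t0 / T < d / 2"
  proof -
    show "T > t0" using M_nonneg d t0 by (simp add: T_def add_pos_nonneg)
    then have "T > 0" using t0 by simp
    moreover have "2 * M * t0 / d < T" using t0 by (simp add: T_def)
    ultimately show "M * t0 / T < d / 2" using d by (simp add: field_simps)
  qed
  define \<eta> where "\<eta> = d / (2 * (barrier K T y0 t0 + 1))"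
  have bar0: "0 \<le> barrier K T y0 t0" using barrier_ge[of t0 T y0 K] T t0 by (meson less_imp_le order_trans zero_le_power2)
  then have \<eta>: "\<eta> > 0" "\<eta> * barrier K T y0 t0 < d / 2" using d by (simp_all add: \<eta>_def field_simps)
  \<comment> \<open>Each face of the cylinder is excluded as the place of a positive maximum: at
    time 0 the phase equals \<open>\<phi>\<close>; at time \<open>T\<close> the linear term is M,
    which bounds the phase; at |y| = R the barrier term exceeds M.\<close>
  define N where "N y t = phase K a b y (t + e) - \<phi> y t - M / T * t - \<eta> * barrier K T y t" for y t
  have N0: "N y0 t0 > 0"
    using T(2) \<eta>(2) by (simp add: N_def \<phi>_Kext[OF t0] d_def)
  define R where "R = sqrt (M / \<eta>) + 1 + norm y0"
  have R: "norm y0 < R" "M < \<eta> * R\<^sup>2"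
  proof -
    show "norm y0 < R" using M_nonneg \<eta> by (simp add: R_def add_nonneg_pos)
    have "sqrt (M / \<eta>) < R" by (simp add: R_def add_pos_nonneg add.assoc)
    then have "(sqrt (M / \<eta>))\<^sup>2 < R\<^sup>2" using M_nonneg \<eta> by (intro power_strict_mono) auto
    then show "M < \<eta> * R\<^sup>2" using M_nonneg \<eta> by (simp add: field_simps)
  qed
  let ?C = "cball (0::real^'n) R \<times> {0..T}"
  have "continuous_on ?C (\<lambda>z. N (fst z) (snd z))"
  proof -
    have "continuous_on ?C (\<lambda>z. phase K a b (fst (fst z, snd z + e)) (snd (fst z, snd z + e)))"
      by (rule continuous_on_compose2[OF continuous_on_phase]) (use e in \<open>auto intro!: continuous_intros\<close>)
    moreover have "continuous_on ?C (\<lambda>z. barrier K T (fst z) (snd z))"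
      by (cases K) (auto simp: barrier_def intro!: continuous_intros)
    ultimately show ?thesis
      unfolding N_def by (intro continuous_intros continuous_on_subset[OF \<phi>_cont]) auto
  qed
  moreover have "compact ?C" by (intro compact_Times) auto
  moreover have in_C: "(y0, t0) \<in> ?C" using R T t0 by simp
  ultimately obtain z1 where z1: "z1 \<in> ?C" "\<And>z. z \<in> ?C \<Longrightarrow> N (fst z) (snd z) \<le> N (fst z1) (snd z1)"
    using continuous_attains_sup[of ?C "\<lambda>z. N (fst z) (snd z)"] by blast
  obtain y1 t1 where z1_eq: "z1 = (y1, t1)" by (cases z1)
  have max: "N y t \<le> N y1 t1" if "norm y \<le> R" "0 \<le> t" "t \<le> T" for y t
    using z1(2)[of "(y, t)"] that by (simp add: z1_eq)
  have c1: "norm y1 \<le> R" "0 \<le> t1" "t1 \<le> T" using z1(1) by (auto simp: z1_eq)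
  have N1: "N y1 t1 > 0" using max[of y0 t0] N0 in_C by simp
  have ph1: "0 \<le> phase K a b y1 (t1 + e)" "phase K a b y1 (t1 + e) \<le> M" using phase_bounds[of "t1 + e" y1] c1 e by auto
  have bar1: "\<eta> * (norm y1)\<^sup>2 \<le> \<eta> * barrier K T y1 t1" using barrier_ge[OF c1(2,3), of y1 K] \<eta> by simp
  have bar1': "0 \<le> \<eta> * barrier K T y1 t1" using bar1 \<eta> by (meson less_imp_le mult_nonneg_nonneg order_trans zero_le_power2)
  have lin: "0 \<le> M / T * t1" using M_nonneg T t0 c1 by simp
  have "t1 \<noteq> 0"
  proof
    assume "t1 = 0"
    then have "N y1 t1 = - (\<eta> * barrier K T y1 t1)" by (simp add: N_def \<phi>_0 g_def)
    then show False using N1 bar1' by linarith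
  qed
  moreover have "t1 \<noteq> T"
  proof
    assume "t1 = T"
    then have "M / T * t1 = M" using T t0 by simp
    then show False using N1 bar1' ph1 \<phi>_nonneg[of y1 t1] unfolding N_def by linarith
  qed
  moreover have "norm y1 \<noteq> R"
  proof
    assume "norm y1 = R"
    then show False using N1 bar1 ph1 \<phi>_nonneg[of y1 t1] lin R(2) unfolding N_def by simp
  qed
  ultimately have c2: "norm y1 < R" "0 < t1" "t1 < T" using c1 by auto
  have "phase K a b y1 (t1 + e) > 0" using N1 bar1' \<phi>_nonneg[of y1 t1] lin unfolding N_def by linarith
  then have b1: "Kext K b y1 (t1 + e) > 0" and ph1_eq: "phase K a b y1 (t1 + e) = Kext K a y1 (t1 + e)"
    by (auto simp: phase_def max_def split: if_splits)
  \<comment> \<open>Near the maximum the extension of \<open>b\<close> stays positive, so the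
    extension of \<open>a\<close> lies below the phase there, with equality at the maximum. Hence
    \<open>N'\<close>, which uses the extension in place of the phase, has a local maximum at the
    same point, and its generator can be computed.\<close>
  have "open {z \<in> {z::(real^'n) \<times> real. 0 < snd z}. 0 < Kext K b (fst z) (snd z)}"
  proof -
    have o: "open {z::(real^'n) \<times> real. 0 < snd z}" by (intro open_Collect_less continuous_intros)
    from continuous_open_preimage[OF continuous_on_Kext[OF bm bM, of K] o open_greaterThan[of 0]]
    show ?thesis by (simp add: vimage_def Int_def)
  qed
  moreover have "(y1, t1 + e) \<in> {z \<in> {z::(real^'n) \<times> real. 0 < snd z}. 0 < Kext K b (fst z) (snd z)}"
    using b1 c2 e by simp
  ultimately obtain \<rho>0 where \<rho>0: "\<rho>0 > 0" "ball (y1, t1 + e) \<rho>0 \<subseteq> {z \<in> {z::(real^'n) \<times> real. 0 < snd z}. 0 < Kext K b (fst z) (snd z)}"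
    by (meson open_contains_ball)
  define N' where "N' y t = Kext K a y (t + e) - Kext K g y t - M / T * t - \<eta> * barrier K T y t" for y t
  have N'_1: "N' y1 t1 = N y1 t1" by (simp add: N'_def N_def ph1_eq \<phi>_Kext c2)
  have N'_le: "N' y t \<le> N' y1 t1" if "norm y \<le> R" "0 < t" "t \<le> T" "dist (y, t) (y1, t1) < \<rho>0" for y t
  proof -
    have "(y, t + e) \<in> ball (y1, t1 + e) \<rho>0"
      using that(4) by (simp add: dist_commute dist_Pair_Pair dist_real_def)
    then have "0 < Kext K b y (t + e)" using \<rho>0(2) by auto
    then have "Kext K a y (t + e) \<le> phase K a b y (t + e)" by (simp add: phase_def)
    then have "N' y t \<le> N y t" by (simp add: N'_def N_def \<phi>_Kext that)
    also have "\<dots> \<le> N y1 t1" using that by (intro max) auto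
    finally show ?thesis by (simp add: N'_1)
  qed
  \<comment> \<open>Steps up to \<open>\<rho>\<close> keep all neighbours in the cylinder, at
    positive times, and in the ball just found. The bound by 1 makes the heat time step
    \<open>(r k)\<^sup>2\<close> no longer than \<open>r k\<close>.\<close>
  define \<rho> where "\<rho> = Min {\<rho>0 / 2, 1, t1 / 2, T - t1, R - norm y1}"
  have \<rho>: "\<rho> > 0" "\<rho> \<le> \<rho>0 / 2" "\<rho> \<le> 1" "\<rho> \<le> t1 / 2" "\<rho> \<le> T - t1" "\<rho> \<le> R - norm y1"
    by (use \<rho>0(1) c2 in \<open>simp add: \<rho>_def\<close>) (unfold \<rho>_def, (rule Min_le; simp)+)
  define r where "r k = \<rho> * inverse (real (Suc k))" for k
  have r0: "r k > 0" for k using \<rho> by (simp add: r_def)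
  have r\<rho>: "r k \<le> \<rho>" for k using \<rho> by (simp add: r_def field_simps)
  have r_lim: "r \<longlonglongrightarrow> 0" unfolding r_def[abs_def] using tendsto_mult_right_zero[OF LIMSEQ_inverse_real_of_nat] by simp
  have r2: "(r k)\<^sup>2 \<le> r k" for k
    using r0[of k] r\<rho>[of k] \<rho>(3) by (simp add: power2_eq_square mult_left_le)
  have r_t: "r k \<le> t1 / 2" for k using r\<rho>[of k] \<rho> by linarith
  have r2_t: "(r k)\<^sup>2 \<le> t1 / 2" for k using r2[of k] r_t[of k] by linarith
  have nonpos: "discrete_gen K (r k) N' y1 t1 \<le> 0" for k
  proof (rule discrete_gen_nonpos_at_max)
    have rr: "r k < \<rho>0" using r\<rho>[of k] \<rho> \<rho>0(1) by linarith
    note facts = r0[of k] r\<rho>[of k] \<rho> r2[of k] r_t[of k] c2 rr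
    show "N' (y1 + r k *\<^sub>R b) t1 \<le> N' y1 t1" if "b \<in> Basis" for b
    proof (rule N'_le)
      have "norm (y1 + r k *\<^sub>R b) \<le> norm y1 + r k"
        using norm_triangle_ineq[of y1 "r k *\<^sub>R b"] that r0[of k] by simp
      then show "norm (y1 + r k *\<^sub>R b) \<le> R" using facts by linarith
      show "dist (y1 + r k *\<^sub>R b, t1) (y1, t1) < \<rho>0" using that facts by (simp add: dist_Pair_Pair dist_norm)
    qed (use facts in auto)
    show "N' (y1 - r k *\<^sub>R b) t1 \<le> N' y1 t1" if "b \<in> Basis" for b
    proof (rule N'_le)
      have "norm (y1 - r k *\<^sub>R b) \<le> norm y1 + r k"
        using norm_triangle_ineq4[of y1 "r k *\<^sub>R b"] that r0[of k] by simp
      then show "norm (y1 - r k *\<^sub>R b) \<le> R" using facts by linarith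
      show "dist (y1 - r k *\<^sub>R b, t1) (y1, t1) < \<rho>0" using that facts by (simp add: dist_Pair_Pair dist_norm)
    qed (use facts in auto)
    have time: "N' y1 (t1 + x) \<le> N' y1 t1" if "\<bar>x\<bar> \<le> r k" for x
    proof (rule N'_le)
      show "dist (y1, t1 + x) (y1, t1) < \<rho>0" using that rr by (simp add: dist_Pair_Pair dist_real_def)
    qed (use that facts in \<open>auto simp: abs_le_iff\<close>)
    show "N' y1 (t1 + r k) \<le> N' y1 t1" "N' y1 (t1 - r k) \<le> N' y1 t1" "N' y1 (t1 - (r k)\<^sup>2) \<le> N' y1 t1"
      using time[of "r k"] time[of "- r k"] time[of "- (r k)\<^sup>2"] r0[of k] r2[of k] by auto
  qed
  have discrete_gen_N': "discrete_gen K (r k) N' y1 t1 / (r k)\<^sup>2 = discrete_gen K (r k) (Kext K a) y1 (t1 + e) / (r k)\<^sup>2 - discrete_gen K (r k) (Kext K g) y1 t1 / (r k)\<^sup>2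
      + (case K of Poisson \<Rightarrow> \<eta> * 2 | Heat \<Rightarrow> M / T + \<eta>)" for k
  proof -
    have "discrete_gen K (r k) N' y1 t1 = discrete_gen K (r k) (Kext K a) y1 (t1 + e) - discrete_gen K (r k) (Kext K g) y1 t1
       - M / T * (case K of Poisson \<Rightarrow> 0 | Heat \<Rightarrow> - (r k)\<^sup>2) - \<eta> * (case K of Poisson \<Rightarrow> - 2 * (r k)\<^sup>2 | Heat \<Rightarrow> - (r k)\<^sup>2)"
      unfolding N'_def[abs_def] discrete_gen_diff discrete_gen_cmult discrete_gen_shift_time discrete_gen_time discrete_gen_barrier ..
    then show ?thesis
      using r0[of k] by (cases K) (simp_all add: add_divide_distrib diff_divide_distrib)
  qed
  have "(\<lambda>k. discrete_gen K (r k) N' y1 t1 / (r k)\<^sup>2) \<longlonglongrightarrow> 0 - 0 + (case K of Poisson \<Rightarrow> \<eta> * 2 | Heat \<Rightarrow> M / T + \<eta>)"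
    unfolding discrete_gen_N'
  proof (intro tendsto_intros discrete_gen_Kext_tendsto[OF _ _ _ _ _ am aM] discrete_gen_Kext_tendsto[OF _ _ _ _ _ gm gM] r0 r_lim r_t r2_t)
    show "r k \<le> (t1 + e) / 2" "(r k)\<^sup>2 \<le> (t1 + e) / 2" for k using r_t[of k] r2_t[of k] e by auto
  qed (use c2 e in auto)
  moreover have "discrete_gen K (r k) N' y1 t1 / (r k)\<^sup>2 \<le> 0" for k using nonpos[of k] by (simp add: divide_nonpos_nonneg)
  ultimately have "0 - 0 + (case K of Poisson \<Rightarrow> \<eta> * 2 | Heat \<Rightarrow> M / T + \<eta>) \<le> 0"
    by (intro LIMSEQ_le_const2) auto
  moreover have "0 < (case K of Poisson \<Rightarrow> \<eta> * 2 | Heat \<Rightarrow> M / T + \<eta>)"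
    using \<eta> M_nonneg T t0 by (cases K) (auto intro!: add_nonneg_pos)
  ultimately show False by linarith
qed

end

text \<open>Along the times \<open>\<epsilon> k\<close> the trace of the phase tends to 0 almost
  everywhere: where \<open>a\<close> is positive, \<open>b\<close> is negative and the cutoff is
  eventually active; elsewhere the positive part itself vanishes in the limit. Then
  \<open>phase_subsolution\<close> bounds the phase at \<open>(y, t)\<close> by a limit equal to 0.
  As the extension of \<open>a\<close> is positive there, that of \<open>b\<close> is at most 0, and
  \<open>sep\<close> excludes equality.\<close>

theorem two_phase_maximum_principle:
  fixes a b :: "real^'n::finite \<Rightarrow> real"
  assumes am: "a \<in> borel_measurable borel" and bm: "b \<in> borel_measurable borel"
    and aM: "\<And>u. \<bar>a u\<bar> \<le> M" and bM: "\<And>u. \<bar>b u\<bar> \<le> M"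
    and sep: "\<And>y t. 0 < t \<Longrightarrow> Kext K b y t = 0 \<Longrightarrow> Kext K a y t \<le> 0"
    and bd: "AE u in lborel. 0 < a u \<longrightarrow> b u < 0"
    and t: "0 < t" and pos: "0 < Kext K a y t"
  shows "Kext K b y t < 0"
proof -
  let ?S = "phase K a b"
  note ctx = am bm aM bM sep
  obtain \<epsilon> where \<epsilon>: "\<And>k::nat. \<epsilon> k > 0" "\<epsilon> \<longlonglongrightarrow> 0"
    "AE u in lborel. (\<lambda>k. Kext K a u (\<epsilon> k)) \<longlonglongrightarrow> a u" "AE u in lborel. (\<lambda>k. Kext K b u (\<epsilon> k)) \<longlonglongrightarrow> b u"
    using Kext_AE_tendsto_subseq[OF am bm aM bM] by blast
  have S_bounds: "0 \<le> ?S u (\<epsilon> k) \<and> ?S u (\<epsilon> k) \<le> M" for u k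
    by (rule phase_bounds[OF ctx \<epsilon>(1)])
  have "AE u in lborel. (\<lambda>k. ?S u (\<epsilon> k)) \<longlonglongrightarrow> 0"
    using \<epsilon>(3,4) bd
  proof eventually_elim
    case (elim u)
    show ?case
    proof (cases "a u > 0")
      case True
      then have "b u < 0" using elim by simp
      with elim(2) have "\<forall>\<^sub>F k in sequentially. Kext K b u (\<epsilon> k) < 0" by (rule order_tendstoD)
      then have "\<forall>\<^sub>F k in sequentially. ?S u (\<epsilon> k) = 0"
        by eventually_elim (simp add: phase_def)
      then show ?thesis by (rule tendsto_eventually)
    next
      case False
      have "(\<lambda>k. max (Kext K a u (\<epsilon> k)) 0) \<longlonglongrightarrow> max (a u) 0" by (intro tendsto_intros elim)
      then have lim: "(\<lambda>k. max (Kext K a u (\<epsilon> k)) 0) \<longlonglongrightarrow> 0" using False by (simp add: max_def)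
      show ?thesis
        by (rule tendsto_sandwich[OF _ _ tendsto_const lim]) (auto simp: S_bounds phase_def)
    qed
  qed
  then have AE0: "AE u in lborel. (\<lambda>k. kern K t (y - u) * ?S u (\<epsilon> k)) \<longlonglongrightarrow> kern K t (y - u) * 0"
    by eventually_elim (intro tendsto_intros)
  have [measurable]: "(\<lambda>u. ?S u (\<epsilon> k)) \<in> borel_measurable borel" for k
    by (rule borel_measurable_continuous_onI)
       (auto simp: continuous_on_sequentially o_def intro!: tendsto_phase[OF ctx] \<epsilon>(1))
  have "(\<lambda>k. LINT u|lborel. kern K t (y - u) * ?S u (\<epsilon> k)) \<longlonglongrightarrow> (LINT u|lborel. kern K t (y - u) * 0)"
  proof (rule integral_dominated_convergence[OF _ _ _ AE0])
    show "integrable lborel (\<lambda>u. kern K t (y - u) * M)" by (intro integrable_mult_left integrable_kern t)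
    show "AE u in lborel. norm (kern K t (y - u) * ?S u (\<epsilon> k)) \<le> kern K t (y - u) * M" for k
      using S_bounds by (intro AE_I2) (simp add: abs_mult abs_of_pos[OF kern_pos[OF t]] mult_left_mono less_imp_le[OF kern_pos[OF t]])
  qed simp_all
  then have lim0: "(\<lambda>k. Kext K (\<lambda>u. ?S u (\<epsilon> k)) y t) \<longlonglongrightarrow> 0"
    by (simp only: mult_zero_right Bochner_Integration.integral_zero Kext_def)
  have "(\<lambda>k. ?S y (t + \<epsilon> k)) \<longlonglongrightarrow> ?S y t"
    by (rule tendsto_phase[OF ctx]) (use t \<epsilon> in \<open>auto intro!: tendsto_eq_intros add_pos_pos\<close>)
  then have "?S y t \<le> 0"
    by (rule LIMSEQ_le[OF _ lim0]) (intro exI allI impI phase_subsolution[OF ctx \<epsilon>(1) t])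
  then show ?thesis
    using pos sep[OF t, of y] by (auto simp: phase_def not_le intro: ccontr split: if_splits)
qed

section \<open>Tangents to the upper boundary\<close>

text \<open>The value of the tangent form of scale \<open>s\<close> on the lower boundary, as a
  function of the ratio of the curve parameter to \<open>s\<close>. Its minimum is at 1, with value
  0 for infinite p and value p otherwise.\<close>

definition tangent_gauge :: "ereal \<Rightarrow> real \<Rightarrow> real" where
  "tangent_gauge p \<tau> = (if p = \<infinity> then \<tau> - 1 - ln \<tau>
     else \<tau> + (real_of_ereal p - 1) * \<tau> powr (-1 / (real_of_ereal p - 1)))"

text \<open>
  The tangents to \<open>x1 * x2 powr (p - 1) = \<delta>\<close> (weighted arithmetic-geometric mean inequality) and to
  \<open>x1 * exp (- x2) = \<delta>\<close> (tangents of the logarithm) are the lines \<open>tangent_form p s x1 x2 = crit p \<delta>\<close>. The sign of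
  \<open>tangent_side p s\<close> tells on which side of the point of tangency \<open>x\<close> lies; it is the sign of the
  derivative of the form in \<open>s\<close>.
\<close>

definition tangent_form :: "ereal \<Rightarrow> real \<Rightarrow> real \<Rightarrow> real \<Rightarrow> real" where
  "tangent_form p s x1 x2 = (if p = \<infinity> then x1 / s - 1 + ln s - x2
     else x1 / s + (real_of_ereal p - 1) * s powr (1 / (real_of_ereal p - 1)) * x2)"

definition tangent_side :: "ereal \<Rightarrow> real \<Rightarrow> real \<Rightarrow> real \<Rightarrow> real" where
  "tangent_side p s x1 x2 = (if p = \<infinity> then s - x1 else s powr (1 + 1 / (real_of_ereal p - 1)) * x2 - x1)"

text \<open>The minimum over \<open>s\<close> of \<open>tangent_form p s\<close> at a point is
  \<open>ln\<close> of its \<open>Apval\<close>, or p times the p-th root of its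
  \<open>Apval\<close>. This is that minimum on the upper boundary.\<close>

definition crit :: "ereal \<Rightarrow> real \<Rightarrow> real" where
  "crit p \<delta> = (if p = \<infinity> then ln \<delta> else real_of_ereal p * \<delta> powr (1 / real_of_ereal p))"

definition Apval :: "ereal \<Rightarrow> real \<Rightarrow> real \<Rightarrow> real" where
  "Apval p x1 x2 = (if p = \<infinity> then x1 * exp (- x2) else x1 * x2 powr (real_of_ereal p - 1))"

definition adm :: "ereal \<Rightarrow> real \<Rightarrow> real \<Rightarrow> bool" where
  "adm p x1 x2 \<longleftrightarrow> 0 < x1 \<and> (p \<noteq> \<infinity> \<longrightarrow> 0 < x2)"

lemma ereal_gt_1_cases:
  assumes "1 < (p::ereal)"
  obtains "p = \<infinity>" | P where "p = ereal P" "1 < P"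
  using assms by (cases p) (auto simp: one_ereal_def)

lemma tangent_form_dual:
  assumes "0 < \<tau>" "0 < s"
  shows "tangent_form p s \<tau> (dual_fn p \<tau>) = tangent_gauge p (\<tau> / s)"
  using assms by (auto simp: tangent_form_def dual_fn_def tangent_gauge_def ln_div powr_divide powr_minus field_simps)

lemma tangent_gauge_deriv:
  assumes "1 < p" "0 < \<tau>"
  shows "(tangent_gauge p has_real_derivative
     1 - (if p = \<infinity> then 1 / \<tau> else \<tau> powr (- 1 / (real_of_ereal p - 1) - 1))) (at \<tau>)"
  using assms(1)
proof (cases rule: ereal_gt_1_cases)
  case 1
  then show ?thesis unfolding tangent_gauge_def[abs_def] using assms(2)
    by (auto intro!: derivative_eq_intros simp: divide_inverse)
next
  case (2 P)
  have "((\<lambda>\<tau>. \<tau> powr (- 1 / (P - 1))) has_real_derivative (- 1 / (P - 1)) * \<tau> powr (- 1 / (P - 1) - 1)) (at \<tau>)"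
    by (rule has_real_derivative_powr[OF assms(2)])
  then have "((\<lambda>\<tau>. \<tau> + (P - 1) * \<tau> powr (- 1 / (P - 1))) has_real_derivative 1 + (P - 1) * ((- 1 / (P - 1)) * \<tau> powr (- 1 / (P - 1) - 1))) (at \<tau>)"
    by (intro DERIV_add DERIV_cmult DERIV_ident)
  moreover have "1 + (P - 1) * ((- 1 / (P - 1)) * \<tau> powr (- 1 / (P - 1) - 1)) = 1 - \<tau> powr (- 1 / (P - 1) - 1)"
    using 2 by simp
  ultimately show ?thesis
    unfolding tangent_gauge_def[abs_def] using 2 by simp
qed

lemma tangent_gauge_mono:
  assumes "1 < p" "1 \<le> x" "x \<le> y"
  shows "tangent_gauge p x \<le> tangent_gauge p y"
proof (rule DERIV_nonneg_imp_nondecreasing[OF assms(3)])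
  fix \<tau> assume "x \<le> \<tau>" "\<tau> \<le> y"
  then have \<tau>: "1 \<le> \<tau>" using assms by simp
  have pw: "\<tau> powr (- 1 / (P - 1) - 1) \<le> 1" if "1 < P" for P
  proof -
    have "0 \<le> 1 / (P - 1)" using that by (intro divide_nonneg_nonneg) linarith+
    then have "- 1 \<le> 1 / (P - 1)" by linarith
    then show ?thesis using powr_mono[of "- 1 / (P - 1) - 1" 0 \<tau>] \<tau> by simp
  qed
  have "0 \<le> 1 - (if p = \<infinity> then 1 / \<tau> else \<tau> powr (- 1 / (real_of_ereal p - 1) - 1))"
    using assms(1) by (rule ereal_gt_1_cases) (use \<tau> pw in auto)
  then show "\<exists>D. (tangent_gauge p has_real_derivative D) (at \<tau>) \<and> 0 \<le> D"
    using tangent_gauge_deriv[OF assms(1), of \<tau>] \<tau> by auto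
qed

lemma tangent_gauge_antimono:
  assumes "1 < p" "0 < x" "x \<le> y" "y \<le> 1"
  shows "tangent_gauge p y \<le> tangent_gauge p x"
proof (rule DERIV_nonpos_imp_nonincreasing[OF assms(3)])
  fix \<tau> assume "x \<le> \<tau>" "\<tau> \<le> y"
  then have \<tau>: "0 < \<tau>" "\<tau> \<le> 1" using assms by auto
  have pw: "1 \<le> \<tau> powr (- 1 / (P - 1) - 1)" if "1 < P" for P
  proof -
    have "0 \<le> 1 / (P - 1)" using that by (intro divide_nonneg_nonneg) linarith+
    then have "- 1 \<le> 1 / (P - 1)" by linarith
    then show ?thesis using powr_mono'[of "- 1 / (P - 1) - 1" 0 \<tau>] \<tau> by simp
  qed
  have "1 - (if p = \<infinity> then 1 / \<tau> else \<tau> powr (- 1 / (real_of_ereal p - 1) - 1)) \<le> 0"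
    using assms(1) by (rule ereal_gt_1_cases) (use \<tau> pw in auto)
  then show "\<exists>D. (tangent_gauge p has_real_derivative D) (at \<tau>) \<and> D \<le> 0"
    using tangent_gauge_deriv[OF assms(1), of \<tau>] \<tau> by auto
qed

lemma tangent_gauge_min:
  assumes "1 < p" "0 < x"
  shows "tangent_gauge p 1 \<le> tangent_gauge p x"
  using tangent_gauge_mono[OF assms(1), of 1 x] tangent_gauge_antimono[OF assms(1,2), of 1] by (cases "x \<le> 1") auto

lemma isCont_tangent_gauge: "1 < p \<Longrightarrow> 0 < \<tau> \<Longrightarrow> isCont (tangent_gauge p) \<tau>"
  using tangent_gauge_deriv by (blast intro: DERIV_isCont)

lemma tangent_gauge_1_less_crit: "1 < p \<Longrightarrow> 1 < \<delta> \<Longrightarrow> tangent_gauge p 1 < crit p \<delta>"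
  by (erule ereal_gt_1_cases) (auto simp: tangent_gauge_def crit_def gr_one_powr)

text \<open>The line of scale \<open>s\<close> at level \<kappa> meets the lower boundary at the
  parameters s \<tau>m and s \<tau>p. Conversely, dividing a parameter by a root gives the scale of
  a line through its point.\<close>

lemma tangent_gauge_roots:
  assumes p: "1 < p" and \<kappa>: "tangent_gauge p 1 < \<kappa>"
  obtains \<tau>m \<tau>p where "0 < \<tau>m" "\<tau>m < 1" "1 < \<tau>p" "tangent_gauge p \<tau>m = \<kappa>" "tangent_gauge p \<tau>p = \<kappa>"
proof -
  have "(\<exists>x. 0 < x \<and> x \<le> 1 \<and> \<kappa> \<le> tangent_gauge p x) \<and> (\<exists>y\<ge>1. \<kappa> \<le> tangent_gauge p y)"
    using p
  proof (cases rule: ereal_gt_1_cases)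
    case 1
    then have k: "\<kappa> > 0" using \<kappa> by (simp add: tangent_gauge_def)
    \<comment> \<open>At this argument minus the logarithm is \<kappa> + 1, which also pays for the
      summand -1. For the large argument below, ln (1 + x) \<le> x with x = sqrt \<kappa>
      suffices.\<close>
    have "\<kappa> \<le> tangent_gauge p (exp (- \<kappa> - 1))" using 1 by (simp add: tangent_gauge_def)
    moreover have "\<kappa> \<le> tangent_gauge p ((1 + sqrt \<kappa>)\<^sup>2)"
    proof -
      have "ln ((1 + sqrt \<kappa>)\<^sup>2) = 2 * ln (1 + sqrt \<kappa>)"
        using k by (simp add: ln_realpow add_pos_nonneg)
      also have "\<dots> \<le> 2 * sqrt \<kappa>" using ln_add_one_self_le_self[of "sqrt \<kappa>"] k by simp
      finally show ?thesis using 1 k by (simp add: tangent_gauge_def power2_eq_square algebra_simps)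
    qed
    moreover have "1 \<le> (1 + sqrt \<kappa>)\<^sup>2" using k by (intro one_le_power) simp
    moreover have "exp (- \<kappa> - 1) \<le> 1" using k by simp
    ultimately show ?thesis using exp_gt_zero by blast
  next
    case (2 P)
    then have k: "\<kappa> > P" using \<kappa> by (simp add: tangent_gauge_def)
    \<comment> \<open>The point at which the power term alone equals \<kappa>; on the other side of
      1 the linear term alone reaches \<kappa> at \<kappa> itself.\<close>
    define x where "x = (\<kappa> / (P - 1)) powr (- (P - 1))"
    have "x powr (- 1 / (P - 1)) = \<kappa> / (P - 1)" 
    proof -
      have "- (P - 1) * (- 1 / (P - 1)) = 1" using 2 by (simp add: field_simps)
      then show ?thesis unfolding x_def powr_powr using 2 k by (simp only: powr_one) simp
    qed
    moreover have "0 < x" using 2 k by (simp add: x_def)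
    ultimately have "\<kappa> \<le> tangent_gauge p x" using 2 k by (simp add: tangent_gauge_def)
    moreover have "x \<le> 1"
    proof -
      have "1 \<le> \<kappa> / (P - 1)" using 2 k by (simp add: field_simps)
      then show ?thesis using powr_mono[of "- (P - 1)" 0 "\<kappa> / (P - 1)"] 2 by (simp add: x_def)
    qed
    moreover have "\<kappa> \<le> tangent_gauge p \<kappa>" "1 \<le> \<kappa>" using 2 k by (auto simp: tangent_gauge_def)
    ultimately show ?thesis using \<open>0 < x\<close> by blast
  qed
  then obtain x y where x: "0 < x" "x \<le> 1" "\<kappa> \<le> tangent_gauge p x" and y: "1 \<le> y" "\<kappa> \<le> tangent_gauge p y" by blast
  have "\<exists>\<tau>\<ge>x. \<tau> \<le> 1 \<and> tangent_gauge p \<tau> = \<kappa>"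
    by (rule IVT2) (use x \<kappa> in \<open>auto intro!: isCont_tangent_gauge p\<close>)
  moreover have "\<exists>\<tau>\<ge>1. \<tau> \<le> y \<and> tangent_gauge p \<tau> = \<kappa>"
    by (rule IVT) (use y \<kappa> in \<open>auto intro!: isCont_tangent_gauge p\<close>)
  ultimately obtain \<tau>m \<tau>p where "x \<le> \<tau>m" "\<tau>m \<le> 1" "tangent_gauge p \<tau>m = \<kappa>" "1 \<le> \<tau>p" "tangent_gauge p \<tau>p = \<kappa>" by blast
  moreover have "\<tau>m \<noteq> 1" "\<tau>p \<noteq> 1" using \<kappa> calculation by auto
  ultimately show thesis using that[of \<tau>m \<tau>p] x by auto
qed

lemma powr_le_powr_iff: "0 < q \<Longrightarrow> 0 \<le> x \<Longrightarrow> 0 \<le> y \<Longrightarrow> x powr q \<le> y powr q \<longleftrightarrow> x \<le> y" for x y q :: real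
  by (meson less_imp_le not_le powr_less_mono2 powr_mono2)

text \<open>\<open>s0\<close> minimises the tangent form over the scale: \<open>tangent_side\<close>
  has the sign of the derivative in \<open>s\<close> and changes it once, at x1 for infinite p and
  at (x1/x2)^((p-1)/p) otherwise.\<close>

lemma adm_optimal:
  assumes p: "1 < p" and x: "adm p x1 x2"
  obtains s0 where "0 < s0" "\<And>s. 0 < s \<Longrightarrow> tangent_side p s x1 x2 \<le> 0 \<longleftrightarrow> s \<le> s0" "\<And>s. 0 < s \<Longrightarrow> 0 \<le> tangent_side p s x1 x2 \<longleftrightarrow> s0 \<le> s"
  using p
proof (cases rule: ereal_gt_1_cases)
  case 1
  then show thesis using x that[of x1] by (auto simp: tangent_side_def adm_def)
next
  case (2 P)
  define q where "q = 1 + 1 / (P - 1)"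
  have q: "q > 0" using 2 by (simp add: q_def add_pos_pos)
  define s0 where "s0 = (x1 / x2) powr (1 / q)"
  have x': "x1 > 0" "x2 > 0" using x 2 by (auto simp: adm_def)
  have s0: "s0 > 0" "s0 powr q = x1 / x2" using x' q by (auto simp: s0_def powr_powr)
  have "tangent_side p s x1 x2 \<le> 0 \<longleftrightarrow> s powr q \<le> s0 powr q" "0 \<le> tangent_side p s x1 x2 \<longleftrightarrow> s0 powr q \<le> s powr q" for s
    unfolding s0(2) using x' 2 by (simp_all add: tangent_side_def q_def field_simps)
  then show thesis
    using that[of s0] s0(1) q by (simp add: powr_le_powr_iff)
qed

text \<open>A zero \<open>s0\<close> of \<open>tangent_side\<close> says that the point is
  \<open>x1 / s0\<close> times the point of the lower boundary with parameter \<open>s0\<close>. The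
  form is homogeneous of degree 1 and \<open>Apval\<close> of degree P, with value 1 on the lower
  boundary.\<close>

lemma tangent_form_optimal:
  assumes p: "p = ereal P" "1 < P" and x: "adm p x1 x2" and s0: "0 < s0" "tangent_side p s0 x1 x2 = 0" and s: "0 < s"
  shows "tangent_form p s x1 x2 = x1 / s0 * tangent_gauge p (s0 / s)" "Apval p x1 x2 = (x1 / s0) powr P"
proof -
  define q where "q = 1 / (P - 1)"
  have x': "x1 > 0" "x2 > 0" using x p by (auto simp: adm_def)
  have x2: "x2 = x1 * s0 powr (- 1 - q)"
  proof -
    have "s0 powr (1 + q) * x2 = x1" using s0 p by (simp add: tangent_side_def q_def)
    then have "x2 = x1 / s0 powr (1 + q)" using s0 by (simp add: field_simps)
    also have "\<dots> = x1 * s0 powr (- (1 + q))" unfolding powr_minus by (simp add: divide_inverse)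
    finally show ?thesis by simp
  qed
  have "tangent_gauge p (s0 / s) = s0 / s + (P - 1) * (s0 powr (- q) * s powr q)"
    using p s s0 by (simp add: tangent_gauge_def q_def powr_divide powr_minus field_simps)
  moreover have "s0 powr (- 1 - q) = s0 powr (- q) / s0"
    using s0 powr_diff[of s0 "- q" 1] by (simp add: minus_diff_commute)
  moreover have "tangent_form p s x1 x2 = x1 / s + (P - 1) * s powr q * (x1 * s0 powr (- 1 - q))"
    using p by (simp add: tangent_form_def q_def x2)
  ultimately show "tangent_form p s x1 x2 = x1 / s0 * tangent_gauge p (s0 / s)"
    using s s0(1) by (simp only:) (simp add: field_simps)
  have "x2 powr (P - 1) = x1 powr (P - 1) * s0 powr ((- 1 - q) * (P - 1))"
    using x' s0 by (simp add: x2 powr_mult powr_powr)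
  also have "(- 1 - q) * (P - 1) = - P" using p by (simp add: q_def field_simps)
  finally have "Apval p x1 x2 = (x1 * x1 powr (P - 1)) * s0 powr (- P)"
    using p by (simp add: Apval_def)
  also have "x1 * x1 powr (P - 1) = x1 powr P" using x' by (simp add: powr_mult_base)
  finally show "Apval p x1 x2 = (x1 / s0) powr P"
    using x' s0 by (simp add: powr_divide powr_minus_divide)
qed

lemma powr_le_iff_root:
  fixes y \<delta> P :: real
  assumes "0 \<le> y" "0 \<le> \<delta>" "0 < P"
  shows "y powr P \<le> \<delta> \<longleftrightarrow> y \<le> \<delta> powr (1 / P)"
proof -
  have "y powr P \<le> (\<delta> powr (1 / P)) powr P \<longleftrightarrow> y \<le> \<delta> powr (1 / P)"
    using assms by (intro powr_le_powr_iff) auto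
  then show ?thesis using assms by (simp add: powr_powr)
qed

text \<open>The equality case of the inequality between the means: at the optimal scale nothing is
  lost, so the nonlinear condition becomes a linear one.\<close>

lemma tangent_form_le_crit_of_tangent_side_zero:
  assumes p: "1 < p" and x: "adm p x1 x2" and v: "Apval p x1 x2 \<le> \<delta>" and s: "0 < s" "tangent_side p s x1 x2 = 0" and \<delta>: "1 < \<delta>"
  shows "tangent_form p s x1 x2 \<le> crit p \<delta>"
  using p
proof (cases rule: ereal_gt_1_cases)
  case 1
  then have "s = x1" "x1 > 0" using s x by (auto simp: tangent_side_def adm_def)
  moreover have "ln (x1 * exp (- x2)) \<le> ln \<delta>"
    using v 1 \<open>x1 > 0\<close> \<delta> by (subst ln_le_cancel_iff) (auto simp: Apval_def)
  ultimately show ?thesis using 1 by (simp add: tangent_form_def crit_def ln_mult)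
next
  case (2 P)
  have pos: "0 < x1" using x by (simp add: adm_def)
  note opt = tangent_form_optimal[OF 2 x s s(1)]
  have "x1 / s \<le> \<delta> powr (1 / P)"
    using v \<delta> 2 pos s unfolding opt(2) by (subst powr_le_iff_root[symmetric]) auto
  moreover have "tangent_form p s x1 x2 = P * (x1 / s)" unfolding opt(1) using 2 s by (simp add: tangent_gauge_def)
  ultimately show ?thesis using 2 by (simp add: crit_def del: times_divide_eq_right)
qed

text \<open>The converse, for which any scale will do: the form is at least its minimum over the
  scales, and that minimum determines \<open>Apval\<close>.\<close>

lemma Apval_le_of_tangent_form_le:
  assumes p: "1 < p" and x: "adm p x1 x2" and s: "0 < s" and N: "tangent_form p s x1 x2 \<le> crit p \<delta>" and \<delta>: "1 < \<delta>"
  shows "Apval p x1 x2 \<le> \<delta>"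
  using p
proof (cases rule: ereal_gt_1_cases)
  case 1
  have pos: "0 < x1" using x by (simp add: adm_def)
  have "ln (x1 / s) \<le> x1 / s - 1" using pos s by (intro ln_le_minus_one) simp
  then have "ln x1 - x2 \<le> ln \<delta>" using N 1 pos s by (simp add: tangent_form_def crit_def ln_div)
  then have "ln (x1 * exp (- x2)) \<le> ln \<delta>" using pos by (simp add: ln_mult)
  then show ?thesis using pos \<delta> 1 by (subst (asm) ln_le_cancel_iff) (auto simp: Apval_def)
next
  case (2 P)
  have pos: "0 < x1" using x by (simp add: adm_def)
  obtain s0 where s0: "0 < s0" "tangent_side p s0 x1 x2 = 0"
    using adm_optimal[OF p x] by (metis order_refl order_antisym)
  note opt = tangent_form_optimal[OF 2 x s0 s]
  have "P \<le> tangent_gauge p (s0 / s)" using tangent_gauge_min[OF p, of "s0 / s"] s s0 2 by (simp add: tangent_gauge_def)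
  then have "x1 / s0 * P \<le> x1 / s0 * tangent_gauge p (s0 / s)" using pos s0 by (intro mult_left_mono) auto
  also have "\<dots> \<le> P * \<delta> powr (1 / P)" using N 2 unfolding opt(1) by (simp add: crit_def)
  finally have "P * (x1 / s0) \<le> P * \<delta> powr (1 / P)" by (simp only: mult.commute)
  moreover have "0 < P" using 2 by simp
  ultimately have "x1 / s0 \<le> \<delta> powr (1 / P)" by (simp only: mult_le_cancel_left_pos)
  then show ?thesis
    unfolding opt(2) using pos s0 \<delta> 2 by (subst powr_le_iff_root) auto
qed

definition clip :: "real \<Rightarrow> real \<Rightarrow> real \<Rightarrow> real" where
  "clip \<alpha> \<beta> \<tau> = max \<alpha> (min \<beta> \<tau>)"

text \<open>Clipping numerator and denominator to the same interval moves their ratio towards 1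
  without crossing it, and the gauge decreases towards 1 from both sides.\<close>

lemma tangent_gauge_clip_le:
  assumes p: "1 < p" and "0 < \<alpha>" "\<alpha> \<le> \<beta>" "0 < \<tau>" "0 < s"
  shows "tangent_gauge p (clip \<alpha> \<beta> \<tau> / clip \<alpha> \<beta> s) \<le> tangent_gauge p (\<tau> / s)"
proof -
  let ?t = "clip \<alpha> \<beta> \<tau>" and ?s = "clip \<alpha> \<beta> s"
  have pos: "0 < ?t" "0 < ?s" using assms by (auto simp: clip_def)
  consider "?t = ?s" | "?s < ?t" | "?t < ?s" by linarith
  then show ?thesis
  proof cases
    case 1
    then show ?thesis using pos tangent_gauge_min[OF p, of "\<tau> / s"] assms by simp
  next
    case 2
    then have "?t \<le> \<tau>" "s \<le> ?s" by (auto simp: clip_def)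
    then have "?t / ?s \<le> \<tau> / s" using pos assms by (intro frac_le) auto
    then show ?thesis using 2 pos by (intro tangent_gauge_mono p) auto
  next
    case 3
    then have "\<tau> \<le> ?t" "?s \<le> s" by (auto simp: clip_def)
    then have "\<tau> / s \<le> ?t / ?s" using pos assms by (intro frac_le) auto
    then show ?thesis using 3 pos assms by (intro tangent_gauge_antimono p) auto
  qed
qed

section \<open>Rearrangement\<close>

text \<open>Hiding the coefficients behind existential quantifiers lets \<open>Kext_affine\<close>
  and \<open>avg_affine\<close> treat finite and infinite p alike.\<close>

lemma tangent_form_affine: "\<exists>A B C. \<forall>x1 x2. tangent_form p s x1 x2 = A * x1 + B * x2 + C"
proof (cases "p = \<infinity>")
  case True
  then show ?thesis
    by (intro exI[of _ "1 / s"] exI[of _ "- 1"] exI[of _ "ln s - 1"]) (simp add: tangent_form_def)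
next
  case False
  then show ?thesis
    by (intro exI[of _ "1 / s"] exI[of _ "(real_of_ereal p - 1) * s powr (1 / (real_of_ereal p - 1))"] exI[of _ 0])
       (simp add: tangent_form_def)
qed

lemma tangent_side_affine: "\<exists>A B C. \<forall>x1 x2. tangent_side p s x1 x2 = A * x1 + B * x2 + C"
proof (cases "p = \<infinity>")
  case True
  then show ?thesis by (intro exI[of _ "- 1"] exI[of _ 0] exI[of _ s]) (simp add: tangent_side_def)
next
  case False
  then show ?thesis
    by (intro exI[of _ "- 1"] exI[of _ "s powr (1 + 1 / (real_of_ereal p - 1))"] exI[of _ 0]) (simp add: tangent_side_def)
qed

lemma Kext_affine:
  fixes y :: "real^'n::finite"
  assumes t: "0 < t" and F: "Kint K F1 y t" "Kint K F2 y t"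
    and f: "\<exists>A B C. \<forall>x1 x2. f x1 x2 = A * x1 + B * x2 + (C::real)"
  shows "Kint K (\<lambda>u. f (F1 u) (F2 u)) y t" "Kext K (\<lambda>u. f (F1 u) (F2 u)) y t = f (Kext K F1 y t) (Kext K F2 y t)"
proof -
  obtain A B C where f: "\<And>x1 x2. f x1 x2 = A * x1 + B * x2 + C" using f by blast
  have eq: "kern K t (y - u) * f (F1 u) (F2 u) = A * (kern K t (y - u) * F1 u) + B * (kern K t (y - u) * F2 u) + C * kern K t (y - u)" for u
    by (simp add: f algebra_simps)
  note int = F[unfolded Kint_def] integrable_kern[OF t, of K y]
  show "Kint K (\<lambda>u. f (F1 u) (F2 u)) y t"
    unfolding Kint_def eq using int by simp
  have "Kext K (\<lambda>u. f (F1 u) (F2 u)) y t = A * Kext K F1 y t + B * Kext K F2 y t + C"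
    unfolding Kext_def eq using int by (simp add: integral_kern[OF t])
  then show "Kext K (\<lambda>u. f (F1 u) (F2 u)) y t = f (Kext K F1 y t) (Kext K F2 y t)"
    by (simp only: f)
qed

lemma avg_affine:
  assumes "c < d" and F: "set_integrable lborel {c..d} F1" "set_integrable lborel {c..d} F2"
    and f: "\<exists>A B C. \<forall>x1 x2. f x1 x2 = A * x1 + B * x2 + (C::real)"
  shows "set_integrable lborel {c..d} (\<lambda>s. f (F1 s) (F2 s))" "avg (\<lambda>s. f (F1 s) (F2 s)) c d = f (avg F1 c d) (avg F2 c d)"
proof -
  obtain A B C where f: "\<And>x1 x2. f x1 x2 = A * x1 + B * x2 + C" using f by blast
  have int: "set_integrable lborel {c..d} (\<lambda>_. C)" by (intro borel_integrable_atLeastAtMost' continuous_on_const)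
  have i: "set_integrable lborel {c..d} (\<lambda>s. A * F1 s)" "set_integrable lborel {c..d} (\<lambda>s. B * F2 s)" using F by simp_all
  then have i2: "set_integrable lborel {c..d} (\<lambda>s. A * F1 s + B * F2 s)" by (rule set_integral_add)
  show "set_integrable lborel {c..d} (\<lambda>s. f (F1 s) (F2 s))"
    unfolding f by (rule set_integral_add[OF i2 int])
  have "(LINT s:{c..d}|lborel. f (F1 s) (F2 s)) = A * (LINT s:{c..d}|lborel. F1 s) + B * (LINT s:{c..d}|lborel. F2 s) + C * (d - c)"
  proof -
    have "(LINT s:{c..d}|lborel. f (F1 s) (F2 s)) = (LINT s:{c..d}|lborel. A * F1 s) + (LINT s:{c..d}|lborel. B * F2 s) + (LINT s:{c..d}|lborel. C)"
      unfolding f set_integral_add(2)[OF i2 int] set_integral_add(2)[OF i] ..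
    moreover have "(LINT s:{c..d}|lborel. C) = C * (d - c)"
      using assms(1) by (simp add: set_lebesgue_integral_def)
    ultimately show ?thesis by simp
  qed
  then have "avg (\<lambda>s. f (F1 s) (F2 s)) c d = (A * (LINT s:{c..d}|lborel. F1 s) + B * (LINT s:{c..d}|lborel. F2 s) + C * (d - c)) / (d - c)"
    unfolding avg_def by (simp only:)
  also have "\<dots> = A * avg F1 c d + B * avg F2 c d + C"
    using assms(1) by (simp add: avg_def add_divide_distrib)
  finally show "avg (\<lambda>s. f (F1 s) (F2 s)) c d = f (avg F1 c d) (avg F2 c d)"
    by (simp only: f)
qed

lemma integral_pos_of_AE_pos:
  fixes f :: "'a \<Rightarrow> real"
  assumes "integrable M f" "AE x in M. 0 \<le> f x" "emeasure M {x\<in>space M. 0 < f x} \<noteq> 0"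
  shows "0 < integral\<^sup>L M f"
proof -
  have "integral\<^sup>L M f \<noteq> 0"
  proof
    assume "integral\<^sup>L M f = 0"
    then have "AE x in M. f x = 0" using integral_nonneg_eq_0_iff_AE[OF assms(1,2)] by simp
    then have "AE x in M. \<not> 0 < f x" by eventually_elim simp
    then show False using assms(1,3) by (subst (asm) AE_iff_measurable[OF _ refl]) auto
  qed
  then show ?thesis using integral_nonneg_AE[OF assms(2)] by simp
qed

lemma Kext_pos:
  fixes y :: "real^'n::finite"
  assumes t: "0 < t" and F: "Kint K F y t" and pos: "AE u in lborel. 0 < F u"
  shows "0 < Kext K F y t"
  unfolding Kext_def
proof (rule integral_pos_of_AE_pos)
  have AE: "AE u in lborel. 0 < kern K t (y - u) * F u" using pos by eventually_elim (simp add: kern_pos[OF t])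
  then show "AE u in lborel. 0 \<le> kern K t (y - u) * F u" by eventually_elim simp
  have [measurable]: "(\<lambda>u. kern K t (y - u) * F u) \<in> borel_measurable lborel" using F by (auto simp: Kint_def)
  have "emeasure lborel {u \<in> space lborel. 0 < kern K t (y - u) * F u} = emeasure lborel (space (lborel :: (real^'n) measure))"
    by (rule emeasure_eq_AE) (use AE in auto)
  then show "emeasure lborel {u \<in> space lborel. 0 < kern K t (y - u) * F u} \<noteq> 0" by simp
qed (use F in \<open>simp add: Kint_def\<close>)

lemma avg_pos:
  assumes "c < d" "set_integrable lborel {c..d} F" "\<And>s. c < s \<Longrightarrow> s < d \<Longrightarrow> 0 < F s"
  shows "0 < avg F c d"
proof -
  have "0 < (LINT s|lborel. indicator {c..d} s *\<^sub>R F s)"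
  proof (rule integral_pos_of_AE_pos)
    show i: "integrable lborel (\<lambda>s. indicator {c..d} s *\<^sub>R F s)" using assms(2) by (simp add: set_integrable_def)
    then have [measurable]: "(\<lambda>s. indicator {c..d} s *\<^sub>R F s) \<in> borel_measurable lborel" by auto
    have "AE s in lborel. s \<noteq> c \<and> s \<noteq> d" using AE_lborel_singleton[of c] AE_lborel_singleton[of d] by eventually_elim auto
    then show "AE s in lborel. 0 \<le> indicator {c..d} s *\<^sub>R F s"
      by eventually_elim (auto simp: indicator_def less_imp_le[OF assms(3)])
    have "emeasure lborel {c<..<d} \<le> emeasure lborel {s \<in> space lborel. 0 < indicator {c..d} s *\<^sub>R F s}"
    proof (rule emeasure_mono)
      show "{c<..<d} \<subseteq> {s \<in> space lborel. 0 < indicator {c..d} s *\<^sub>R F s}"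
        using assms(3) by (auto simp: indicator_def)
      show "{s \<in> space lborel. 0 < indicator {c..d} s *\<^sub>R F s} \<in> sets lborel" by measurable
    qed
    then show "emeasure lborel {s \<in> space lborel. 0 < indicator {c..d} s *\<^sub>R F s} \<noteq> 0" using assms(1) by auto
  qed
  then show ?thesis using assms(1) by (simp add: avg_def set_lebesgue_integral_def)
qed

text \<open>A distribution is the image of the uniform one under its quantile function. The
  \<open>ennreal\<close> version allows an infinite extension of \<open>f\<close> composed with
  \<open>w\<close>; the real version serves the affine forms.\<close>

lemma quantile_rearrangement:
  fixes w :: "real^'n::finite \<Rightarrow> real"
  assumes t: "0 < t" and w[measurable]: "w \<in> borel_measurable borel"
  obtains v :: "real \<Rightarrow> real" where "v \<in> borel_measurable borel" "mono_on {0<..<1} v"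
    "\<And>F :: real \<Rightarrow> ennreal. F \<in> borel_measurable borel \<Longrightarrow>
       (\<integral>\<^sup>+ u. ennreal (kern K t (y - u)) * F (w u) \<partial>lborel) = (\<integral>\<^sup>+ r. F (v r) * indicator {0..1} r \<partial>lborel)"
    "\<And>F :: real \<Rightarrow> real. F \<in> borel_measurable borel \<Longrightarrow> Kint K (\<lambda>u. F (w u)) y t \<Longrightarrow>
       set_integrable lborel {0..1} (\<lambda>r. F (v r)) \<and> (LINT r:{0..1}|lborel. F (v r)) = Kext K (\<lambda>u. F (w u)) y t"
proof -
  define \<mu> where "\<mu> = density lborel (\<lambda>u. ennreal (kern K t (y - u)))"
  have [measurable_cong, simp]: "sets \<mu> = sets borel" by (simp add: \<mu>_def)
  interpret \<mu>: prob_space \<mu>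
    by (rule prob_spaceI) (simp add: \<mu>_def emeasure_density nn_integral_kern_affine[OF t])
  define D where "D = distr \<mu> borel w"
  interpret D: cdf_distribution D
    unfolding cdf_distribution_def D_def by (rule \<mu>.real_distribution_distr) simp
  let ?\<Omega> = "restrict_space lborel {0<..<1::real}"
  \<comment> \<open>\<open>D.I\<close> is the quantile function on the open unit interval only; the
    value 1 elsewhere is a default, and the two end points are null.\<close>
  define v where "v r = (if r \<in> {0<..<1} then D.I r else 1)" for r
  have v[measurable]: "v \<in> borel_measurable borel"
    unfolding v_def[abs_def]
    by (subst measurable_If_restrict_space_iff) (use D.measurable_CI in \<open>simp_all del: greaterThanLessThan_iff\<close>)
  have I_meas[measurable]: "D.I \<in> borel_measurable ?\<Omega>"
    using D.measurable_CI by (simp add: measurable_cong_sets[OF sets_restrict_space_cong[OF sets_lborel] refl])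
  have AE01: "AE r in lborel. r \<noteq> 0 \<and> r \<noteq> (1::real)"
    using AE_lborel_singleton[of "0::real"] AE_lborel_singleton[of "1::real"] by eventually_elim auto
  show thesis
  proof (rule that[OF v])
    show "mono_on {0<..<1} v"
      using D.mono_I by (auto simp: v_def monotone_on_def)
    fix F :: "real \<Rightarrow> ennreal" assume [measurable]: "F \<in> borel_measurable borel"
    have "(\<integral>\<^sup>+ u. ennreal (kern K t (y - u)) * F (w u) \<partial>lborel) = (\<integral>\<^sup>+ x. F x \<partial>D)"
      unfolding D_def \<mu>_def by (simp add: nn_integral_distr nn_integral_density)
    also have "\<dots> = (\<integral>\<^sup>+ x. F x \<partial>distr ?\<Omega> borel D.I)" by (simp only: D.distr_I_eq_M)
    also have "\<dots> = (\<integral>\<^sup>+ r. F (D.I r) \<partial>?\<Omega>)" by (simp add: nn_integral_distr)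
    also have "\<dots> = (\<integral>\<^sup>+ r. F (D.I r) * indicator {0<..<1} r \<partial>lborel)"
      by (rule nn_integral_restrict_space) simp
    also have "\<dots> = (\<integral>\<^sup>+ r. F (v r) * indicator {0..1} r \<partial>lborel)"
      by (rule nn_integral_cong_AE, rule eventually_mono[OF AE01]) (auto simp: v_def indicator_def)
    finally show "(\<integral>\<^sup>+ u. ennreal (kern K t (y - u)) * F (w u) \<partial>lborel) = (\<integral>\<^sup>+ r. F (v r) * indicator {0..1} r \<partial>lborel)" .
  next
    fix F :: "real \<Rightarrow> real" assume [measurable]: "F \<in> borel_measurable borel" and int: "Kint K (\<lambda>u. F (w u)) y t"
    have pos: "AE u in lborel. 0 \<le> kern K t (y - u)" by (intro AE_I2 less_imp_le[OF kern_pos[OF t]])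
    have "integrable \<mu> (\<lambda>u. F (w u))"
      unfolding \<mu>_def using int pos by (subst integrable_density) (auto simp: Kint_def)
    then have "integrable D F" unfolding D_def by (subst integrable_distr_eq) auto
    then have "integrable (distr ?\<Omega> borel D.I) F" by (simp only: D.distr_I_eq_M)
    then have "integrable ?\<Omega> (\<lambda>r. F (D.I r))" by (subst (asm) integrable_distr_eq) auto
    then have i1: "integrable lborel (\<lambda>r. indicator {0<..<1} r *\<^sub>R F (D.I r))"
      by (subst (asm) integrable_restrict_space) auto
    have AE_eq: "AE r in lborel. indicator {0<..<1} r *\<^sub>R F (D.I r) = indicator {0..1} r *\<^sub>R F (v r)"
      using AE01 by eventually_elim (auto simp: v_def indicator_def)
    have i2: "integrable lborel (\<lambda>r. indicator {0..1} r *\<^sub>R F (v r))"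
      by (rule integrable_cong_AE_imp[OF i1 _ AE_eq[THEN AE_mp]]) auto
    have "Kext K (\<lambda>u. F (w u)) y t = (LINT u|\<mu>. F (w u))"
      unfolding \<mu>_def Kext_def using pos by (subst integral_density) auto
    also have "\<dots> = (LINT x|D. F x)" unfolding D_def by (subst integral_distr) auto
    also have "\<dots> = (LINT x|distr ?\<Omega> borel D.I. F x)" by (simp only: D.distr_I_eq_M)
    also have "\<dots> = (LINT r|?\<Omega>. F (D.I r))" by (subst integral_distr) auto
    also have "\<dots> = (LINT r|lborel. indicator {0<..<1} r *\<^sub>R F (D.I r))" by (rule integral_restrict_space) simp
    also have "\<dots> = (LINT r|lborel. indicator {0..1} r *\<^sub>R F (v r))"
      by (rule integral_cong_AE) (use i1 i2 AE_eq in auto)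
    finally show "set_integrable lborel {0..1} (\<lambda>r. F (v r)) \<and> (LINT r:{0..1}|lborel. F (v r)) = Kext K (\<lambda>u. F (w u)) y t"
      using i2 by (simp add: set_integrable_def set_lebesgue_integral_def)
  qed
qed

section \<open>Clipped weights and the choice of the tangent\<close>

lemma measurable_dual_fn [measurable]: "dual_fn p \<in> borel_measurable borel"
  unfolding dual_fn_def[abs_def] by (cases "p = \<infinity>") simp_all

lemma measurable_tangent_gauge [measurable]: "tangent_gauge p \<in> borel_measurable borel"
  unfolding tangent_gauge_def[abs_def] by (cases "p = \<infinity>") simp_all

lemma continuous_on_dual_fn: "continuous_on {0<..} (dual_fn p)"
  unfolding dual_fn_def[abs_def] by (cases "p = \<infinity>") (auto intro!: continuous_intros)

lemma measurable_clip [measurable]: "clip \<alpha> \<beta> \<in> borel_measurable borel"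
  unfolding clip_def[abs_def] by simp

lemma clip_bounds: "\<alpha> \<le> \<beta> \<Longrightarrow> \<alpha> \<le> clip \<alpha> \<beta> \<tau> \<and> clip \<alpha> \<beta> \<tau> \<le> \<beta>"
  by (auto simp: clip_def)

lemma clip_bounded:
  fixes f :: "real \<Rightarrow> real"
  assumes "continuous_on {0<..} f" "0 < \<alpha>" "\<alpha> \<le> \<beta>"
  obtains M where "\<And>\<tau>. \<bar>f (clip \<alpha> \<beta> \<tau>)\<bar> \<le> M"
proof -
  have "compact (f ` {\<alpha>..\<beta>})"
    by (intro compact_continuous_image continuous_on_subset[OF assms(1)]) (use assms in auto)
  then obtain M where "\<And>x. x \<in> f ` {\<alpha>..\<beta>} \<Longrightarrow> norm x \<le> M" by (meson compact_imp_bounded bounded_iff)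
  then show thesis using that[of M] clip_bounds[OF assms(3)] by auto
qed

lemma Kint_clip:
  assumes "0 < t" "w \<in> borel_measurable borel" "0 < \<alpha>" "\<alpha> \<le> \<beta>"
    and [measurable]: "f \<in> borel_measurable borel" and f: "continuous_on {0<..} f"
  shows "Kint K (\<lambda>u. f (clip \<alpha> \<beta> (w u))) y t"
proof -
  note [measurable] = assms(2)
  obtain M where "\<And>\<tau>. \<bar>f (clip \<alpha> \<beta> \<tau>)\<bar> \<le> M" using clip_bounded[OF f assms(3,4)] by blast
  then show ?thesis unfolding Kint_def by (intro integrable_kern_mult[where M = M] assms(1)) simp_all
qed

lemma dual_fn_pos: "p \<noteq> \<infinity> \<Longrightarrow> 0 < \<tau> \<Longrightarrow> 0 < dual_fn p \<tau>"
  by (simp add: dual_fn_def)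

lemma ApK_facts:
  assumes "ApK K p \<delta> w" "0 < t"
  shows "w \<in> borel_measurable borel" "AE u in lborel. 0 < w u" "Kint K w y t" "Kint K (\<lambda>u. dual_fn p (w u)) y t"
    "Apval p (Kext K w y t) (Kext K (\<lambda>u. dual_fn p (w u)) y t) \<le> \<delta>"
  using assms by (auto simp: ApK_def weight_Rn_def dual_fn_def Apval_def split: if_splits)

text \<open>Linearise at the scale that is optimal for the averages of the unclipped weight. Under
  the integral clipping lowers the form pointwise, and one good tangent suffices to recover the
  condition.\<close>

lemma ApK_clip:
  fixes w :: "real^'n::finite \<Rightarrow> real"
  assumes p: "1 < p" and \<delta>: "1 < \<delta>" and A: "ApK K p \<delta> w" and ab: "0 < \<alpha>" "\<alpha> \<le> \<beta>" and t: "0 < t"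
  defines "cl \<equiv> \<lambda>u. clip \<alpha> \<beta> (w u)"
  shows "adm p (Kext K cl y t) (Kext K (\<lambda>u. dual_fn p (cl u)) y t)"
    "Apval p (Kext K cl y t) (Kext K (\<lambda>u. dual_fn p (cl u)) y t) \<le> \<delta>"
proof -
  note w = ApK_facts(1,2)[OF A t] ApK_facts(3-5)[OF A t, of y]
  note [measurable] = w(1)
  have cl_pos: "0 < cl u" for u using clip_bounds[OF ab(2), of "w u"] ab(1) by (simp add: cl_def)
  have ki: "Kint K cl y t" "Kint K (\<lambda>u. dual_fn p (cl u)) y t"
    unfolding cl_def
    using Kint_clip[OF t w(1) ab, of "\<lambda>x. x"] Kint_clip[OF t w(1) ab measurable_dual_fn continuous_on_dual_fn] by (simp_all add: continuous_on_id)
  have adm_w: "adm p (Kext K w y t) (Kext K (\<lambda>u. dual_fn p (w u)) y t)"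
    unfolding adm_def
  proof (intro conjI impI)
    show "0 < Kext K w y t" by (rule Kext_pos[OF t w(3,2)])
    assume "p \<noteq> \<infinity>"
    then have "AE u in lborel. 0 < dual_fn p (w u)" using w(2) by (auto elim!: eventually_mono intro: dual_fn_pos)
    then show "0 < Kext K (\<lambda>u. dual_fn p (w u)) y t" by (rule Kext_pos[OF t w(4)])
  qed
  show adm: "adm p (Kext K cl y t) (Kext K (\<lambda>u. dual_fn p (cl u)) y t)"
    unfolding adm_def using Kext_pos[OF t ki(1)] Kext_pos[OF t ki(2)] cl_pos dual_fn_pos[of p] by auto
  obtain s where s: "0 < s" "tangent_side p s (Kext K w y t) (Kext K (\<lambda>u. dual_fn p (w u)) y t) = 0"
    using adm_optimal[OF p adm_w] by (metis order_refl order_antisym)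
  \<comment> \<open>The scale must be clipped together with the weight for
    \<open>tangent_gauge_clip_le\<close> to apply.\<close>
  define s' where "s' = clip \<alpha> \<beta> s"
  have s': "0 < s'" using clip_bounds[OF ab(2), of s] ab(1) by (simp add: s'_def)
  have "tangent_form p s' (Kext K cl y t) (Kext K (\<lambda>u. dual_fn p (cl u)) y t) = Kext K (\<lambda>u. tangent_form p s' (cl u) (dual_fn p (cl u))) y t"
    by (rule Kext_affine(2)[OF t ki tangent_form_affine, symmetric])
  also have "\<dots> \<le> Kext K (\<lambda>u. tangent_form p s (w u) (dual_fn p (w u))) y t"
    unfolding Kext_def
  proof (rule integral_mono_AE)
    show "integrable lborel (\<lambda>u. kern K t (y - u) * tangent_form p s' (cl u) (dual_fn p (cl u)))"
      "integrable lborel (\<lambda>u. kern K t (y - u) * tangent_form p s (w u) (dual_fn p (w u)))"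
      using Kext_affine(1)[OF t ki tangent_form_affine] Kext_affine(1)[OF t w(3,4) tangent_form_affine] by (simp_all add: Kint_def)
    show "AE u in lborel. kern K t (y - u) * tangent_form p s' (cl u) (dual_fn p (cl u)) \<le> kern K t (y - u) * tangent_form p s (w u) (dual_fn p (w u))"
      using w(2)
    proof eventually_elim
      case (elim u)
      show ?case
        unfolding tangent_form_dual[OF cl_pos s'] tangent_form_dual[OF elim s(1)]
        unfolding cl_def s'_def
        by (intro mult_left_mono tangent_gauge_clip_le p ab elim s(1) less_imp_le[OF kern_pos[OF t]])
    qed
  qed
  also have "\<dots> = tangent_form p s (Kext K w y t) (Kext K (\<lambda>u. dual_fn p (w u)) y t)"
    by (rule Kext_affine(2)[OF t w(3,4) tangent_form_affine])
  also have "\<dots> \<le> crit p \<delta>"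
    by (rule tangent_form_le_crit_of_tangent_side_zero[OF p adm_w w(5) s \<delta>])
  finally show "Apval p (Kext K cl y t) (Kext K (\<lambda>u. dual_fn p (cl u)) y t) \<le> \<delta>"
    by (rule Apval_le_of_tangent_form_le[OF p adm s' _ \<delta>])
qed

lemma tangent_side_dual_sign:
  assumes p: "1 < p" and "0 < \<tau>" "0 < s"
  shows "tangent_side p s \<tau> (dual_fn p \<tau>) < 0 \<longleftrightarrow> s < \<tau>" "0 < tangent_side p s \<tau> (dual_fn p \<tau>) \<longleftrightarrow> \<tau> < s"
proof -
  have "(tangent_side p s \<tau> (dual_fn p \<tau>) < 0 \<longleftrightarrow> s < \<tau>) \<and> (0 < tangent_side p s \<tau> (dual_fn p \<tau>) \<longleftrightarrow> \<tau> < s)"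
    using p
  proof (rule ereal_gt_1_cases)
    assume "p = \<infinity>"
    then show ?thesis by (simp add: tangent_side_def)
  next
    fix P assume P: "p = ereal P" "1 < P"
    define q where "q = 1 / (P - 1)"
    have q: "1 + q > 0" using P by (simp add: q_def add_pos_pos)
    have "\<tau> = \<tau> powr (1 + q) * \<tau> powr (- q)" using assms by (simp flip: powr_add)
    then have "tangent_side p s \<tau> (dual_fn p \<tau>) = (s powr (1 + q) - \<tau> powr (1 + q)) * \<tau> powr (- q)"
      using P by (simp add: tangent_side_def dual_fn_def q_def left_diff_distrib)
    moreover have "0 < \<tau> powr (- q)" using assms by simp
    ultimately have "(tangent_side p s \<tau> (dual_fn p \<tau>) < 0 \<longleftrightarrow> s powr (1 + q) < \<tau> powr (1 + q))"
      "(0 < tangent_side p s \<tau> (dual_fn p \<tau>) \<longleftrightarrow> \<tau> powr (1 + q) < s powr (1 + q))"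
      by (simp_all add: mult_less_0_iff zero_less_mult_iff)
    then show ?thesis
      using powr_le_powr_iff[OF q, of s \<tau>] powr_le_powr_iff[OF q, of \<tau> s] assms by (simp add: not_le[symmetric])
  qed
  then show "tangent_side p s \<tau> (dual_fn p \<tau>) < 0 \<longleftrightarrow> s < \<tau>" "0 < tangent_side p s \<tau> (dual_fn p \<tau>) \<longleftrightarrow> \<tau> < s" by auto
qed

lemma exists_good_scale:
  fixes w :: "real^'n::finite \<Rightarrow> real"
  assumes p: "1 < p" and \<delta>: "1 < \<delta>" and A: "ApK K p \<delta> w" and ab: "0 < \<alpha>" "\<alpha> \<le> \<beta>" and t: "0 < t"
    and s1: "\<alpha> \<le> s1" "tangent_gauge p (\<alpha> / s1) = crit p \<delta>" and s2: "s2 \<le> \<beta>" "tangent_gauge p (\<beta> / s2) = crit p \<delta>" and s12: "s1 \<le> s2"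
  obtains s where "s1 \<le> s" "s \<le> s2" "Kext K (\<lambda>u. tangent_gauge p (clip \<alpha> \<beta> (w u) / s)) y t \<le> crit p \<delta>"
proof -
  define cl where "cl = (\<lambda>u. clip \<alpha> \<beta> (w u))"
  have wm[measurable]: "w \<in> borel_measurable borel" using ApK_facts(1)[OF A t] .
  have [measurable]: "cl \<in> borel_measurable borel" unfolding cl_def by simp
  have pos: "0 < s1" "0 < s2" using ab s1 s12 by auto
  have cl: "\<alpha> \<le> cl u" "cl u \<le> \<beta>" "0 < cl u" for u using clip_bounds[OF ab(2), of "w u"] ab(1) by (auto simp: cl_def)
  define X1 where "X1 = Kext K cl"
  define X2 where "X2 = Kext K (\<lambda>u. dual_fn p (cl u))"
  have adm: "adm p (X1 y t) (X2 y t)" and val: "Apval p (X1 y t) (X2 y t) \<le> \<delta>" if "0 < t" for y t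
    using ApK_clip[OF p \<delta> A ab that, of y] by (simp_all add: X1_def X2_def cl_def)
  have ki: "Kint K cl y t" "Kint K (\<lambda>u. dual_fn p (cl u)) y t" if "0 < t" for y t
    unfolding cl_def
    using Kint_clip[OF that wm ab, of "\<lambda>x. x"] Kint_clip[OF that wm ab measurable_dual_fn continuous_on_dual_fn] by (simp_all add: continuous_on_id)
  have bounded: "\<exists>M. \<forall>u. \<bar>f (cl u) (dual_fn p (cl u))\<bar> \<le> M" if f: "\<exists>A B C. \<forall>x1 x2. f x1 x2 = A * x1 + B * x2 + (C::real)" for f
  proof -
    obtain A B C where f: "\<And>x1 x2. f x1 x2 = A * x1 + B * x2 + C" using f by blast
    have "continuous_on {0<..} (\<lambda>x. f x (dual_fn p x))" unfolding f by (intro continuous_intros continuous_on_dual_fn)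
    from clip_bounded[OF this ab] show ?thesis unfolding cl_def by metis
  qed
  have N1: "\<exists>A B C. \<forall>x1 x2. tangent_form p s x1 x2 - crit p \<delta> = A * x1 + B * x2 + C" for s
  proof -
    obtain A B C where "\<forall>x1 x2. tangent_form p s x1 x2 = A * x1 + B * x2 + C" using tangent_form_affine by blast
    then show ?thesis by (intro exI[of _ A] exI[of _ B] exI[of _ "C - crit p \<delta>"]) simp
  qed
  \<comment> \<open>The maximum principle applied to the excess over the tangent of scale
    \<open>s\<close> and to the side, with \<open>\<sigma>\<close> selecting which piece is allowed.
    The kernel condition enters at all points of the half-space: where the side vanishes, it forces
    the excess to be nonpositive.\<close>
  have phase: "\<sigma> * tangent_side p s (X1 y t) (X2 y t) < 0"
    if s: "0 < s" and \<sigma>: "\<sigma> \<in> {1, -1}" and bd: "\<And>u. tangent_gauge p (cl u / s) > crit p \<delta> \<Longrightarrow> \<sigma> * tangent_side p s (cl u) (dual_fn p (cl u)) < 0"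
      and N: "tangent_form p s (X1 y t) (X2 y t) > crit p \<delta>" for s \<sigma>
  proof -
    have mf1: "\<exists>A B C. \<forall>x1 x2. \<sigma> * tangent_side p s x1 x2 = A * x1 + B * x2 + C"
    proof -
      obtain A B C where "\<forall>x1 x2. tangent_side p s x1 x2 = A * x1 + B * x2 + C" using tangent_side_affine by blast
      then show ?thesis by (intro exI[of _ "\<sigma> * A"] exI[of _ "\<sigma> * B"] exI[of _ "\<sigma> * C"]) (simp add: algebra_simps)
    qed
    define a where "a u = tangent_form p s (cl u) (dual_fn p (cl u)) - crit p \<delta>" for u
    define b where "b u = \<sigma> * tangent_side p s (cl u) (dual_fn p (cl u))" for u
    have am: "a \<in> borel_measurable borel" unfolding a_def[abs_def] tangent_form_def by (cases "p = \<infinity>") simp_all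
    have bm: "b \<in> borel_measurable borel" unfolding b_def[abs_def] tangent_side_def by (cases "p = \<infinity>") simp_all
    obtain Ma Mb where "\<And>u. \<bar>a u\<bar> \<le> Ma" "\<And>u. \<bar>b u\<bar> \<le> Mb"
      using bounded[OF N1[of s]] bounded[OF mf1] unfolding a_def b_def by blast
    then have M: "\<bar>a u\<bar> \<le> max Ma Mb" "\<bar>b u\<bar> \<le> max Ma Mb" for u by (meson max.coboundedI1 max.coboundedI2)+
    have Ka: "Kext K a y t = tangent_form p s (X1 y t) (X2 y t) - crit p \<delta>" if "0 < t" for y t
      unfolding a_def[abs_def] X1_def X2_def by (rule Kext_affine(2)[OF that ki[OF that] N1])
    have Kb: "Kext K b y t = \<sigma> * tangent_side p s (X1 y t) (X2 y t)" if "0 < t" for y t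
      unfolding b_def[abs_def] X1_def X2_def by (rule Kext_affine(2)[OF that ki[OF that] mf1])
    have "Kext K b y t < 0"
    proof (rule two_phase_maximum_principle[OF am bm M _ _ t])
      show "Kext K a y t \<le> 0" if "0 < t" "Kext K b y t = 0" for y t
        using tangent_form_le_crit_of_tangent_side_zero[OF p adm[OF that(1)] val[OF that(1)] s _ \<delta>, of y] that \<sigma> by (auto simp: Ka Kb)
      show "AE u in lborel. 0 < a u \<longrightarrow> b u < 0"
        using bd by (intro AE_I2) (simp add: a_def b_def tangent_form_dual[OF cl(3) s])
      show "0 < Kext K a y t" using N by (simp add: Ka[OF t])
    qed
    then show ?thesis by (simp add: Kb[OF t])
  qed
  \<comment> \<open>The gauge at \<open>\<alpha> / s1\<close> is exactly critical with ratio at most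
    1, so by monotonicity the arc from \<alpha> to \<open>s1\<close> is not above the tangent; an
    excess can occur only beyond \<open>s1\<close>. The case \<open>ph2\<close> is the mirror
    image.\<close>
  have ph1: "s1 \<le> s0" if s0: "\<And>s. 0 < s \<Longrightarrow> tangent_side p s (X1 y t) (X2 y t) \<le> 0 \<longleftrightarrow> s \<le> s0" and N: "tangent_form p s1 (X1 y t) (X2 y t) > crit p \<delta>" for s0
  proof -
    have "1 * tangent_side p s1 (X1 y t) (X2 y t) < 0"
    proof (rule phase[OF pos(1) _ _ N])
      fix u assume G: "tangent_gauge p (cl u / s1) > crit p \<delta>"
      have "\<not> cl u / s1 \<le> 1"
        using tangent_gauge_antimono[OF p, of "\<alpha> / s1" "cl u / s1"] G s1(2) pos ab cl[of u] by (auto simp: divide_right_mono)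
      then show "1 * tangent_side p s1 (cl u) (dual_fn p (cl u)) < 0"
        using tangent_side_dual_sign(1)[OF p cl(3) pos(1)] pos by simp
    qed simp
    then show ?thesis using s0[OF pos(1)] by simp
  qed
  have ph2: "s0 \<le> s2" if s0: "\<And>s. 0 < s \<Longrightarrow> 0 \<le> tangent_side p s (X1 y t) (X2 y t) \<longleftrightarrow> s0 \<le> s" and N: "tangent_form p s2 (X1 y t) (X2 y t) > crit p \<delta>" for s0
  proof -
    have "-1 * tangent_side p s2 (X1 y t) (X2 y t) < 0"
    proof (rule phase[OF pos(2) _ _ N])
      fix u assume G: "tangent_gauge p (cl u / s2) > crit p \<delta>"
      have "\<not> 1 \<le> cl u / s2"
        using tangent_gauge_mono[OF p, of "cl u / s2" "\<beta> / s2"] G s2(2) pos cl[of u] by (auto simp: divide_right_mono)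
      then show "-1 * tangent_side p s2 (cl u) (dual_fn p (cl u)) < 0"
        using tangent_side_dual_sign(2)[OF p cl(3) pos(2)] pos by simp
    qed simp
    then show ?thesis using s0[OF pos(2)] by simp
  qed
  \<comment> \<open>If \<open>s1\<close> or \<open>s2\<close> is already good, take it. Otherwise
    both are exceeded, which places the optimal scale \<open>s0\<close> between them, and
    \<open>s0\<close> is good by the kernel condition at \<open>(y, t)\<close>.\<close>
  have "\<exists>s. s1 \<le> s \<and> s \<le> s2 \<and> tangent_form p s (X1 y t) (X2 y t) \<le> crit p \<delta>"
  proof -
    obtain s0 where s0: "0 < s0" "\<And>s. 0 < s \<Longrightarrow> tangent_side p s (X1 y t) (X2 y t) \<le> 0 \<longleftrightarrow> s \<le> s0"
      "\<And>s. 0 < s \<Longrightarrow> 0 \<le> tangent_side p s (X1 y t) (X2 y t) \<longleftrightarrow> s0 \<le> s"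
      using adm_optimal[OF p adm[OF t, of y]] by blast
    have "tangent_side p s0 (X1 y t) (X2 y t) = 0" using s0 by (metis order_refl order_antisym)
    then have "tangent_form p s0 (X1 y t) (X2 y t) \<le> crit p \<delta>"
      by (intro tangent_form_le_crit_of_tangent_side_zero[OF p adm[OF t] val[OF t] s0(1) _ \<delta>])
    then show ?thesis
      using ph1[OF s0(2)] ph2[OF s0(3)] s12 by (meson not_le order_refl)
  qed
  then obtain s where s: "s1 \<le> s" "s \<le> s2" "tangent_form p s (X1 y t) (X2 y t) \<le> crit p \<delta>" by blast
  then have "0 < s" using pos by linarith
  have "tangent_form p s (X1 y t) (X2 y t) = Kext K (\<lambda>u. tangent_form p s (cl u) (dual_fn p (cl u))) y t"
    unfolding X1_def X2_def by (rule Kext_affine(2)[OF t ki[OF t] tangent_form_affine, symmetric])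
  then show thesis
    using that[OF s(1,2)] s(3) unfolding tangent_form_dual[OF cl(3) \<open>0 < s\<close>] by (simp add: cl_def)
qed

text \<open>The interval is interior so that \<open>v c\<close> and \<open>v d\<close> are genuine
  quantiles, positive and finite, and can serve as clipping levels.\<close>

lemma rearrangement_Apval_interior:
  fixes w :: "real^'n::finite \<Rightarrow> real"
  assumes p: "1 < p" and \<delta>: "1 < \<delta>" and A: "ApK K p \<delta> w" and t: "0 < t"
    and v: "v \<in> borel_measurable borel" "mono_on {0<..<1} v" "\<And>r. 0 < r \<Longrightarrow> r < 1 \<Longrightarrow> 0 < v r"
    and vint: "set_integrable lborel {0..1} v" "set_integrable lborel {0..1} (\<lambda>r. dual_fn p (v r))"
    and dist: "\<And>F :: real \<Rightarrow> real. F \<in> borel_measurable borel \<Longrightarrow> Kint K (\<lambda>u. F (w u)) y t \<Longrightarrow>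
       set_integrable lborel {0..1} (\<lambda>r. F (v r)) \<and> (LINT r:{0..1}|lborel. F (v r)) = Kext K (\<lambda>u. F (w u)) y t"
    and cd: "0 < c" "c < d" "d < 1"
  shows "Apval p (avg v c d) (avg (\<lambda>r. dual_fn p (v r)) c d) \<le> \<delta>"
proof -
  define \<kappa> where "\<kappa> = crit p \<delta>"
  have sub: "{c..d} \<subseteq> {0..1}" using cd by auto
  have vi: "set_integrable lborel {c..d} v" "set_integrable lborel {c..d} (\<lambda>r. dual_fn p (v r))"
    using vint sub by (auto intro: set_integrable_subset)
  have adm: "adm p (avg v c d) (avg (\<lambda>r. dual_fn p (v r)) c d)"
    unfolding adm_def using cd by (auto intro!: avg_pos vi v dual_fn_pos)
  obtain \<tau>m \<tau>p where \<tau>: "0 < \<tau>m" "\<tau>m < 1" "1 < \<tau>p" "tangent_gauge p \<tau>m = \<kappa>" "tangent_gauge p \<tau>p = \<kappa>"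
    using tangent_gauge_roots[OF p tangent_gauge_1_less_crit[OF p \<delta>]] unfolding \<kappa>_def by blast
  define \<alpha> where "\<alpha> = v c"
  define \<beta> where "\<beta> = v d"
  have mono: "v r \<le> v r'" if "0 < r" "r \<le> r'" "r' < 1" for r r'
    using v(2) that by (auto simp: monotone_on_def)
  have ab: "0 < \<alpha>" "\<alpha> \<le> \<beta>" using cd v(3) mono[of c d] by (auto simp: \<alpha>_def \<beta>_def)
  \<comment> \<open>With the smaller root \<alpha> is the lower of the two intersections of the
    tangent \<open>s1\<close> with the curve; with the larger root \<beta> is the upper intersection
    for \<open>s2\<close>.\<close>
  define s1 where "s1 = \<alpha> / \<tau>m"
  define s2 where "s2 = \<beta> / \<tau>p"
  have s1: "\<alpha> \<le> s1" "tangent_gauge p (\<alpha> / s1) = \<kappa>" "0 < s1" using ab \<tau> by (auto simp: s1_def field_simps)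
  have s2: "s2 \<le> \<beta>" "tangent_gauge p (\<beta> / s2) = \<kappa>" "0 < s2" using ab \<tau> by (auto simp: s2_def field_simps)
  have GN: "avg (\<lambda>r. tangent_gauge p (v r / s)) c d = tangent_form p s (avg v c d) (avg (\<lambda>r. dual_fn p (v r)) c d)"
    and Gi: "set_integrable lborel {c..d} (\<lambda>r. tangent_gauge p (v r / s))" if "0 < s" for s
  proof -
    have eq: "tangent_form p s (v r) (dual_fn p (v r)) = tangent_gauge p (v r / s)" if "r \<in> {c..d}" for r
      using that cd v(3) \<open>0 < s\<close> by (intro tangent_form_dual) auto
    have "avg (\<lambda>r. tangent_gauge p (v r / s)) c d = avg (\<lambda>r. tangent_form p s (v r) (dual_fn p (v r))) c d"
      unfolding avg_def by (subst set_lebesgue_integral_cong[OF _ ]) (auto simp: eq)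
    then show "avg (\<lambda>r. tangent_gauge p (v r / s)) c d = tangent_form p s (avg v c d) (avg (\<lambda>r. dual_fn p (v r)) c d)"
      using avg_affine(2)[OF cd(2) vi tangent_form_affine] by simp
    show "set_integrable lborel {c..d} (\<lambda>r. tangent_gauge p (v r / s))"
      using avg_affine(1)[OF cd(2) vi tangent_form_affine[of p s]] by (subst set_integrable_cong[OF refl refl eq[symmetric]]) auto
  qed
  have "\<exists>s>0. (LINT r:{c..d}|lborel. tangent_gauge p (v r / s)) \<le> \<kappa> * (d - c)"
  proof (cases "s1 \<le> s2")
    \<comment> \<open>With \<open>s2 < s1\<close> the tangent \<open>s1\<close> has its second
      intersection beyond \<beta>, so it is above the whole arc, and a pointwise bound is
      enough.\<close>
    case False
    have "(LINT r:{c..d}|lborel. tangent_gauge p (v r / s1)) \<le> (LINT r:{c..d}|lborel. \<kappa>)"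
    proof (rule set_integral_mono[OF Gi[OF s1(3)]])
      show "set_integrable lborel {c..d} (\<lambda>_. \<kappa>)" by (intro borel_integrable_atLeastAtMost' continuous_on_const)
      fix r assume "r \<in> {c..d}"
      then have r: "\<alpha> \<le> v r" "v r \<le> \<beta>" using mono[of c r] mono[of r d] cd by (auto simp: \<alpha>_def \<beta>_def)
      show "tangent_gauge p (v r / s1) \<le> \<kappa>"
      proof (cases "v r / s1 \<le> 1")
        case True
        have "tangent_gauge p (v r / s1) \<le> tangent_gauge p (\<alpha> / s1)"
          using True r ab s1 by (intro tangent_gauge_antimono p) (auto simp: divide_right_mono)
        then show ?thesis using s1 by simp
      next
        case False
        have "v r / s1 \<le> \<beta> / s2" using r ab s1 s2 \<open>\<not> s1 \<le> s2\<close> by (intro frac_le) auto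
        then have "tangent_gauge p (v r / s1) \<le> tangent_gauge p (\<beta> / s2)" using False by (intro tangent_gauge_mono p) auto
        then show ?thesis using s2 by simp
      qed
    qed
    also have "\<dots> = \<kappa> * (d - c)" using cd by (simp add: set_lebesgue_integral_def)
    finally show ?thesis using s1(3) by blast
  next
    case True
    obtain s where s: "s1 \<le> s" "s \<le> s2" "Kext K (\<lambda>u. tangent_gauge p (clip \<alpha> \<beta> (w u) / s)) y t \<le> \<kappa>"
      using exists_good_scale[OF p \<delta> A ab t s1(1) s1(2)[unfolded \<kappa>_def] s2(1) s2(2)[unfolded \<kappa>_def] True, of y]
      unfolding \<kappa>_def by blast
    have s0: "0 < s" using s s1 by linarith
    define F where "F \<tau> = tangent_gauge p (clip \<alpha> \<beta> \<tau> / s)" for \<tau>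
    have Fm[measurable]: "F \<in> borel_measurable borel" unfolding F_def[abs_def] by simp
    have cG: "continuous_on {0<..} (\<lambda>x. tangent_gauge p (x / s))"
      by (intro continuous_at_imp_continuous_on ballI continuous_within_compose3[OF isCont_tangent_gauge[OF p]] continuous_intros) (use s0 in auto)
    have "Kint K (\<lambda>u. F (w u)) y t"
      unfolding F_def by (rule Kint_clip[OF t ApK_facts(1)[OF A t] ab _ cG]) simp
    note Fi = dist[OF Fm this]
    \<comment> \<open>Raising the scale from \<open>s1\<close> pushes the ratio of \<alpha> further
      below the smaller root; lowering it from \<open>s2\<close> pushes the ratio of \<beta> further
      above the larger one.\<close>
    have G1: "\<kappa> \<le> tangent_gauge p (\<alpha> / s)" "\<kappa> \<le> tangent_gauge p (\<beta> / s)"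
    proof -
      have "\<alpha> / s \<le> \<alpha> / s1" using ab s s0 s1 by (intro divide_left_mono) auto
      moreover have "\<alpha> / s1 \<le> 1" using s1 by simp
      ultimately show "\<kappa> \<le> tangent_gauge p (\<alpha> / s)" using tangent_gauge_antimono[OF p, of "\<alpha> / s" "\<alpha> / s1"] s1(2) ab s0 by simp
      have "\<beta> / s2 \<le> \<beta> / s" using ab s s0 s2 by (intro divide_left_mono) auto
      moreover have "1 \<le> \<beta> / s2" using s2 by simp
      ultimately show "\<kappa> \<le> tangent_gauge p (\<beta> / s)" using tangent_gauge_mono[OF p, of "\<beta> / s2" "\<beta> / s"] s2(2) by simp
    qed
    \<comment> \<open>Outside \<open>[c, d]\<close> the clipped function is \<alpha> or \<beta>,
      where the gauge is at least \<kappa>. Replacing it there by \<kappa> gives this lower bound,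
      and subtracting \<kappa> times the removed length from a total of at most \<kappa> leaves at
      most \<kappa> times d - c.\<close>
    let ?L = "\<lambda>r. \<kappa> * indicator {0..1} r - \<kappa> * indicator {c..d} r + indicator {c..d} r *\<^sub>R tangent_gauge p (v r / s)"
    have Li: "integrable lborel (\<lambda>r::real. \<kappa> * indicator {0..1} r)" "integrable lborel (\<lambda>r::real. \<kappa> * indicator {c..d} r)"
      "integrable lborel (\<lambda>r. indicator {c..d} r *\<^sub>R tangent_gauge p (v r / s))"
    proof -
      have ind: "integrable lborel (indicat_real {a..b})" for a b :: real
        by (rule integrable_real_indicator) (auto simp: emeasure_lborel_Icc_eq)
      show "integrable lborel (\<lambda>r::real. \<kappa> * indicator {0..1} r)" "integrable lborel (\<lambda>r::real. \<kappa> * indicator {c..d} r)"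
        using ind by simp_all
      show "integrable lborel (\<lambda>r. indicator {c..d} r *\<^sub>R tangent_gauge p (v r / s))"
        using Gi[OF s0] by (simp only: set_integrable_def)
    qed
    have "(LINT r|lborel. ?L r) \<le> (LINT r|lborel. indicator {0..1} r *\<^sub>R F (v r))"
    proof (rule integral_mono_AE)
      show "integrable lborel ?L"
        using Li by (intro Bochner_Integration.integrable_add Bochner_Integration.integrable_diff)
      show "integrable lborel (\<lambda>r. indicator {0..1} r *\<^sub>R F (v r))" using Fi by (simp add: set_integrable_def)
      have AE01: "AE r in lborel. r \<noteq> 0 \<and> r \<noteq> (1::real)"
        using AE_lborel_singleton[of "0::real"] AE_lborel_singleton[of "1::real"] by eventually_elim auto
      show "AE r in lborel. ?L r \<le> indicator {0..1} r *\<^sub>R F (v r)"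
      proof (rule eventually_mono[OF AE01])
        fix r :: real assume r: "r \<noteq> 0 \<and> r \<noteq> 1"
        consider "r < 0 \<or> 1 < r" | "0 < r" "r < c" | "c \<le> r" "r \<le> d" | "d < r" "r < 1" using r by linarith
        then show "?L r \<le> indicator {0..1} r *\<^sub>R F (v r)"
        proof cases
          case 1
          then show ?thesis using cd by (auto simp: indicator_def)
        next
          case 2
          then have "clip \<alpha> \<beta> (v r) = \<alpha>" using mono[of r c] cd ab by (auto simp: clip_def \<alpha>_def)
          then show ?thesis using 2 cd G1 by (simp add: indicator_def F_def)
        next
          case 3
          then have "clip \<alpha> \<beta> (v r) = v r" using mono[of c r] mono[of r d] cd by (auto simp: clip_def \<alpha>_def \<beta>_def)
          then show ?thesis using 3 cd by (simp add: indicator_def F_def)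
        next
          case 4
          then have "clip \<alpha> \<beta> (v r) = \<beta>" using mono[of d r] cd ab by (auto simp: clip_def \<beta>_def)
          then show ?thesis using 4 cd G1 by (simp add: indicator_def F_def)
        qed
      qed
    qed
    also have "\<dots> = Kext K (\<lambda>u. F (w u)) y t" using Fi by (simp add: set_lebesgue_integral_def)
    also have "\<dots> \<le> \<kappa>" using s(3) by (simp add: F_def)
    also have "(LINT r|lborel. ?L r) = \<kappa> - \<kappa> * (d - c) + (LINT r:{c..d}|lborel. tangent_gauge p (v r / s))"
    proof -
      have "(LINT r|lborel. ?L r) = (LINT r::real|lborel. \<kappa> * indicator {0..1} r) - (LINT r|lborel. \<kappa> * indicator {c..d} r) + (LINT r|lborel. indicator {c..d} r *\<^sub>R tangent_gauge p (v r / s))"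
        using Li by (simp only: Bochner_Integration.integral_add Bochner_Integration.integral_diff Bochner_Integration.integrable_diff)
      then show ?thesis using cd by (simp add: set_lebesgue_integral_def)
    qed
    finally have "(LINT r:{c..d}|lborel. tangent_gauge p (v r / s)) \<le> \<kappa> * (d - c)" by simp
    then show ?thesis using s0 by blast
  qed
  then obtain s where s: "0 < s" "(LINT r:{c..d}|lborel. tangent_gauge p (v r / s)) \<le> \<kappa> * (d - c)" by blast
  then have "avg (\<lambda>r. tangent_gauge p (v r / s)) c d \<le> crit p \<delta>"
    using cd by (simp add: avg_def \<kappa>_def pos_divide_le_eq)
  then show ?thesis
    by (intro Apval_le_of_tangent_form_le[OF p adm s(1) _ \<delta>]) (simp only: GN[OF s(1)])
qed

section \<open>Arbitrary subintervals and the comparison of the Bellman functions\<close>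

lemma avg_tendsto:
  assumes F: "set_integrable lborel {0..1} F" and cd: "0 \<le> c" "c < d" "d \<le> 1"
    and e: "e \<longlonglongrightarrow> 0" "\<And>k. 0 < e k"
  shows "(\<lambda>k. avg F (c + e k) (d - e k)) \<longlonglongrightarrow> avg F c d"
proof -
  have "(\<lambda>k. LINT r|lborel. indicator {c + e k..d - e k} r *\<^sub>R F r) \<longlonglongrightarrow> (LINT r|lborel. indicator {c..d} r *\<^sub>R F r)"
  proof (rule integral_dominated_convergence[where w = "\<lambda>r. norm (indicator {0..1} r *\<^sub>R F r)"])
    have sub: "set_integrable lborel {a..b} F" if "0 \<le> a" "b \<le> 1" for a b
      using F by (rule set_integrable_subset) (use that in auto)
    show "integrable lborel (\<lambda>r. norm (indicator {0..1} r *\<^sub>R F r))" using F by (simp add: set_integrable_def)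
    show "(\<lambda>r. indicator {c..d} r *\<^sub>R F r) \<in> borel_measurable lborel" using sub[OF cd(1,3)] by (auto simp: set_integrable_def)
    show "(\<lambda>r. indicator {c + e k..d - e k} r *\<^sub>R F r) \<in> borel_measurable lborel" for k
      using sub[of "c + e k" "d - e k"] cd less_imp_le[OF e(2), of k] by (auto simp: set_integrable_def)
    show "AE r in lborel. norm (indicator {c + e k..d - e k} r *\<^sub>R F r) \<le> norm (indicator {0..1} r *\<^sub>R F r)" for k
      using cd e(2)[of k] by (intro AE_I2) (auto simp: indicator_def)
    have AE: "AE r in lborel. r \<noteq> c \<and> r \<noteq> d"
      using AE_lborel_singleton[of c] AE_lborel_singleton[of d] by eventually_elim auto
    show "AE r in lborel. (\<lambda>k. indicator {c + e k..d - e k} r *\<^sub>R F r) \<longlonglongrightarrow> indicator {c..d} r *\<^sub>R F r"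
    proof (rule eventually_mono[OF AE])
      fix r assume r: "r \<noteq> c \<and> r \<noteq> d"
      have "\<forall>\<^sub>F k in sequentially. indicator {c + e k..d - e k} r *\<^sub>R F r = indicator {c..d} r *\<^sub>R F r"
      proof (cases "c < r \<and> r < d")
        case True
        have "\<forall>\<^sub>F k in sequentially. e k < r - c" "\<forall>\<^sub>F k in sequentially. e k < d - r"
          using True by (auto intro!: order_tendstoD(2)[OF e(1)])
        then show ?thesis by eventually_elim (use True in \<open>auto simp: indicator_def\<close>)
      next
        case False
        then have "r < c \<or> d < r" using r by auto
        then have "indicator {c + e k..d - e k} r *\<^sub>R F r = indicator {c..d} r *\<^sub>R F r" for k
          using e(2)[of k] by (auto simp: indicator_def)
        then show ?thesis by simp
      qed
      then show "(\<lambda>k. indicator {c + e k..d - e k} r *\<^sub>R F r) \<longlonglongrightarrow> indicator {c..d} r *\<^sub>R F r"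
        by (rule tendsto_eventually)
    qed
  qed
  moreover have "(\<lambda>k. (d - e k) - (c + e k)) \<longlonglongrightarrow> (d - 0) - (c + 0)" by (intro tendsto_intros e)
  ultimately show ?thesis
    unfolding avg_def set_lebesgue_integral_def using cd by (intro tendsto_divide) auto
qed

text \<open>At 0 and 1 the values of \<open>v\<close> carry no information about \<open>w\<close>,
  so intervals reaching the ends are exhausted by interior ones, and the condition is closed under
  the limit.\<close>

lemma rearrangement_Ap_int:
  fixes w :: "real^'n::finite \<Rightarrow> real"
  assumes p: "1 < p" and \<delta>: "1 < \<delta>'" "\<delta>' \<le> \<delta>" and A: "ApK K p \<delta>' w" and t: "0 < t"
    and v: "v \<in> borel_measurable borel" "mono_on {0<..<1} v" "\<And>r. 0 < r \<Longrightarrow> r < 1 \<Longrightarrow> 0 < v r"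
    and dist: "\<And>F :: real \<Rightarrow> real. F \<in> borel_measurable borel \<Longrightarrow> Kint K (\<lambda>u. F (w u)) y t \<Longrightarrow>
       set_integrable lborel {0..1} (\<lambda>r. F (v r)) \<and> (LINT r:{0..1}|lborel. F (v r)) = Kext K (\<lambda>u. F (w u)) y t"
  shows "Ap_int p \<delta> v 0 1"
proof -
  have vint: "set_integrable lborel {0..1} v" "set_integrable lborel {0..1} (\<lambda>r. dual_fn p (v r))"
    using dist[of "\<lambda>x. x"] dist[of "dual_fn p"] ApK_facts(3,4)[OF A t] by auto
  have val: "Apval p (avg v c d) (avg (\<lambda>r. dual_fn p (v r)) c d) \<le> \<delta>" if cd: "0 \<le> c" "c < d" "d \<le> 1" for c d
  proof -
    \<comment> \<open>Removing at most a third at each end keeps the shrunken interval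
      nondegenerate.\<close>
    define e where "e k = (d - c) / 3 * inverse (real (Suc k))" for k
    have e: "e \<longlonglongrightarrow> 0" "0 < e k" "e k \<le> (d - c) / 3" for k
    proof -
      show "e \<longlonglongrightarrow> 0" unfolding e_def[abs_def] using tendsto_mult_right_zero[OF LIMSEQ_inverse_real_of_nat] by simp
      show "0 < e k" using cd by (simp add: e_def)
      show "e k \<le> (d - c) / 3" using cd unfolding e_def by (intro mult_left_le) (auto simp: inverse_le_1_iff)
    qed
    have le: "Apval p (avg v (c + e k) (d - e k)) (avg (\<lambda>r. dual_fn p (v r)) (c + e k) (d - e k)) \<le> \<delta>'" for k
      by (rule rearrangement_Apval_interior[OF p \<delta>(1) A t v vint dist]) (use cd e(2,3)[of k] in \<open>auto simp: field_simps\<close>)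
    have lim: "(\<lambda>k. avg v (c + e k) (d - e k)) \<longlonglongrightarrow> avg v c d"
      "(\<lambda>k. avg (\<lambda>r. dual_fn p (v r)) (c + e k) (d - e k)) \<longlonglongrightarrow> avg (\<lambda>r. dual_fn p (v r)) c d"
      by (intro avg_tendsto vint cd e)+
    have pos: "0 < avg (\<lambda>r. dual_fn p (v r)) c d" if "p \<noteq> \<infinity>"
    proof (rule avg_pos[OF cd(2)])
      show "set_integrable lborel {c..d} (\<lambda>r. dual_fn p (v r))"
        using vint(2) by (rule set_integrable_subset) (use cd in auto)
    qed (use cd v(3) that in \<open>auto intro!: dual_fn_pos\<close>)
    have "(\<lambda>k. Apval p (avg v (c + e k) (d - e k)) (avg (\<lambda>r. dual_fn p (v r)) (c + e k) (d - e k))) \<longlonglongrightarrow> Apval p (avg v c d) (avg (\<lambda>r. dual_fn p (v r)) c d)"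
    proof (cases "p = \<infinity>")
      case True
      then show ?thesis unfolding Apval_def by (simp only: simp_thms if_True) (intro tendsto_intros lim[unfolded True])
    next
      case False
      with pos have "avg (\<lambda>r. dual_fn p (v r)) c d \<noteq> 0" by simp
      with False show ?thesis unfolding Apval_def by (simp only: if_False) (intro tendsto_intros lim disjI1)
    qed
    then have "Apval p (avg v c d) (avg (\<lambda>r. dual_fn p (v r)) c d) \<le> \<delta>'"
      by (rule LIMSEQ_le_const2) (use le in auto)
    then show ?thesis using \<delta> by simp
  qed
  have "AE s in lborel. s \<noteq> 0 \<and> s \<noteq> (1::real)"
    using AE_lborel_singleton[of "0::real"] AE_lborel_singleton[of "1::real"] by eventually_elim auto
  then have "AE s in lborel. s \<in> {0..1} \<longrightarrow> 0 < v s"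
    by (rule eventually_mono) (auto intro!: v(3))
  then show ?thesis
    unfolding Ap_int_def using vint val by (auto simp: dual_fn_def Apval_def split: if_splits)
qed

theorem theorem3p2:
  fixes K :: kernel and f :: "real \<Rightarrow> real" and \<delta> \<delta>' :: real and p :: ereal
    and x :: "real \<times> real"
  assumes "f \<in> borel_measurable (restrict_space borel {0<..})"
    and "\<forall>s>0. 0 \<le> f s"
    and "1 < \<delta>'" and "\<delta>' < \<delta>"
    and "1 < p"
    and "Omega p \<delta>' x"
  shows "DpK K TYPE('n::finite) p \<delta>' f x \<le> Dp p \<delta> f x"
  unfolding DpK_def
proof (rule Sup_least, clarify)
  fix w :: "real^'n \<Rightarrow> real" and y t
  assume t: "0 < t" and A: "ApK K p \<delta>' w" and x1: "Kext K w y t = fst x"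
    and x2: "Kext K (\<lambda>u. dual_fn p (w u)) y t = snd x"
  note w = ApK_facts(1,2)[OF A t]
  \<comment> \<open>\<open>f\<close> is measurable and nonnegative on the positive half-line only;
    extension by 0 gives a function on the whole line to which the rearrangement applies, and
    \<open>w\<close> is positive almost everywhere.\<close>
  define F where "F s = (if s \<in> {0<..} then ennreal (f s) else 0)" for s
  have F: "F \<in> borel_measurable borel"
    unfolding F_def[abs_def]
    by (subst measurable_If_restrict_space_iff) (use assms(1) in \<open>simp_all del: greaterThan_iff\<close>)
  obtain v :: "real \<Rightarrow> real" where v: "v \<in> borel_measurable borel" "mono_on {0<..<1} v"
    and nn: "\<And>F :: real \<Rightarrow> ennreal. F \<in> borel_measurable borel \<Longrightarrow>
       (\<integral>\<^sup>+ u. ennreal (kern K t (y - u)) * F (w u) \<partial>lborel) = (\<integral>\<^sup>+ r. F (v r) * indicator {0..1} r \<partial>lborel)"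
    and dist: "\<And>F :: real \<Rightarrow> real. F \<in> borel_measurable borel \<Longrightarrow> Kint K (\<lambda>u. F (w u)) y t \<Longrightarrow>
       set_integrable lborel {0..1} (\<lambda>r. F (v r)) \<and> (LINT r:{0..1}|lborel. F (v r)) = Kext K (\<lambda>u. F (w u)) y t"
    by (rule quantile_rearrangement[OF t w(1), where K = K and y = y]) (rule that; simp)
  note [measurable] = w(1) v(1) F
  \<comment> \<open>\<open>w\<close> is positive only almost everywhere, so positivity of
    \<open>v\<close> must come from its distribution: by monotonicity a nonpositive value at
    \<open>r\<close> would make \<open>v\<close> nonpositive on all of \<open>{0<..r}\<close>, a set
    of positive measure, whereas \<open>w\<close> is nonpositive only on a null set.\<close>
  have v_pos: "0 < v r" if r: "0 < r" "r < 1" for r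
  proof (rule ccontr)
    assume "\<not> 0 < v r"
    then have "v r' \<le> 0" if "0 < r'" "r' \<le> r" for r'
      using v(2) that r by (force simp: monotone_on_def)
    then have "(\<integral>\<^sup>+ r'. indicator {0<..r} r' \<partial>lborel) \<le> (\<integral>\<^sup>+ r'. indicator {..0} (v r') * indicator {0..1} r' \<partial>lborel)"
      using r by (intro nn_integral_mono) (auto simp: indicator_def)
    also have "\<dots> = (\<integral>\<^sup>+ u. ennreal (kern K t (y - u)) * indicator {..0} (w u) \<partial>lborel)"
      by (rule nn[symmetric]) simp
    also have "\<dots> = (\<integral>\<^sup>+ u. 0 \<partial>(lborel :: (real^'n) measure))"
      by (rule nn_integral_cong_AE, rule eventually_mono[OF w(2)]) (auto simp: indicator_def)
    finally show False using r by simp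
  qed
  have "Ap_int p \<delta> v 0 1"
    by (rule rearrangement_Ap_int[OF assms(5,3) _ A t v v_pos dist]) (use assms(4) in auto)
  moreover have "avg v 0 1 = fst x"
    using dist[of "\<lambda>x. x"] ApK_facts(3)[OF A t, of y] by (simp add: avg_def x1)
  moreover have "avg (\<lambda>s. dual_fn p (v s)) 0 1 = snd x"
    using dist[of "dual_fn p"] ApK_facts(4)[OF A t, of y] by (simp add: avg_def x2)
  moreover have "Kext_nn K (\<lambda>u. f (w u)) y t = ennreal (1 / (1 - 0)) * (\<integral>\<^sup>+ s. ennreal (f (v s)) * indicator {0..1} s \<partial>lborel)"
  proof -
    have "Kext_nn K (\<lambda>u. f (w u)) y t = (\<integral>\<^sup>+ u. ennreal (kern K t (y - u)) * F (w u) \<partial>lborel)"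
      unfolding Kext_nn_def
      by (rule nn_integral_cong_AE, rule eventually_mono[OF w(2)])
         (simp add: F_def ennreal_mult' less_imp_le[OF kern_pos[OF t]])
    also have "\<dots> = (\<integral>\<^sup>+ r. F (v r) * indicator {0..1} r \<partial>lborel)" by (rule nn) simp
    also have "\<dots> = (\<integral>\<^sup>+ s. ennreal (f (v s)) * indicator {0..1} s \<partial>lborel)"
    proof (rule nn_integral_cong_AE)
      have "AE s in lborel. s \<noteq> 0 \<and> s \<noteq> (1::real)"
        using AE_lborel_singleton[of "0::real"] AE_lborel_singleton[of "1::real"] by eventually_elim auto
      then show "AE s in lborel. F (v s) * indicator {0..1} s = ennreal (f (v s)) * indicator {0..1} s"
        by (rule eventually_mono) (use v_pos in \<open>auto simp: F_def indicator_def\<close>)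
    qed
    finally show ?thesis by simp
  qed
  ultimately show "Kext_nn K (\<lambda>u. f (w u)) y t \<le> Dp p \<delta> f x"
    unfolding Dp_def by (intro Sup_upper CollectI exI[of _ 0] exI[of _ 1] exI[of _ v]) auto
qed

end
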